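(* The twisted Hilbert space $Z(\mathcal T^2)$ satisfies the Principle of Small Perturbations.
   Context: $\omega$ is the space of all complex sequences with pointwise convergence; $c_{00}$ is the space of finitely supported sequences. Blocks are finitely supported vectors $y_1,y_2,\dots$ with $\max\operatorname{supp}y_j<\min\operatorname{supp}y_{j+1}$. Tsirelson's space. For $x\in c_{00}$ let $\|x\|_0=\max_j|x_j|$ and $\|x\|_{n+1}=\max\{\|x\|_n,\frac12\max\sum_{j=1}^k\|A_jx\|_n\}$, where the inner maximum is over all $k$ and finite subsets $k\le A_1<\dots<A_k$ of $\mathbb N$ ($A_j<A_{j+1}$ means $\max A_j<\min A_{j+1}$; $A_jx$ is the restriction of $x$ to $A_j$). $\mathcal T$ is the completion of $c_{00}$ under $\|x\|=\lim_n\|x\|_n$. $\mathcal T^2$ (the 2-convexification) is the completion of $c_{00}$ under $\|x\|_{\mathcal T^2}=\|\,|x|^2\,\|_{\mathcal T}^{1/2}$. The space $Z(X)$. Let $X$ be a space with an unconditional basis $(e_j)$, regarded as a sequence space in $\omega$ through the basis, with $X^*$ regarded as a sequence space through $x^*\mapsto(x^*(e_j))_j$. Let $\mathbb S=\{z\in\mathbb C:0\le \operatorname{Re}z\le 1\}$. $\mathcal F_\infty(X,X^* )$ is the space of functions $F:\mathbb S\to\omega$, bounded and continuous on $\mathbb S$, analytic in its interior, such that $t\mapsto F(it)\in X$ and $t\mapsto F(1+it)\in X^*$ are bounded and continuous, with norm $\max(\sup_t\|F(it)\|_X,\sup_t\|F(1+it)\|_{X^*})$. The interpolation space $(X,X^*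 )_{1/2}=\{F(1/2):F\in\mathcal F_\infty(X,X^* )\}$ with the quotient norm equals $\ell_2$ up to an equivalent norm. Fix a homogeneous selection $x\in\ell_2\mapsto B(x)\in\mathcal F_\infty(X,X^* )$ with $B(x)(1/2)=x$ and $\|B(x)\|\le C\|x\|_2$, and put $\Omega(x)=B(x)'(1/2)\in\omega$. Then $Z(X)=\{(x,y)\in\omega\times\omega: y\in\ell_2,\ x-\Omega(y)\in\ell_2\}$ with the quasi-norm $\|(x,y)\|=\|x-\Omega(y)\|_2+\|y\|_2$, which is equivalent to a norm; different selections give equivalent quasi-norms. Principle of Small Perturbations: a twisted Hilbert space $Z$ of this form satisfies it if for every sequence $(w_j)$ in $Z$ which is equivalent to the unit vector basis of $\ell_2$ there are a subsequence $(w_{k_j})$ of $(w_j)$ and blocks $(y_j,0)$ in $Z$ such that (1) $\|(y_j,0)\|=1$ for every $j\in\mathbb N$, and (2) $\|w_{k_j}-(y_j,0)\|\le2^{-j}$ for every $j\in\mathbb N$.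
   Formalization: Condition (2) is stated for the normalised vectors w_{k_j}/‖w_{k_j}‖ instead of w_{k_j}, since as written it fails for w_j=(2e_j,0), which is equivalent to the ℓ_2 basis but stays at distance at least 1 from every norm-one (y,0). *)

theory Defs
  imports "HOL-Complex_Analysis.Complex_Analysis" "HOL-Library.Function_Algebras"
begin

(* omega is the type nat => complex with the library's product topology. Coordinates are
   counted from 0: index i stands for the coordinate i + 1 of the usual notation. *)

type_synonym omega = "nat \<Rightarrow> complex"

definition supp :: "omega \<Rightarrow> nat set" where
  "supp x = {i. x i \<noteq> 0}"

definition c00 :: "omega set" where
  "c00 = {x. finite (supp x)}"

definition unit_vec :: "nat \<Rightarrow> omega" where
  "unit_vec j = (\<lambda>i. if i = j then 1 else 0)"

definition scale :: "complex \<Rightarrow> omega \<Rightarrow> omega" where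
  "scale c x = (\<lambda>i. c * x i)"

definition restrict_to :: "nat set \<Rightarrow> omega \<Rightarrow> omega" where
  "restrict_to A x = (\<lambda>i. if i \<in> A then x i else 0)"

definition ell2 :: "omega set" where
  "ell2 = {x. summable (\<lambda>i. (cmod (x i))\<^sup>2)}"

definition ell2_norm :: "omega \<Rightarrow> real" where
  "ell2_norm x = sqrt (\<Sum>i. (cmod (x i))\<^sup>2)"

record seq_space =
  vecs :: "omega set"
  nrm :: "omega \<Rightarrow> real"


subsection \<open>Completions of \<open>c00\<close> and duals as sequence spaces\<close>

definition represents :: "(omega \<Rightarrow> real) \<Rightarrow> (nat \<Rightarrow> omega) \<Rightarrow> omega \<Rightarrow> bool" where
  "represents N u x \<longleftrightarrow>
     range u \<subseteq> c00 \<and>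
     (\<forall>e>0. \<exists>M. \<forall>m\<ge>M. \<forall>n\<ge>M. N (u m - u n) < e) \<and>
     (\<forall>i. (\<lambda>n. u n i) \<longlonglongrightarrow> x i)"

(* The elements of the completion are classes of N-Cauchy sequences in c00; a class is
   identified with its sequence of coordinates. When the unit vectors form a basis for N,
   the coordinates determine the class, so the value r below is unique. *)
definition completion :: "(omega \<Rightarrow> real) \<Rightarrow> seq_space" where
  "completion N =
     \<lparr>vecs = {x. \<exists>u. represents N u x},
      nrm = (\<lambda>x. THE r. \<exists>u. represents N u x \<and> (\<lambda>n. N (u n)) \<longlonglongrightarrow> r)\<rparr>"

(* C is a bound for a linear functional on X whose values on the unit vectors are given by y *)
definition functional_bound :: "seq_space \<Rightarrow> omega \<Rightarrow> real \<Rightarrow> bool" where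
  "functional_bound X y C \<longleftrightarrow> 0 \<le> C \<and>
     (\<exists>f :: omega \<Rightarrow> complex.
        (\<forall>x\<in>vecs X. \<forall>x'\<in>vecs X. f (x + x') = f x + f x') \<and>
        (\<forall>c. \<forall>x\<in>vecs X. f (scale c x) = c * f x) \<and>
        (\<forall>x\<in>vecs X. cmod (f x) \<le> C * nrm X x) \<and>
        (\<forall>j. f (unit_vec j) = y j))"

definition dual :: "seq_space \<Rightarrow> seq_space" where
  "dual X =
     \<lparr>vecs = {y. \<exists>C. functional_bound X y C},
      nrm = (\<lambda>y. Inf {C. functional_bound X y C})\<rparr>"


subsection \<open>Tsirelson's space and its 2-convexification\<close>

(* The condition k \<le> A_1 reads k \<le> i + 1 for i \<in> A 0, since coordinates are counted from 0. *)
definition admissible :: "nat \<Rightarrow> (nat \<Rightarrow> nat set) \<Rightarrow> bool" where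
  "admissible k A \<longleftrightarrow> 1 \<le> k \<and>
     (\<forall>j<k. finite (A j) \<and> A j \<noteq> {}) \<and>
     k \<le> Suc (Min (A 0)) \<and>
     (\<forall>j. Suc j < k \<longrightarrow> Max (A j) < Min (A (Suc j)))"

(* Only meant for arguments in c00; there both suprema are maxima. *)
primrec tsirelson_level :: "nat \<Rightarrow> omega \<Rightarrow> real" where
  "tsirelson_level 0 x = (SUP i. cmod (x i))"
| "tsirelson_level (Suc n) x =
     max (tsirelson_level n x)
         (1/2 * Sup {\<Sum>j<k. tsirelson_level n (restrict_to (A j) x) | k A. admissible k A})"

definition tsirelson_norm :: "omega \<Rightarrow> real" where
  "tsirelson_norm x = lim (\<lambda>n. tsirelson_level n x)"

definition tsirelson2_norm :: "omega \<Rightarrow> real" where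
  "tsirelson2_norm x = sqrt (tsirelson_norm (\<lambda>i. complex_of_real ((cmod (x i))\<^sup>2)))"

definition T2 :: seq_space where
  "T2 = completion tsirelson2_norm"


subsection \<open>Complex interpolation and the twisted Hilbert space\<close>

definition strip :: "complex set" where
  "strip = {z. 0 \<le> Re z \<and> Re z \<le> 1}"

definition bounded_continuous_into :: "seq_space \<Rightarrow> (real \<Rightarrow> omega) \<Rightarrow> bool" where
  "bounded_continuous_into X g \<longleftrightarrow>
     range g \<subseteq> vecs X \<and>
     bdd_above (range (\<lambda>t. nrm X (g t))) \<and>
     (\<forall>t. ((\<lambda>s. nrm X (g s - g t)) \<longlongrightarrow> 0) (at t))"

(* Boundedness and analyticity of omega-valued functions are coordinatewise; the library's
   metric on nat => complex is bounded, so its predicate bounded would be vacuous there.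
   Values of F outside the strip are irrelevant. *)
definition calderon :: "seq_space \<Rightarrow> seq_space \<Rightarrow> (complex \<Rightarrow> omega) set" where
  "calderon X Y =
     {F. (\<forall>i. bounded ((\<lambda>z. F z i) ` strip)) \<and>
         continuous_on strip F \<and>
         (\<forall>i. (\<lambda>z. F z i) analytic_on interior strip) \<and>
         bounded_continuous_into X (\<lambda>t. F (\<i> * complex_of_real t)) \<and>
         bounded_continuous_into Y (\<lambda>t. F (1 + \<i> * complex_of_real t))}"

definition calderon_norm :: "seq_space \<Rightarrow> seq_space \<Rightarrow> (complex \<Rightarrow> omega) \<Rightarrow> real" where
  "calderon_norm X Y F =
     max (SUP t. nrm X (F (\<i> * complex_of_real t)))
         (SUP t. nrm Y (F (1 + \<i> * complex_of_real t)))"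

definition homogeneous_selection :: "seq_space \<Rightarrow> (omega \<Rightarrow> complex \<Rightarrow> omega) \<Rightarrow> bool" where
  "homogeneous_selection X B \<longleftrightarrow>
     (\<forall>x\<in>ell2. B x \<in> calderon X (dual X) \<and> B x (1/2) = x) \<and>
     (\<exists>C. \<forall>x\<in>ell2. calderon_norm X (dual X) (B x) \<le> C * ell2_norm x) \<and>
     (\<forall>x\<in>ell2. \<forall>c. \<forall>z\<in>strip. B (scale c x) z = scale c (B x z))"

definition Omega :: "(omega \<Rightarrow> complex \<Rightarrow> omega) \<Rightarrow> omega \<Rightarrow> omega" where
  "Omega B x = (\<lambda>i. deriv (\<lambda>z. B x z i) (1/2))"

(* For a homogeneous selection B for the couple of X and its dual, Z_space B and Z_norm B are
   Z(X) and its quasi-norm; they depend on X only through B. *)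
definition Z_space :: "(omega \<Rightarrow> complex \<Rightarrow> omega) \<Rightarrow> (omega \<times> omega) set" where
  "Z_space B = {(x, y). y \<in> ell2 \<and> x - Omega B y \<in> ell2}"

definition Z_norm :: "(omega \<Rightarrow> complex \<Rightarrow> omega) \<Rightarrow> omega \<times> omega \<Rightarrow> real" where
  "Z_norm B = (\<lambda>(x, y). ell2_norm (x - Omega B y) + ell2_norm y)"

definition scale_pair :: "complex \<Rightarrow> omega \<times> omega \<Rightarrow> omega \<times> omega" where
  "scale_pair c = (\<lambda>(x, y). (scale c x, scale c y))"


subsection \<open>The Principle of Small Perturbations\<close>

definition equivalent_to_ell2_basis ::
    "(omega \<times> omega \<Rightarrow> real) \<Rightarrow> (nat \<Rightarrow> omega \<times> omega) \<Rightarrow> bool" where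
  "equivalent_to_ell2_basis N w \<longleftrightarrow>
     (\<exists>c>0. \<exists>C. \<forall>n. \<forall>a :: nat \<Rightarrow> complex.
        c * sqrt (\<Sum>j<n. (cmod (a j))\<^sup>2) \<le> N (\<Sum>j<n. scale_pair (a j) (w j)) \<and>
        N (\<Sum>j<n. scale_pair (a j) (w j)) \<le> C * sqrt (\<Sum>j<n. (cmod (a j))\<^sup>2))"

definition block_sequence :: "(nat \<Rightarrow> omega) \<Rightarrow> bool" where
  "block_sequence y \<longleftrightarrow>
     (\<forall>j. y j \<in> c00) \<and> (\<forall>j. \<forall>a\<in>supp (y j). \<forall>b\<in>supp (y (Suc j)). a < b)"

(* The approximated vectors are normalised: since the blocks have norm one, the unnormalised
   condition fails for w j = (2 e_j, 0), which is equivalent to the basis of l_2 in every space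
   of this form. For normalised w the factor 1 / norm is 1. Sequences are indexed from 0,
   so the j-th error is 2 to the power -(j + 1). *)
definition small_perturbations ::
    "(omega \<times> omega) set \<Rightarrow> (omega \<times> omega \<Rightarrow> real) \<Rightarrow> bool" where
  "small_perturbations Z N \<longleftrightarrow>
     (\<forall>w. range w \<subseteq> Z \<and> equivalent_to_ell2_basis N w \<longrightarrow>
        (\<exists>k y. strict_mono (k :: nat \<Rightarrow> nat) \<and> block_sequence y \<and>
           (\<forall>j. (y j, 0) \<in> Z \<and> N (y j, 0) = 1 \<and>
                N (scale_pair (complex_of_real (1 / N (w (k j)))) (w (k j)) - (y j, 0))
                  \<le> (1/2) ^ Suc j)))"

end

theory Submission imports Defs begin

text \<open>
  Let \<open>w j = (x j, y j)\<close> be equivalent to the basis of \<open>\<ell>\<^sub>2\<close>. All coordinates of \<open>x j\<close> and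
  \<open>y j\<close> tend to zero, so if \<open>y j\<close> is small in \<open>\<ell>\<^sub>2\<close> along a subsequence, then
  \<open>x j - \<Omega> (y j)\<close> is close to a block sequence, and so is \<open>w j\<close> in \<open>Z\<close>.

  Otherwise the \<open>y j\<close> contain almost blocks \<open>u j\<close> on whose span \<open>\<Omega>\<close> is, up to a bounded error,
  linear and acts blockwise. For finitely supported \<open>v\<close> of norm \<open>s\<close>, maximising
  \<open>\<Sum>i. \<bar>v i\<bar>\<^sup>2 ln (f i)\<close> over the unit ball of \<open>\<T>\<^sup>2\<close> gives a factorisation of
  \<open>\<bar>v\<bar>\<^sup>2\<close> into \<open>\<phi> = s f\<close> and \<open>\<bar>v\<bar>\<^sup>2 / \<phi>\<close>, both of norm at most \<open>s\<close> in the
  space and its dual, and \<open>\<Omega> v\<close> equals \<open>- 2 v ln (\<phi> / \<bar>v\<bar>)\<close> up to an error of order \<open>s\<close>. Hence the factor of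
  \<open>\<Sum>j. a j u j\<close> is comparable with \<open>\<Sum>j. a j \<phi> j\<close>, which forces the factors \<open>\<phi> j\<close> to dominate
  the basis of \<open>\<ell>\<^sub>2\<close> in \<open>\<T>\<^sup>2\<close>. Their squares then span a copy of \<open>\<ell>\<^sub>1\<close> in
  Tsirelson's space, which contains none.
\<close>

subsection \<open>Lattice norms on finitely supported sequences\<close>

text \<open>\<open>\<Omega>\<close> is not linear, and the selection \<open>B\<close> is arbitrary.
  The main analytic fact is that two extensions of the same vector to the strip have derivatives at
  1/2 whose difference is bounded in l_2 by their norms. So \<open>\<Omega>\<close> may be read off,
  up to a bounded error, from any convenient extension: a sum of selected ones, or an explicit one
  built from a Lozanovskii factorisation.

  Linearity on the \<open>u j\<close> comes from the upper l_2 estimate: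
  \<open>\<Omega> (\<Sum>j. a j y j)\<close> is close to \<open>\<Sum>j. a j x j\<close>, which is
  linear in the coefficients. The obstacle is to cut to blocks with summable errors: the
  \<open>x j\<close> need not lie in l_2, and the norm of a vector controls only the coordinates of
  its image under \<open>\<Omega>\<close>, not the l_2 norm. The lower estimate keeps the norms of
  the \<open>w j\<close> away from zero.

  Disjointness turns the squared norm of \<open>\<Sum>j. a j \<phi> j\<close> in the
  2-convexification into the Tsirelson norm of \<open>\<Sum>j. (a j)^2 (\<phi> j)^2\<close>; this is
  how l_2 becomes l_1. Nonnegative coefficients suffice, because l_1 is excluded by an argument
  about convex hulls.\<close>

lemma c00_iff_bound: "x \<in> c00 \<longleftrightarrow> (\<exists>n. \<forall>i\<ge>n. x i = 0)"
proof
  assume "x \<in> c00"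
  then show "\<exists>n. \<forall>i\<ge>n. x i = 0"
    unfolding c00_def supp_def by (auto simp: finite_nat_set_iff_bounded) (meson linorder_not_less)
next
  assume "\<exists>n. \<forall>i\<ge>n. x i = 0"
  then obtain n where n: "\<forall>i\<ge>n. x i = 0" by blast
  then have "supp x \<subseteq> {..<n}" by (auto simp: supp_def not_le[symmetric])
  then show "x \<in> c00" by (simp add: c00_def finite_subset)
qed

lemma c00_bound:
  assumes "x \<in> c00" obtains n where "\<And>i. n \<le> i \<Longrightarrow> x i = 0"
  using assms c00_iff_bound by blast

lemma c00_cmod_mono:
  assumes "y \<in> c00" and "\<And>i. cmod (x i) \<le> cmod (y i)" shows "x \<in> c00"
proof -
  have "y i = 0 \<Longrightarrow> x i = 0" for i using assms(2)[of i] by simp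
  then have "supp x \<subseteq> supp y" by (auto simp: supp_def)
  then show ?thesis using assms(1) by (auto simp: c00_def intro: finite_subset)
qed

lemma c00_zero [simp]: "0 \<in> c00" "(\<lambda>i. 0) \<in> c00"
  by (auto simp: c00_def supp_def)

lemma c00_add [simp]: "x \<in> c00 \<Longrightarrow> y \<in> c00 \<Longrightarrow> x + y \<in> c00"
  unfolding c00_def supp_def
  by (auto intro: finite_subset[of _ "{i. x i \<noteq> 0} \<union> {i. y i \<noteq> 0}"])

lemma c00_scale [simp]: "x \<in> c00 \<Longrightarrow> scale c x \<in> c00"
  unfolding c00_def supp_def scale_def by (auto intro: finite_subset[of _ "{i. x i \<noteq> 0}"])

lemma c00_diff [simp]: "x \<in> c00 \<Longrightarrow> y \<in> c00 \<Longrightarrow> x - y \<in> c00"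
  unfolding c00_def supp_def
  by (auto intro: finite_subset[of _ "{i. x i \<noteq> 0} \<union> {i. y i \<noteq> 0}"])

lemma c00_restrict [simp]: "x \<in> c00 \<Longrightarrow> restrict_to A x \<in> c00"
  by (rule c00_cmod_mono) (auto simp: restrict_to_def)

lemma cmod_restrict_le [simp]: "cmod (restrict_to A x i) \<le> cmod (x i)"
  by (simp add: restrict_to_def)

lemma restrict_add: "restrict_to A (x + y) = restrict_to A x + restrict_to A y"
  by (auto simp: restrict_to_def)

lemma restrict_scale: "restrict_to A (scale c x) = scale c (restrict_to A x)"
  by (auto simp: restrict_to_def scale_def)

lemma c00_restrict_lessThan [simp]: "restrict_to {..<n} x \<in> c00"
  unfolding c00_iff_bound restrict_to_def by (auto intro: exI[of _ n])

lemma c00_unit_vec [simp]: "unit_vec j \<in> c00"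
  unfolding c00_iff_bound unit_vec_def by (auto intro: exI[of _ "Suc j"])

lemma c00_sum: "(\<And>j. j \<in> A \<Longrightarrow> x j \<in> c00) \<Longrightarrow> sum x A \<in> c00"
  by (induction A rule: infinite_finite_induct) auto

lemma sum_omega_apply: "(sum x A) i = (\<Sum>j\<in>A. x j i)" for x :: "'a \<Rightarrow> omega"
  by (induction A rule: infinite_finite_induct) auto

text \<open>The largest norm with normalised unit vectors. It bounds the suprema in the recursion
  and gives continuity of every \<open>lattice_norm\<close> in finitely many coordinates.\<close>

definition ell1_norm :: "omega \<Rightarrow> real" where
  "ell1_norm x = (\<Sum>i\<in>supp x. cmod (x i))"

lemma ell1_norm_superset:
  "finite A \<Longrightarrow> supp x \<subseteq> A \<Longrightarrow> ell1_norm x = (\<Sum>i\<in>A. cmod (x i))"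
  unfolding ell1_norm_def by (rule sum.mono_neutral_left) (auto simp: supp_def)

lemma c00_decomp:
  assumes "\<And>i. n \<le> i \<Longrightarrow> x i = 0"
  shows "x = (\<Sum>j<n. scale (x j) (unit_vec j))"
proof
  fix i show "x i = (\<Sum>j<n. scale (x j) (unit_vec j)) i"
    using assms[of i] by (auto simp: sum_omega_apply scale_def unit_vec_def if_distrib sum.delta cong: if_cong)
qed

text \<open>\<open>mono\<close> contains 1-unconditionality: the norm depends on absolute values
  only, and restrictions do not increase it. The axioms stay on \<open>c00\<close> because the
  recursive norms are suprema that are meant only there.\<close>

locale lattice_norm =
  fixes N :: "omega \<Rightarrow> real"
  assumes triangle: "x \<in> c00 \<Longrightarrow> y \<in> c00 \<Longrightarrow> N (x + y) \<le> N x + N y"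
    and homog: "x \<in> c00 \<Longrightarrow> N (scale c x) = cmod c * N x"
    and mono: "x \<in> c00 \<Longrightarrow> y \<in> c00 \<Longrightarrow> (\<And>i. cmod (x i) \<le> cmod (y i)) \<Longrightarrow> N x \<le> N y"
    and unit: "N (unit_vec i) = 1"
begin

lemma zero: "N 0 = 0" "N (\<lambda>i. 0) = 0"
proof -
  have "N (scale 0 0) = 0" using homog[of 0 0] by simp
  then show "N (\<lambda>i. 0) = 0" "N 0 = 0" by (auto simp: scale_def zero_fun_def)
qed

lemma nonneg: "x \<in> c00 \<Longrightarrow> 0 \<le> N x"
  using mono[of 0 x] by (simp add: zero)

lemma cmod_cong: "x \<in> c00 \<Longrightarrow> (\<And>i. cmod (x i) = cmod (y i)) \<Longrightarrow> N x = N y"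
  by (metis c00_cmod_mono mono order_antisym order_refl)

lemma sum_le: "(\<And>j. j \<in> A \<Longrightarrow> x j \<in> c00) \<Longrightarrow> N (sum x A) \<le> (\<Sum>j\<in>A. N (x j))"
proof (induction A rule: infinite_finite_induct)
  case (insert a A)
  have "N (x a + sum x A) \<le> N (x a) + N (sum x A)"
    using insert by (intro triangle c00_sum) auto
  also have "N (sum x A) \<le> (\<Sum>j\<in>A. N (x j))" using insert by auto
  finally show ?case using insert by (metis sum.insert add_left_mono)
qed (auto simp: zero)

lemma le_ell1: assumes "x \<in> c00" shows "N x \<le> ell1_norm x"
proof -
  obtain n where n: "\<And>i. n \<le> i \<Longrightarrow> x i = 0" using c00_bound[OF assms] by blast
  have "N x = N (\<Sum>j<n. scale (x j) (unit_vec j))" using c00_decomp[of n x] n by simp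
  also have "\<dots> \<le> (\<Sum>j<n. N (scale (x j) (unit_vec j)))" by (rule sum_le) simp
  also have "\<dots> = (\<Sum>j<n. cmod (x j))" by (simp add: homog unit)
  also have "\<dots> = ell1_norm x"
    using n by (intro ell1_norm_superset[symmetric]) (auto simp: supp_def not_le[symmetric])
  finally show ?thesis .
qed

lemma coord_le: assumes "x \<in> c00" shows "cmod (x i) \<le> N x"
proof -
  have "cmod (x i) = N (scale (x i) (unit_vec i))" by (simp add: homog unit)
  also have "\<dots> \<le> N x" using assms
    by (intro mono c00_scale c00_unit_vec) (auto simp: scale_def unit_vec_def)
  finally show ?thesis .
qed

lemma restrict_le: "x \<in> c00 \<Longrightarrow> N (restrict_to A x) \<le> N x"
  by (rule mono) auto

lemma minus_commute: "x \<in> c00 \<Longrightarrow> y \<in> c00 \<Longrightarrow> N (x - y) = N (y - x)"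
  by (rule cmod_cong) (auto simp: norm_minus_commute)

lemma diff_le: "x \<in> c00 \<Longrightarrow> y \<in> c00 \<Longrightarrow> \<bar>N x - N y\<bar> \<le> N (x - y)"
  using triangle[of "x - y" y] triangle[of "y - x" x] minus_commute[of x y] by auto

end

subsection \<open>The norms of Tsirelson's space and of its 2-convexification\<close>

text \<open>The inner set of the recursion, with the previous level abstracted to \<open>N\<close>,
  so that one step of the recursion can be treated for any \<open>lattice_norm\<close>.\<close>

definition tsirelson_sums :: "(omega \<Rightarrow> real) \<Rightarrow> omega \<Rightarrow> real set" where
  "tsirelson_sums N x = {\<Sum>j<k. N (restrict_to (A j) x) | k A. admissible k A}"

text \<open>\<open>admissible\<close> compares consecutive sets only; the order passes through the
  sets in between because they are nonempty, so that their minimum is at most their maximum.\<close>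

lemma admissible_less:
  assumes "admissible k A" and "i < j" and "j < k" and "a \<in> A i" and "b \<in> A j"
  shows "a < b"
proof -
  have *: "Max (A i) < Min (A j)" using assms(2,3)
  proof (induction j)
    case (Suc j)
    have fin: "finite (A j)" "A j \<noteq> {}" using assms(1) Suc.prems by (auto simp: admissible_def)
    have step: "Max (A j) < Min (A (Suc j))" using assms(1) Suc.prems by (auto simp: admissible_def)
    show ?case
    proof (cases "i = j")
      case False
      then have "Max (A i) < Min (A j)" using Suc by auto
      also have "\<dots> \<le> Max (A j)" using fin by simp
      finally show ?thesis using step by simp
    qed (use step in simp)
  qed simp
  have "finite (A i)" "finite (A j)" using assms by (auto simp: admissible_def)
  then have "a \<le> Max (A i)" "Min (A j) \<le> b" using assms by auto
  then show ?thesis using * by linarith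
qed

lemma admissible_disjoint:
  assumes "admissible k A" shows "disjoint_family_on A {..<k}"
  unfolding disjoint_family_on_def
proof safe
  fix i j x assume "i < k" "j < k" "i \<noteq> j" "x \<in> A i" "x \<in> A j"
  then show "x \<in> {}"
    using admissible_less[OF assms, of i j x x] admissible_less[OF assms, of j i x x]
    by (cases "i < j") auto
qed

lemma admissible_exists: "admissible 1 (\<lambda>j. {0})"
  by (simp add: admissible_def)

context lattice_norm
begin

text \<open>The pieces are disjoint, so their l_1 norms add up to at most that of the whole
  vector.\<close>

lemma admissible_sum_le:
  assumes "x \<in> c00" and "admissible k A"
  shows "(\<Sum>j<k. N (restrict_to (A j) x)) \<le> ell1_norm x"
proof -
  have fin: "finite (supp x)" using assms by (simp add: c00_def)
  have "(\<Sum>j<k. N (restrict_to (A j) x)) \<le> (\<Sum>j<k. ell1_norm (restrict_to (A j) x))"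
    using assms by (intro sum_mono le_ell1) auto
  also have "\<dots> = (\<Sum>j<k. \<Sum>i\<in>supp x \<inter> A j. cmod (x i))"
  proof (rule sum.cong)
    fix j
    have "supp (restrict_to (A j) x) = supp x \<inter> A j" by (auto simp: supp_def restrict_to_def)
    then show "ell1_norm (restrict_to (A j) x) = (\<Sum>i\<in>supp x \<inter> A j. cmod (x i))"
      unfolding ell1_norm_def by (auto simp: restrict_to_def intro: sum.cong)
  qed simp
  also have "\<dots> = (\<Sum>i\<in>(\<Union>j<k. supp x \<inter> A j). cmod (x i))"
    using fin admissible_disjoint[OF assms(2)]
    by (subst sum.UNION_disjoint) (auto simp: disjoint_family_on_def)
  also have "\<dots> \<le> ell1_norm x"
    unfolding ell1_norm_def using fin by (intro sum_mono2) auto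
  finally show ?thesis .
qed

lemma tsirelson_sums_bdd: "x \<in> c00 \<Longrightarrow> bdd_above (tsirelson_sums N x)"
  unfolding tsirelson_sums_def by (rule bdd_aboveI[of _ "ell1_norm x"]) (auto intro: admissible_sum_le)

lemma tsirelson_sums_nonempty: "tsirelson_sums N x \<noteq> {}"
  unfolding tsirelson_sums_def using admissible_exists by blast

lemma tsirelson_sumsI:
  "x \<in> c00 \<Longrightarrow> admissible k A \<Longrightarrow> (\<Sum>j<k. N (restrict_to (A j) x)) \<le> Sup (tsirelson_sums N x)"
  by (rule cSup_upper[OF _ tsirelson_sums_bdd]) (auto simp: tsirelson_sums_def)

lemma tsirelson_sums_leI:
  "(\<And>k A. admissible k A \<Longrightarrow> (\<Sum>j<k. N (restrict_to (A j) x)) \<le> r) \<Longrightarrow> Sup (tsirelson_sums N x) \<le> r"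
  by (rule cSup_least[OF tsirelson_sums_nonempty]) (auto simp: tsirelson_sums_def)

text \<open>Suprema of sums of norms inherit the triangle inequality, homogeneity and monotonicity.
  Normalisation survives because the sums for a unit vector are at most its l_1 norm 1, and are then
  halved.\<close>

lemma tsirelson_step:
  "lattice_norm (\<lambda>x. max (N x) (1/2 * Sup (tsirelson_sums N x)))"
proof
  let ?S = "\<lambda>x. Sup (tsirelson_sums N x)"
  fix x y assume x: "x \<in> c00" and y: "y \<in> c00"
  have "?S (x + y) \<le> ?S x + ?S y"
  proof (rule tsirelson_sums_leI)
    fix k A assume a: "admissible k A"
    have "(\<Sum>j<k. N (restrict_to (A j) (x + y))) \<le> (\<Sum>j<k. N (restrict_to (A j) x) + N (restrict_to (A j) y))"
    proof (rule sum_mono)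
      fix j
      show "N (restrict_to (A j) (x + y)) \<le> N (restrict_to (A j) x) + N (restrict_to (A j) y)"
        using x y by (simp add: restrict_add triangle)
    qed
    also have "\<dots> \<le> ?S x + ?S y"
      unfolding sum.distrib using x y a by (intro add_mono tsirelson_sumsI)
    finally show "(\<Sum>j<k. N (restrict_to (A j) (x + y))) \<le> ?S x + ?S y" .
  qed
  then show "max (N (x + y)) (1/2 * ?S (x + y)) \<le> max (N x) (1/2 * ?S x) + max (N y) (1/2 * ?S y)"
    using triangle[OF x y] by linarith
  assume le: "\<And>i. cmod (x i) \<le> cmod (y i)"
  have "?S x \<le> ?S y"
  proof (rule tsirelson_sums_leI)
    fix k A assume a: "admissible k A"
    have "(\<Sum>j<k. N (restrict_to (A j) x)) \<le> (\<Sum>j<k. N (restrict_to (A j) y))"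
      using x y le by (intro sum_mono mono c00_restrict) (auto simp: restrict_to_def)
    also have "\<dots> \<le> ?S y" using y a by (rule tsirelson_sumsI)
    finally show "(\<Sum>j<k. N (restrict_to (A j) x)) \<le> ?S y" .
  qed
  then show "max (N x) (1/2 * ?S x) \<le> max (N y) (1/2 * ?S y)"
    using mono[OF x y le] by linarith
next
  let ?S = "\<lambda>x. Sup (tsirelson_sums N x)"
  fix x and c :: complex assume x: "x \<in> c00"
  have le: "?S (scale c x) \<le> cmod c * ?S x" if x: "x \<in> c00" for c x
  proof (rule tsirelson_sums_leI)
    fix k A assume a: "admissible k A"
    have "(\<Sum>j<k. N (restrict_to (A j) (scale c x))) = cmod c * (\<Sum>j<k. N (restrict_to (A j) x))"
      using x by (simp add: restrict_scale homog sum_distrib_left)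
    also have "\<dots> \<le> cmod c * ?S x" using x a by (intro mult_left_mono tsirelson_sumsI) auto
    finally show "(\<Sum>j<k. N (restrict_to (A j) (scale c x))) \<le> cmod c * ?S x" .
  qed
  have "?S (scale c x) = cmod c * ?S x"
  proof (cases "c = 0")
    case True
    have "(\<Sum>j<1::nat. N (restrict_to {0} (scale 0 x))) \<le> ?S (scale 0 x)"
      using tsirelson_sumsI[OF c00_scale[OF x] admissible_exists] .
    moreover have "restrict_to {0} (scale 0 x) = 0" by (auto simp: restrict_to_def scale_def)
    ultimately have "0 \<le> ?S (scale 0 x)" by (simp add: zero)
    then show ?thesis using le[OF x, of 0] True by simp
  next
    case False
    have "?S (scale (inverse c) (scale c x)) \<le> cmod (inverse c) * ?S (scale c x)"
      using x by (intro le) auto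
    moreover have "scale (inverse c) (scale c x) = x" using False by (auto simp: scale_def)
    ultimately have "cmod c * ?S x \<le> ?S (scale c x)"
      using False by (simp add: norm_inverse norm_divide field_simps)
    then show ?thesis using le[OF x, of c] by simp
  qed
  then show "max (N (scale c x)) (1/2 * ?S (scale c x)) = cmod c * max (N x) (1/2 * ?S x)"
    using homog[OF x, of c] by (simp add: max_mult_distrib_left)
next
  fix i
  have "ell1_norm (unit_vec i) = 1"
    by (subst ell1_norm_superset[of "{i}"]) (auto simp: supp_def unit_vec_def)
  then have "Sup (tsirelson_sums N (unit_vec i)) \<le> 1"
    by (intro tsirelson_sums_leI) (metis admissible_sum_le c00_unit_vec)
  then show "max (N (unit_vec i)) (1/2 * Sup (tsirelson_sums N (unit_vec i))) = 1"
    by (simp add: unit)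
qed

end

lemma sup_norm_bdd: "x \<in> c00 \<Longrightarrow> bdd_above (range (\<lambda>i. cmod (x i)))"
proof -
  assume "x \<in> c00"
  then have "finite (supp x)" by (simp add: c00_def)
  moreover have "range (\<lambda>i. cmod (x i)) \<subseteq> insert 0 ((\<lambda>i. cmod (x i)) ` supp x)"
    by (auto simp: supp_def)
  ultimately have "finite (range (\<lambda>i. cmod (x i)))" by (meson finite.insertI finite_imageI finite_subset)
  then show ?thesis by simp
qed

lemma lattice_norm_sup: "lattice_norm (\<lambda>x. SUP i. cmod (x i))"
proof
  fix x y assume x: "x \<in> c00" and y: "y \<in> c00"
  show "(SUP i. cmod ((x + y) i)) \<le> (SUP i. cmod (x i)) + (SUP i. cmod (y i))"
    by (rule cSUP_least)
       (auto intro!: order.trans[OF norm_triangle_ineq] add_mono cSUP_upper sup_norm_bdd x y)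
  assume "\<And>i. cmod (x i) \<le> cmod (y i)"
  then show "(SUP i. cmod (x i)) \<le> (SUP i. cmod (y i))"
    by (intro cSUP_mono sup_norm_bdd y) auto
next
  fix x and c :: complex assume x: "x \<in> c00"
  show "(SUP i. cmod (scale c x i)) = cmod c * (SUP i. cmod (x i))"
    unfolding scale_def norm_mult
  proof (rule antisym)
    show "(SUP i. cmod c * cmod (x i)) \<le> cmod c * (SUP i. cmod (x i))"
      by (rule cSUP_least) (auto intro!: mult_left_mono cSUP_upper sup_norm_bdd x)
    have bdd: "bdd_above (range (\<lambda>i. cmod c * cmod (x i)))"
      using sup_norm_bdd[OF c00_scale[OF x, of c]] by (simp add: scale_def norm_mult)
    show "cmod c * (SUP i. cmod (x i)) \<le> (SUP i. cmod c * cmod (x i))"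
    proof (cases "c = 0")
      case False
      have "(SUP i. cmod (x i)) \<le> (SUP i. cmod c * cmod (x i)) / cmod c"
      proof (rule cSUP_least)
        fix i
        have "cmod c * cmod (x i) \<le> (SUP i. cmod c * cmod (x i))" by (rule cSUP_upper[OF _ bdd]) simp
        then show "cmod (x i) \<le> (SUP i. cmod c * cmod (x i)) / cmod c"
          using False by (simp add: field_simps)
      qed simp
      then show ?thesis using False by (simp add: field_simps)
    qed simp
  qed
next
  fix i
  show "(SUP j. cmod (unit_vec i j)) = 1"
  proof (rule antisym)
    show "(SUP j. cmod (unit_vec i j)) \<le> 1" by (rule cSUP_least) (auto simp: unit_vec_def)
    show "1 \<le> (SUP j. cmod (unit_vec i j))"
      by (rule cSUP_upper2[where x = i]) (auto simp: unit_vec_def intro!: sup_norm_bdd[OF c00_unit_vec, unfolded unit_vec_def])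
  qed
qed

section \<open>The limit of the levels and the implicit equation of Tsirelson's norm\<close>

lemma tsirelson_level_Suc:
  "tsirelson_level (Suc n) x = max (tsirelson_level n x) (1/2 * Sup (tsirelson_sums (tsirelson_level n) x))"
  by (simp add: tsirelson_sums_def)

lemma level_norm: "lattice_norm (tsirelson_level n)"
proof (induction n)
  case 0 show ?case using lattice_norm_sup by (simp add: tsirelson_level.simps(1)[abs_def])
next
  case (Suc n)
  then show ?case using lattice_norm.tsirelson_step[OF Suc] tsirelson_level_Suc by presburger
qed

lemma level_mono: "incseq (\<lambda>n. tsirelson_level n x)"
  by (rule incseq_SucI) simp

lemma level_tendsto:
  assumes "x \<in> c00" shows "(\<lambda>n. tsirelson_level n x) \<longlonglongrightarrow> tsirelson_norm x"
proof -
  have "tsirelson_level n x \<le> ell1_norm x" for n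
    using lattice_norm.le_ell1[OF level_norm assms] .
  then have "convergent (\<lambda>n. tsirelson_level n x)"
    using level_mono by (metis incseq_convergent convergent_def)
  then show ?thesis unfolding tsirelson_norm_def by (simp add: convergent_LIMSEQ_iff)
qed

lemma tsirelson_level_le: "x \<in> c00 \<Longrightarrow> tsirelson_level n x \<le> tsirelson_norm x"
  using incseq_le[OF level_mono level_tendsto] .

lemma lattice_norm_tsirelson: "lattice_norm tsirelson_norm"
proof
  fix x y assume x: "x \<in> c00" and y: "y \<in> c00"
  show "tsirelson_norm (x + y) \<le> tsirelson_norm x + tsirelson_norm y"
    by (rule LIMSEQ_le[OF level_tendsto tendsto_add[OF level_tendsto level_tendsto]])
       (auto simp: x y intro!: exI[of _ 0] lattice_norm.triangle[OF level_norm])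
  assume le: "\<And>i. cmod (x i) \<le> cmod (y i)"
  show "tsirelson_norm x \<le> tsirelson_norm y"
    by (rule LIMSEQ_le[OF level_tendsto level_tendsto])
       (auto simp: x y le intro!: exI[of _ 0] lattice_norm.mono[OF level_norm])
next
  fix x and c :: complex assume x: "x \<in> c00"
  have "(\<lambda>n. tsirelson_level n (scale c x)) \<longlonglongrightarrow> cmod c * tsirelson_norm x"
    unfolding lattice_norm.homog[OF level_norm x]
    by (intro tendsto_mult tendsto_const level_tendsto x)
  then show "tsirelson_norm (scale c x) = cmod c * tsirelson_norm x"
    using LIMSEQ_unique level_tendsto[OF c00_scale[OF x]] by blast
next
  fix i
  have "(\<lambda>n. tsirelson_level n (unit_vec i)) \<longlonglongrightarrow> 1"
    by (simp add: lattice_norm.unit[OF level_norm])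
  then show "tsirelson_norm (unit_vec i) = 1"
    using LIMSEQ_unique level_tendsto[OF c00_unit_vec] by blast
qed

text \<open>One half of the implicit equation for the norm: the recursion bounds the sums at level n
  by twice level n + 1, and n tends to infinity.\<close>

lemma tsirelson_lower:
  assumes x: "x \<in> c00" and a: "admissible k A"
  shows "(\<Sum>j<k. tsirelson_norm (restrict_to (A j) x)) \<le> 2 * tsirelson_norm x"
proof (rule LIMSEQ_le_const2)
  show "(\<lambda>n. \<Sum>j<k. tsirelson_level n (restrict_to (A j) x)) \<longlonglongrightarrow> (\<Sum>j<k. tsirelson_norm (restrict_to (A j) x))"
    using x by (intro tendsto_sum level_tendsto) simp
  have "(\<Sum>j<k. tsirelson_level n (restrict_to (A j) x)) \<le> 2 * tsirelson_norm x" for n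
  proof -
    have "(\<Sum>j<k. tsirelson_level n (restrict_to (A j) x)) \<le> Sup (tsirelson_sums (tsirelson_level n) x)"
      using lattice_norm.tsirelson_sumsI[OF level_norm x a] .
    also have "\<dots> \<le> 2 * tsirelson_level (Suc n) x"
      unfolding tsirelson_level_Suc by linarith
    also have "\<dots> \<le> 2 * tsirelson_norm x" by (rule mult_left_mono[OF tsirelson_level_le[OF x]]) simp
    finally show ?thesis .
  qed
  then show "\<exists>M. \<forall>n\<ge>M. (\<Sum>j<k. tsirelson_level n (restrict_to (A j) x)) \<le> 2 * tsirelson_norm x"
    by blast
qed

text \<open>The other half of the implicit equation, by induction on the levels: the norm is the
  least number above the coordinates and the halved sums. From here on the levels are no longer
  mentioned.\<close>

lemma tsirelson_leI:
  assumes x: "x \<in> c00" and coord: "\<And>i. cmod (x i) \<le> r"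
    and sums: "\<And>k A. admissible k A \<Longrightarrow> (\<Sum>j<k. tsirelson_norm (restrict_to (A j) x)) \<le> 2 * r"
  shows "tsirelson_norm x \<le> r"
proof -
  have "tsirelson_level n x \<le> r" for n
  proof (induction n)
    case 0 show ?case by (simp add: cSUP_least coord)
  next
    case (Suc n)
    have "Sup (tsirelson_sums (tsirelson_level n) x) \<le> 2 * r"
    proof (rule lattice_norm.tsirelson_sums_leI[OF level_norm])
      fix k A assume a: "admissible k A"
      have "(\<Sum>j<k. tsirelson_level n (restrict_to (A j) x)) \<le> (\<Sum>j<k. tsirelson_norm (restrict_to (A j) x))"
        using x by (intro sum_mono tsirelson_level_le) simp
      also have "\<dots> \<le> 2 * r" using sums[OF a] .
      finally show "(\<Sum>j<k. tsirelson_level n (restrict_to (A j) x)) \<le> 2 * r" .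
    qed
    then show ?case unfolding tsirelson_level_Suc using Suc by simp
  qed
  then show ?thesis using LIMSEQ_le_const2[OF level_tendsto[OF x]] by blast
qed

section \<open>The 2-convexification\<close>

definition sq_abs :: "omega \<Rightarrow> omega" where
  "sq_abs x = (\<lambda>i. complex_of_real ((cmod (x i))\<^sup>2))"

lemma c00_sq_abs [simp]: "x \<in> c00 \<Longrightarrow> sq_abs x \<in> c00"
  by (auto simp: c00_def supp_def sq_abs_def)

lemma tsirelson2_eq: "tsirelson2_norm x = sqrt (tsirelson_norm (sq_abs x))"
  by (simp add: tsirelson2_norm_def sq_abs_def)

text \<open>For positive a and b the choice s = b / a gives equality. Being linear in the two
  squares, the bound can be passed through the Tsirelson norm, where it replaces the Cauchy-Schwarz
  inequality.\<close>

lemma square_sum_le_weighted: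
  fixes a b s :: real assumes "0 < s"
  shows "(a + b)\<^sup>2 \<le> (1 + s) * a\<^sup>2 + (1 + 1 / s) * b\<^sup>2"
proof -
  have "0 \<le> (s * a - b)\<^sup>2 / s" using assms by simp
  also have "\<dots> = s * a\<^sup>2 - 2 * a * b + b\<^sup>2 / s"
    using assms by (simp add: power2_eq_square field_simps)
  finally show ?thesis using assms by (simp add: power2_eq_square algebra_simps)
qed

lemma lattice_norm_tsirelson2: "lattice_norm tsirelson2_norm"
proof
  interpret T: lattice_norm tsirelson_norm by (rule lattice_norm_tsirelson)
  fix x y assume x: "x \<in> c00" and y: "y \<in> c00"
  let ?a = "tsirelson2_norm x" and ?b = "tsirelson2_norm y"
  have a: "?a\<^sup>2 = tsirelson_norm (sq_abs x)" "0 \<le> ?a" and b: "?b\<^sup>2 = tsirelson_norm (sq_abs y)" "0 \<le> ?b"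
    using T.nonneg x y by (auto simp: tsirelson2_eq)
  have bound: "tsirelson_norm (sq_abs (x + y)) \<le> (1 + s) * ?a\<^sup>2 + (1 + 1 / s) * ?b\<^sup>2" if s: "0 < s" for s
  proof -
    have "tsirelson_norm (sq_abs (x + y))
        \<le> tsirelson_norm (scale (of_real (1 + s)) (sq_abs x) + scale (of_real (1 + 1 / s)) (sq_abs y))"
    proof (rule T.mono)
      fix i
      have "(cmod (x i + y i))\<^sup>2 \<le> (cmod (x i) + cmod (y i))\<^sup>2"
        by (simp add: norm_triangle_ineq power_mono)
      also have "\<dots> \<le> (1 + s) * (cmod (x i))\<^sup>2 + (1 + 1 / s) * (cmod (y i))\<^sup>2"
        by (rule square_sum_le_weighted[OF s])
      finally have "(cmod (x i + y i))\<^sup>2 \<le> (1 + s) * (cmod (x i))\<^sup>2 + (1 + 1 / s) * (cmod (y i))\<^sup>2" .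
      moreover have "(scale (of_real (1 + s)) (sq_abs x) + scale (of_real (1 + 1 / s)) (sq_abs y)) i
          = of_real ((1 + s) * (cmod (x i))\<^sup>2 + (1 + 1 / s) * (cmod (y i))\<^sup>2)"
        by (simp add: scale_def sq_abs_def)
      moreover have "cmod (sq_abs (x + y) i) = (cmod (x i + y i))\<^sup>2"
        unfolding sq_abs_def norm_of_real by simp
      ultimately show "cmod (sq_abs (x + y) i)
          \<le> cmod ((scale (of_real (1 + s)) (sq_abs x) + scale (of_real (1 + 1 / s)) (sq_abs y)) i)"
        by (simp only: norm_of_real)
    qed (use x y in auto)
    also have "\<dots> \<le> tsirelson_norm (scale (of_real (1 + s)) (sq_abs x))
          + tsirelson_norm (scale (of_real (1 + 1 / s)) (sq_abs y))"
      using x y by (intro T.triangle) auto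
    also have "\<dots> = \<bar>1 + s\<bar> * ?a\<^sup>2 + \<bar>1 + 1 / s\<bar> * ?b\<^sup>2"
      using x y by (simp add: T.homog a b del: of_real_add of_real_divide)
    finally show ?thesis using s by simp
  qed
  show "tsirelson2_norm (x + y) \<le> ?a + ?b"
  proof (rule field_le_epsilon)
    fix d :: real assume "0 < d"
    \<comment> \<open>The optimal weight is the quotient of the two norms, which may vanish; both
      are raised by d / 2 to be divided.\<close>
    define e where "e = d / 2"
    have e: "0 < e" using \<open>0 < d\<close> by (simp add: e_def)
    define p q where "p = ?a + e" and "q = ?b + e"
    have pq: "0 < p" "0 < q" "?a \<le> p" "?b \<le> q" using a b e by (auto simp: p_def q_def)
    have "tsirelson_norm (sq_abs (x + y)) \<le> (1 + q / p) * ?a\<^sup>2 + (1 + 1 / (q / p)) * ?b\<^sup>2"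
      using pq by (intro bound divide_pos_pos)
    also have "\<dots> \<le> (1 + q / p) * p\<^sup>2 + (1 + 1 / (q / p)) * q\<^sup>2"
      using a b pq by (intro add_mono mult_left_mono power_mono) auto
    also have "\<dots> = (p + q)\<^sup>2"
      using pq by (simp add: power2_eq_square field_simps)
    finally have "tsirelson2_norm (x + y) \<le> p + q"
      unfolding tsirelson2_eq using pq by (intro real_le_lsqrt) auto
    then show "tsirelson2_norm (x + y) \<le> ?a + ?b + d" by (simp add: p_def q_def e_def)
  qed
  assume "\<And>i. cmod (x i) \<le> cmod (y i)"
  then have "tsirelson_norm (sq_abs x) \<le> tsirelson_norm (sq_abs y)"
    using x y by (intro T.mono c00_sq_abs) (auto simp: sq_abs_def norm_power intro: power_mono)
  then show "?a \<le> ?b" by (simp add: tsirelson2_eq)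
next
  interpret T: lattice_norm tsirelson_norm by (rule lattice_norm_tsirelson)
  fix x and c :: complex assume x: "x \<in> c00"
  have "sq_abs (scale c x) = scale (of_real ((cmod c)\<^sup>2)) (sq_abs x)"
    by (auto simp: sq_abs_def scale_def norm_mult power_mult_distrib)
  then show "tsirelson2_norm (scale c x) = cmod c * tsirelson2_norm x"
    using x by (simp add: tsirelson2_eq T.homog norm_power real_sqrt_mult)
next
  interpret T: lattice_norm tsirelson_norm by (rule lattice_norm_tsirelson)
  fix i
  have "sq_abs (unit_vec i) = unit_vec i" by (auto simp: sq_abs_def unit_vec_def)
  then show "tsirelson2_norm (unit_vec i) = 1" by (simp add: tsirelson2_eq T.unit)
qed

subsection \<open>Tsirelson's space contains no copy of \<open>\<ell>\<^sub>1\<close>\<close>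

text \<open>A vector that meets at most one of the sets contributes at most g, and any other at most
  2 * g by \<open>tsirelson_lower\<close>. Since vectors and sets are both successive, at most k
  vectors can meet two or more sets.\<close>

lemma tsirelson_successive_le:
  assumes c00: "\<And>l. v l \<in> c00" and norm: "\<And>l. tsirelson_norm (v l) \<le> g"
    and succ: "\<And>l l' a b. l < l' \<Longrightarrow> v l a \<noteq> 0 \<Longrightarrow> v l' b \<noteq> 0 \<Longrightarrow> a < b"
    and adm: "admissible k A"
  shows "(\<Sum>l<r. \<Sum>j<k. tsirelson_norm (restrict_to (A j) (v l))) \<le> (real r + real k) * g"
proof -
  interpret T: lattice_norm tsirelson_norm by (rule lattice_norm_tsirelson)
  define H where "H l = {j. j < k \<and> (\<exists>a\<in>A j. v l a \<noteq> 0)}" for l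
  \<comment> \<open>The vectors that meet at least two sets; \<open>H l\<close> lists the sets met
    by \<open>v l\<close>.\<close>
  define J where "J = {l. l < r \<and> (\<exists>j\<in>H l. j < Max (H l))}"
  let ?s = "\<lambda>l. \<Sum>j<k. tsirelson_norm (restrict_to (A j) (v l))"
  have g: "0 \<le> g" using T.nonneg[OF c00[of 0]] norm[of 0] by linarith
  have fin: "finite (H l)" for l by (simp add: H_def)
  have zero: "tsirelson_norm (restrict_to (A j) (v l)) = 0" if "j < k" "j \<notin> H l" for j l
  proof -
    have "restrict_to (A j) (v l) = 0" using that by (auto simp: H_def restrict_to_def)
    then show ?thesis by (simp add: T.zero)
  qed
  have le2: "?s l \<le> 2 * g" for l
    using tsirelson_lower[OF c00[of l] adm] norm[of l] by linarith
  have le1: "?s l \<le> g" if l: "l < r" "l \<notin> J" for l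
  proof (cases "H l = {}")
    case True
    then have "?s l = 0" using zero by (intro sum.neutral) auto
    then show ?thesis using g by simp
  next
    case False
    define m where "m = Max (H l)"
    have m: "m \<in> H l" "\<And>j. j \<in> H l \<Longrightarrow> j = m"
      using Max_in[OF fin False] Max_ge[OF fin] l unfolding m_def J_def
      by (auto simp: le_less)
    have "?s l = (\<Sum>j\<in>{m}. tsirelson_norm (restrict_to (A j) (v l)))"
    proof (rule sum.mono_neutral_right)
      show "\<forall>i\<in>{..<k} - {m}. tsirelson_norm (restrict_to (A i) (v l)) = 0"
        using m(2) zero by blast
    qed (use m(1) in \<open>auto simp: H_def\<close>)
    also have "\<dots> \<le> g" using T.restrict_le[OF c00[of l], of "A m"] norm[of l] by simp
    finally show ?thesis .
  qed
  \<comment> \<open>A later vector in \<open>J\<close> meets some set before its last one; that set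
    cannot precede the last set met by the earlier vector. Hence the last sets met are strictly
    increasing along \<open>J\<close>.\<close>
  have "inj_on (\<lambda>l. Max (H l)) J"
  proof (rule linorder_inj_onI)
    fix l l' assume l: "l < l'" "l \<in> J" "l' \<in> J"
    obtain j where j: "j \<in> H l'" "j < Max (H l')" using l by (auto simp: J_def)
    have "H l \<noteq> {}" using l by (auto simp: J_def)
    then have "Max (H l) \<in> H l" using fin by simp
    then obtain a where a: "Max (H l) < k" "a \<in> A (Max (H l))" "v l a \<noteq> 0" by (auto simp: H_def)
    obtain b where b: "j < k" "b \<in> A j" "v l' b \<noteq> 0" using j by (auto simp: H_def)
    have "a < b" using succ[OF l(1) a(3) b(3)] .
    then have "\<not> j < Max (H l)" using admissible_less[OF adm _ a(1) b(2) a(2)] by auto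
    then show "Max (H l) \<noteq> Max (H l')" using j by simp
  qed auto
  moreover have "(\<lambda>l. Max (H l)) ` J \<subseteq> {..<k}"
  proof safe
    fix l assume "l \<in> J"
    then have "H l \<noteq> {}" by (auto simp: J_def)
    then have "Max (H l) \<in> H l" using fin by simp
    then show "Max (H l) < k" by (simp add: H_def)
  qed
  ultimately have "card J \<le> card {..<k}" by (intro card_inj_on_le[where f = "\<lambda>l. Max (H l)"]) auto
  then have card: "real (card J) \<le> real k" by simp
  have "(\<Sum>l<r. ?s l) \<le> (\<Sum>l<r. g + (if l \<in> J then g else 0))"
    using le1 le2 by (intro sum_mono) (simp add: mult_2[symmetric])
  also have "\<dots> = real r * g + (\<Sum>l\<in>J. g)"
    by (simp add: sum.distrib, subst sum.inter_filter[symmetric]) (auto simp: J_def)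
  also have "\<dots> \<le> real r * g + real k * g" using card g by (simp add: mult_right_mono)
  finally show ?thesis by (simp add: algebra_simps)
qed

text \<open>More than q sets cannot see x, by admissibility. With k at most q, hence at most r / 4,
  the sums are at most 2 * g for x and (1 + 1/4) * g for the average; half of 13/4 is the
  constant.\<close>

lemma tsirelson_avg_upper:
  assumes v: "\<And>l. v l \<in> c00" "\<And>l. tsirelson_norm (v l) \<le> g"
    and succ: "\<And>l l' a b. l < l' \<Longrightarrow> v l a \<noteq> 0 \<Longrightarrow> v l' b \<noteq> 0 \<Longrightarrow> a < b"
    and x: "x \<in> c00" "tsirelson_norm x \<le> g" "\<And>i. q \<le> i \<Longrightarrow> x i = 0"
    and q: "\<And>l i. i < q \<Longrightarrow> v l i = 0" and r: "0 < r" "4 * q \<le> r"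
  shows "tsirelson_norm (x + scale (of_real (1 / real r)) (\<Sum>l<r. v l)) \<le> 13 / 8 * g"
proof -
  interpret T: lattice_norm tsirelson_norm by (rule lattice_norm_tsirelson)
  define z where "z = scale (of_real (1 / real r)) (\<Sum>l<r. v l)"
  have g: "0 \<le> g" using T.nonneg[OF x(1)] x(2) by linarith
  have zc: "z \<in> c00" using v by (simp add: z_def c00_sum)
  have z0: "z i = 0" if "i < q" for i
    using q[OF that] by (simp add: z_def scale_def sum_omega_apply)
  have zle: "tsirelson_norm (restrict_to S z) \<le> 1 / real r * (\<Sum>l<r. tsirelson_norm (restrict_to S (v l)))" for S
  proof -
    have "restrict_to S z = scale (of_real (1 / real r)) (\<Sum>l<r. restrict_to S (v l))"
      by (auto simp: z_def restrict_to_def scale_def sum_omega_apply)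
    then have "tsirelson_norm (restrict_to S z) = 1 / real r * tsirelson_norm (\<Sum>l<r. restrict_to S (v l))"
      using v r by (simp add: T.homog c00_sum norm_divide)
    also have "\<dots> \<le> 1 / real r * (\<Sum>l<r. tsirelson_norm (restrict_to S (v l)))"
      using v by (intro mult_left_mono T.sum_le) auto
    finally show ?thesis .
  qed
  have zg: "tsirelson_norm z \<le> g"
  proof -
    have "restrict_to UNIV w = w" for w by (auto simp: restrict_to_def)
    then have "tsirelson_norm z \<le> 1 / real r * (\<Sum>l<r. tsirelson_norm (v l))"
      using zle[of UNIV] by simp
    also have "\<dots> \<le> 1 / real r * (\<Sum>l<r. g)" using v by (intro mult_left_mono sum_mono) auto
    finally show ?thesis using r by simp
  qed
  have "tsirelson_norm (x + z) \<le> 13 / 8 * g"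
  proof (rule tsirelson_leI)
    show "x + z \<in> c00" using x zc by simp
    fix i
    have "cmod ((x + z) i) \<le> g"
    proof (cases "i < q")
      case True
      then show ?thesis using z0 T.coord_le[OF x(1), of i] x(2) by simp
    next
      case False
      then show ?thesis using x(3)[of i] T.coord_le[OF zc, of i] zg by simp
    qed
    then show "cmod ((x + z) i) \<le> 13 / 8 * g" using g by linarith
  next
    fix k A assume adm: "admissible k A"
    show "(\<Sum>j<k. tsirelson_norm (restrict_to (A j) (x + z))) \<le> 2 * (13 / 8 * g)"
    proof (cases "k \<le> q")
      case False
      \<comment> \<open>Here k is at least q + 1 and at most \<open>Suc (Min (A 0))\<close>, so
        every set lies in the coordinates from q on, where x vanishes.\<close>
      have "restrict_to (A j) (x + z) = restrict_to (A j) z" if "j < k" for j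
      proof -
        have "q \<le> a" if "a \<in> A j" for a
        proof -
          have "0 < k" "finite (A 0)" "A 0 \<noteq> {}" "k \<le> Suc (Min (A 0))" using adm by (auto simp: admissible_def)
          moreover have "Min (A 0) \<le> a"
          proof (cases "j = 0")
            case False
            then show ?thesis
              using admissible_less[OF adm, of 0 j "Min (A 0)" a] \<open>j < k\<close> \<open>a \<in> A j\<close> calculation by simp
          qed (use calculation \<open>a \<in> A j\<close> in auto)
          ultimately show ?thesis using False by linarith
        qed
        then show ?thesis using x(3) by (auto simp: restrict_to_def)
      qed
      then have "(\<Sum>j<k. tsirelson_norm (restrict_to (A j) (x + z))) = (\<Sum>j<k. tsirelson_norm (restrict_to (A j) z))"
        by (intro sum.cong) auto
      also have "\<dots> \<le> 2 * g" using tsirelson_lower[OF zc adm] zg by linarith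
      finally show ?thesis using g by linarith
    next
      case True
      have "(\<Sum>j<k. tsirelson_norm (restrict_to (A j) (x + z)))
          \<le> (\<Sum>j<k. tsirelson_norm (restrict_to (A j) x) + tsirelson_norm (restrict_to (A j) z))"
        unfolding restrict_add using x zc by (intro sum_mono T.triangle) auto
      also have "\<dots> = (\<Sum>j<k. tsirelson_norm (restrict_to (A j) x)) + (\<Sum>j<k. tsirelson_norm (restrict_to (A j) z))"
        by (rule sum.distrib)
      also have "(\<Sum>j<k. tsirelson_norm (restrict_to (A j) x)) \<le> 2 * g"
        using tsirelson_lower[OF x(1) adm] x(2) by linarith
      also have "(\<Sum>j<k. tsirelson_norm (restrict_to (A j) z))
          \<le> (\<Sum>j<k. 1 / real r * (\<Sum>l<r. tsirelson_norm (restrict_to (A j) (v l))))"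
        by (intro sum_mono zle)
      also have "\<dots> = 1 / real r * (\<Sum>j<k. \<Sum>l<r. tsirelson_norm (restrict_to (A j) (v l)))"
        by (rule sum_distrib_left[symmetric])
      also have "\<dots> = 1 / real r * (\<Sum>l<r. \<Sum>j<k. tsirelson_norm (restrict_to (A j) (v l)))"
        by (rule arg_cong[where f = "\<lambda>t. 1 / real r * t", OF sum.swap])
      also have "\<dots> \<le> 1 / real r * ((real r + real k) * g)"
      proof (rule mult_left_mono)
        show "(\<Sum>l<r. \<Sum>j<k. tsirelson_norm (restrict_to (A j) (v l))) \<le> (real r + real k) * g"
          by (rule tsirelson_successive_le[OF v succ adm])
      qed simp
      also have "\<dots> \<le> 1 / real r * ((real r + real r / 4) * g)"
        using True r g by (intro mult_left_mono mult_right_mono) auto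
      also have "\<dots> = 5 / 4 * g" using r by (simp add: field_simps)
      finally show ?thesis by linarith
    qed
  qed
  then show ?thesis by (simp add: z_def)
qed

text \<open>
  On the convex hulls of the tails of \<open>h\<close> the norm has infima \<open>\<gamma> n\<close> that increase to a positive
  limit. A convex combination far out that almost attains the limit, added to a long average of such
  combinations even further out, has norm about \<open>2 \<gamma>\<close> by convexity but at most \<open>13/8 \<gamma>\<close> by
  the previous estimate.
\<close>

lemma tsirelson_no_positive_ell1:
  fixes h :: "nat \<Rightarrow> omega"
  assumes c00: "\<And>j. h j \<in> c00" and supp: "\<And>j i. i < j \<Longrightarrow> h j i = 0"
    and bounded: "\<And>j. tsirelson_norm (h j) \<le> C" and c: "0 < c"
    and lower: "\<And>b m. (\<And>j. 0 \<le> b j) \<Longrightarrow>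
      c * (\<Sum>j<m. b j) \<le> tsirelson_norm (\<Sum>j<m. scale (complex_of_real (b j)) (h j))"
  shows False
proof -
  interpret T: lattice_norm tsirelson_norm by (rule lattice_norm_tsirelson)
  \<comment> \<open>Cutting the sum at i loses nothing, because \<open>h j\<close> vanishes before
    j; thus the combination is defined without naming a bound for the support of b.
    \<open>Q n\<close> consists of the convex coefficients supported from n on.\<close>
  define V where "V b = (\<lambda>i. \<Sum>j\<le>i. complex_of_real (b j) * h j i)" for b :: "nat \<Rightarrow> real"
  define Q where "Q n = {b :: nat \<Rightarrow> real. (\<forall>j. 0 \<le> b j) \<and> (\<forall>j<n. b j = 0) \<and>
    (\<exists>m. (\<forall>j\<ge>m. b j = 0) \<and> sum b {..<m} = 1)}" for n
  define \<gamma> where "\<gamma> n = Inf ((\<lambda>b. tsirelson_norm (V b)) ` Q n)" for n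
  have V: "V b = (\<Sum>j<m. scale (complex_of_real (b j)) (h j))" if "\<forall>j\<ge>m. b j = 0" for b m
  proof
    fix i
    have "V b i = (\<Sum>j\<in>{..i} \<inter> {..<m}. complex_of_real (b j) * h j i)"
      unfolding V_def using that by (intro sum.mono_neutral_right) (auto simp: not_less)
    also have "\<dots> = (\<Sum>j<m. complex_of_real (b j) * h j i)"
    proof (rule sum.mono_neutral_left)
      have "h j i = 0" if "\<not> j \<le> i" for j using supp[of i j] that by simp
      then show "\<forall>j\<in>{..<m} - {..i} \<inter> {..<m}. complex_of_real (b j) * h j i = 0" by auto
    qed auto
    finally show "V b i = (\<Sum>j<m. scale (complex_of_real (b j)) (h j)) i"
      by (simp add: sum_omega_apply scale_def)
  qed
  have Vc: "V b \<in> c00" if b: "b \<in> Q n" for b n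
  proof -
    obtain m where "\<forall>j\<ge>m. b j = 0" using b unfolding Q_def by blast
    then show ?thesis using V c00 by (auto intro!: c00_sum)
  qed
  have V0: "V b i = 0" if "b \<in> Q n" "i < n" for b n i
    using that by (auto simp: V_def Q_def intro!: sum.neutral)
  have Vlow: "c \<le> tsirelson_norm (V b)" if b: "b \<in> Q n" for b n
  proof -
    obtain m where "\<forall>j\<ge>m. b j = 0" "sum b {..<m} = 1" "\<And>j. 0 \<le> b j" using b unfolding Q_def by blast
    then show ?thesis using V[of m b] lower[of b m] by simp
  qed
  have Qmono: "Q n' \<subseteq> Q n" if "n \<le> n'" for n n' using that by (auto simp: Q_def)
  have Qconv: "(\<lambda>j. (1 / real r) * (\<Sum>l<r. B l j)) \<in> Q n" if "0 < r" "\<And>l. B l \<in> Q n" for r n B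
  proof -
    have "\<exists>m. (\<forall>j\<ge>m. B l j = 0) \<and> sum (B l) {..<m} = 1" for l using that(2)[of l] by (auto simp: Q_def)
    then obtain m where m: "\<And>l j. m l \<le> j \<Longrightarrow> B l j = 0" "\<And>l. sum (B l) {..<m l} = 1" by metis
    define M where "M = Max (m ` {..<r})"
    have M: "m l \<le> M" if "l < r" for l using that by (simp add: M_def)
    have "sum (B l) {..<M} = 1" if "l < r" for l
      using m M[OF that] by (subst m(2)[of l, symmetric], intro sum.mono_neutral_right) auto
    then have "(\<Sum>l<r. \<Sum>j<M. B l j) = real r" by simp
    moreover have "(\<Sum>j<M. (1 / real r) * (\<Sum>l<r. B l j)) = (1 / real r) * (\<Sum>j<M. \<Sum>l<r. B l j)"
      by (rule sum_distrib_left[symmetric])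
    moreover have "(\<Sum>j<M. \<Sum>l<r. B l j) = (\<Sum>l<r. \<Sum>j<M. B l j)" by (rule sum.swap)
    ultimately have "(\<Sum>j<M. (1 / real r) * (\<Sum>l<r. B l j)) = 1"
      using \<open>0 < r\<close> by simp
    moreover have "B l j = 0" if "l < r" "M \<le> j" for l j using m(1)[of l j] M[of l] that by simp
    ultimately show ?thesis
      using that(2) by (auto simp: Q_def intro!: exI[of _ M] divide_nonneg_nonneg sum_nonneg)
  qed
  have hQ: "(\<lambda>j. if j = n then 1 else 0) \<in> Q n" for n
    by (auto simp: Q_def intro!: exI[of _ "Suc n"])
  have Vh: "V (\<lambda>j. if j = n then 1 else 0) = h n" for n
  proof
    fix i
    show "V (\<lambda>j. if j = n then 1 else 0) i = h n i"
      unfolding V_def using supp[of i n] by (simp add: if_distrib if_distribR sum.delta not_le cong: if_cong)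
  qed
  have bdd: "bdd_below ((\<lambda>b. tsirelson_norm (V b)) ` Q n)" for n
    using Vlow by (intro bdd_belowI[of _ c]) auto
  have \<gamma>le: "\<gamma> n \<le> tsirelson_norm (V b)" if "b \<in> Q n" for b n
    unfolding \<gamma>_def using that bdd by (intro cInf_lower) auto
  have "c \<le> \<gamma> n" for n
    unfolding \<gamma>_def using hQ Vlow by (intro cInf_greatest) auto
  have "incseq \<gamma>"
    unfolding incseq_def \<gamma>_def using hQ bdd by (intro allI impI cInf_superset_mono image_mono Qmono) blast+
  moreover have "\<gamma> n \<le> C" for n using \<gamma>le[OF hQ] Vh bounded order_trans by metis
  ultimately obtain G where G: "\<gamma> \<longlonglongrightarrow> G" "\<And>n. \<gamma> n \<le> G"
    using incseq_convergent by metis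
  have Gpos: "0 < G" using \<open>\<And>n. c \<le> \<gamma> n\<close>[of 0] G(2)[of 0] c by linarith
  \<comment> \<open>The infima come above 15/16 of the limit and near-minimisers below 17/16 of it;
    the contradiction is that twice 15/16 exceeds 13/8 times 17/16.\<close>
  define g where "g = 17 / 16 * G"
  have "eventually (\<lambda>n. 15 / 16 * G < \<gamma> n) sequentially" using G(1) Gpos by (intro order_tendstoD) auto
  then obtain n0 where n0: "15 / 16 * G < \<gamma> n0" by (auto simp: eventually_sequentially)
  have "\<exists>b\<in>Q n. tsirelson_norm (V b) < g" for n
  proof -
    have "Inf ((\<lambda>b. tsirelson_norm (V b)) ` Q n) < g"
      using G(2)[of n] Gpos unfolding \<gamma>_def[symmetric] g_def by linarith
    then show ?thesis using hQ by (subst (asm) cInf_less_iff[OF _ bdd]) auto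
  qed
  then obtain \<beta> where \<beta>: "\<And>n. \<beta> n \<in> Q n" "\<And>n. tsirelson_norm (V (\<beta> n)) < g" by metis
  have "\<exists>e. \<forall>i\<ge>e. V (\<beta> n) i = 0" for n using Vc[OF \<beta>(1)[of n]] c00_iff_bound by blast
  then obtain e where e: "\<And>n i. e n \<le> i \<Longrightarrow> V (\<beta> n) i = 0" by metis
  \<comment> \<open>Each starting index lies past the support of the preceding combination, which
    makes the \<open>v l\<close> successive. Starting from \<open>e n0\<close> puts all of them
    beyond the support of \<open>V (\<beta> n0)\<close>.\<close>
  define s where "s = rec_nat (max n0 (e n0)) (\<lambda>l p. max p (e p))"
  have s: "s 0 = max n0 (e n0)" "s (Suc l) = max (s l) (e (s l))" for l by (auto simp: s_def)
  have smono: "s l \<le> s l'" if "l \<le> l'" for l l' using that by (rule lift_Suc_mono_le[rotated]) (simp add: s)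
  define v where "v l = V (\<beta> (s l))" for l
  define r where "r = 4 * e n0 + 4"
  have sQ: "\<beta> (s l) \<in> Q n0" for l
    using Qmono[of n0 "s l"] \<beta>(1)[of "s l"] smono[of 0 l] s(1) by auto
  have succ: "a < b" if "l < l'" "v l a \<noteq> 0" "v l' b \<noteq> 0" for l l' a b
  proof -
    have "a < e (s l)" using that e[of "s l" a] by (force simp: v_def not_le[symmetric])
    also have "\<dots> \<le> s (Suc l)" by (simp add: s)
    also have "\<dots> \<le> s l'" using that by (intro smono) auto
    also have "\<dots> \<le> b" using that V0[OF \<beta>(1)] by (force simp: v_def not_less[symmetric])
    finally show ?thesis .
  qed
  define \<beta>' where "\<beta>' = (\<lambda>j. (1 / real r) * (\<Sum>l<r. \<beta> (s l) j))"
  have \<beta>'Q: "\<beta>' \<in> Q n0" unfolding \<beta>'_def by (rule Qconv) (auto simp: r_def sQ)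
  have V\<beta>': "V \<beta>' = scale (of_real (1 / real r)) (\<Sum>l<r. v l)"
  proof
    fix i
    have "V \<beta>' i = (\<Sum>j\<le>i. \<Sum>l<r. of_real (1 / real r) * (of_real (\<beta> (s l) j) * h j i))"
      unfolding V_def \<beta>'_def of_real_mult of_real_sum sum_distrib_left sum_distrib_right by (simp add: mult_ac)
    also have "\<dots> = (\<Sum>l<r. \<Sum>j\<le>i. of_real (1 / real r) * (of_real (\<beta> (s l) j) * h j i))" by (rule sum.swap)
    also have "\<dots> = scale (of_real (1 / real r)) (\<Sum>l<r. v l) i"
      by (simp add: scale_def sum_omega_apply v_def V_def sum_distrib_left)
    finally show "V \<beta>' i = scale (of_real (1 / real r)) (\<Sum>l<r. v l) i" .
  qed
  have "tsirelson_norm (V (\<beta> n0) + V \<beta>') \<le> 13 / 8 * g"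
    unfolding V\<beta>'
  proof (rule tsirelson_avg_upper[where q = "e n0"])
    show "\<And>l. v l \<in> c00" using Vc[OF \<beta>(1)] by (simp add: v_def)
    show "\<And>l. tsirelson_norm (v l) \<le> g" using \<beta>(2) by (simp add: v_def less_imp_le)
    show "V (\<beta> n0) \<in> c00" using Vc[OF \<beta>(1)] .
    show "tsirelson_norm (V (\<beta> n0)) \<le> g" using \<beta>(2) by (simp add: less_imp_le)
    fix l i assume "i < e n0"
    then have "i < s l" using smono[of 0 l] s(1) by simp
    then show "v l i = 0" using V0[OF \<beta>(1)] by (simp add: v_def)
  qed (use succ e in \<open>auto simp: r_def\<close>)
  moreover have "2 * \<gamma> n0 \<le> tsirelson_norm (V (\<beta> n0) + V \<beta>')"
  proof -
    \<comment> \<open>The midpoint of the two coefficient sequences, written as an average of two so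
      that \<open>Qconv\<close> applies.\<close>
    define b where "b = (\<lambda>j. (1 / real 2) * (\<Sum>l<2. (if l = (0::nat) then \<beta> n0 else \<beta>') j))"
    have "b \<in> Q n0" unfolding b_def by (rule Qconv) (auto simp: \<beta> \<beta>'Q)
    moreover have "V b = scale (of_real (1 / 2)) (V (\<beta> n0) + V \<beta>')"
      by (auto simp: V_def b_def scale_def sum_distrib_left sum.distrib[symmetric] numeral_2_eq_2 algebra_simps intro!: sum.cong)
    ultimately have "\<gamma> n0 \<le> tsirelson_norm (scale (of_real (1 / 2)) (V (\<beta> n0) + V \<beta>'))"
      using \<gamma>le by metis
    also have "\<dots> = 1 / 2 * tsirelson_norm (V (\<beta> n0) + V \<beta>')"
      using Vc[OF \<beta>(1)] Vc[OF \<beta>'Q] by (subst T.homog) auto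
    finally show ?thesis by simp
  qed
  ultimately show False using n0 Gpos unfolding g_def by linarith
qed

subsection \<open>The completion and its dual\<close>

context lattice_norm
begin

text \<open>The norm on m coordinates is dominated by l_1. The filter is arbitrary because the fact
  is used both for limits of sequences and for continuity in the product topology.\<close>

lemma restrict_tendsto:
  assumes "\<And>i. ((\<lambda>n. u n i) \<longlongrightarrow> x i) \<F>"
  shows "((\<lambda>n. N (restrict_to {..<m} (u n))) \<longlongrightarrow> N (restrict_to {..<m} x)) \<F>"
proof -
  have "((\<lambda>n. \<Sum>i<m. cmod (u n i - x i)) \<longlongrightarrow> (\<Sum>i<m. cmod (x i - x i))) \<F>"
    by (intro tendsto_intros assms)
  then have lim: "((\<lambda>n. \<Sum>i<m. cmod (u n i - x i)) \<longlongrightarrow> 0) \<F>" by simp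
  have "norm (N (restrict_to {..<m} (u n)) - N (restrict_to {..<m} x)) \<le> (\<Sum>i<m. cmod (u n i - x i))" for n
  proof -
    let ?d = "restrict_to {..<m} (u n) - restrict_to {..<m} x"
    have "norm (N (restrict_to {..<m} (u n)) - N (restrict_to {..<m} x)) \<le> N ?d"
      using diff_le[of "restrict_to {..<m} (u n)" "restrict_to {..<m} x"] by simp
    also have "\<dots> \<le> ell1_norm ?d" by (rule le_ell1) simp
    also have "\<dots> = (\<Sum>i<m. cmod (?d i))"
      by (rule ell1_norm_superset) (auto simp: supp_def restrict_to_def split: if_splits)
    also have "\<dots> = (\<Sum>i<m. cmod (u n i - x i))" by (intro sum.cong) (auto simp: restrict_to_def)
    finally show ?thesis .
  qed
  then have "((\<lambda>n. N (restrict_to {..<m} (u n)) - N (restrict_to {..<m} x)) \<longlongrightarrow> 0) \<F>"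
    by (intro tendsto_0_le[OF lim, of _ 1]) (auto intro!: always_eventually simp: sum_nonneg)
  then show ?thesis by (rule LIM_zero_cancel)
qed

lemma represents_limit:
  assumes "represents N u x" obtains r where "(\<lambda>n. N (u n)) \<longlonglongrightarrow> r"
proof -
  have u: "\<And>n. u n \<in> c00" and cauchy: "\<And>e. 0 < e \<Longrightarrow> \<exists>M. \<forall>m\<ge>M. \<forall>n\<ge>M. N (u m - u n) < e"
    using assms by (auto simp: represents_def)
  have "Cauchy (\<lambda>n. N (u n))"
  proof (rule CauchyI)
    fix e :: real assume "0 < e"
    then obtain M where "\<forall>m\<ge>M. \<forall>n\<ge>M. N (u m - u n) < e" using cauchy by blast
    moreover have "norm (N (u m) - N (u n)) \<le> N (u m - u n)" for m n
      using diff_le[OF u u] by simp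
    ultimately show "\<exists>M. \<forall>m\<ge>M. \<forall>n\<ge>M. norm (N (u m) - N (u n)) < e"
      by (meson order.strict_trans1)
  qed
  then show ?thesis using that Cauchy_convergent convergent_def by blast
qed

lemma represents_restrict_le:
  assumes "represents N u x" and "(\<lambda>n. N (u n)) \<longlonglongrightarrow> r"
  shows "N (restrict_to {..<m} x) \<le> r"
proof (rule LIMSEQ_le[OF restrict_tendsto assms(2)])
  have u: "\<And>n. u n \<in> c00" using assms(1) by (auto simp: represents_def)
  then show "\<exists>M. \<forall>n\<ge>M. N (restrict_to {..<m} (u n)) \<le> N (u n)" using restrict_le by blast
qed (use assms(1) in \<open>auto simp: represents_def\<close>)

text \<open>One term of the Cauchy sequence is within e of all later ones and has finite support.
  Beyond that support, the later terms therefore have norm below e.\<close>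

lemma represents_le_restrict:
  assumes rep: "represents N u x" and lim: "(\<lambda>n. N (u n)) \<longlonglongrightarrow> r" and e: "0 < e"
  shows "\<exists>m. r \<le> N (restrict_to {..<m} x) + e"
proof -
  have u: "\<And>n. u n \<in> c00" using rep by (auto simp: represents_def)
  obtain M where M: "\<And>m n. M \<le> m \<Longrightarrow> M \<le> n \<Longrightarrow> N (u m - u n) < e"
    using rep e unfolding represents_def by blast
  obtain m where m: "\<And>i. m \<le> i \<Longrightarrow> u M i = 0" using c00_bound[OF u[of M]] by blast
  have "N (u n) \<le> N (restrict_to {..<m} (u n)) + e" if "M \<le> n" for n
  proof -
    let ?v = "restrict_to {m..} (u n - u M)"
    have eq: "u n = restrict_to {..<m} (u n) + ?v"
      using m by (auto simp: restrict_to_def fun_eq_iff)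
    have "N (restrict_to {..<m} (u n) + ?v) \<le> N (restrict_to {..<m} (u n)) + N ?v"
      using u by (intro triangle) auto
    moreover have "N ?v \<le> N (u n - u M)" using u by (intro restrict_le) auto
    ultimately show ?thesis using M[OF that order_refl] eq by simp
  qed
  then have "\<exists>M. \<forall>n\<ge>M. N (u n) \<le> N (restrict_to {..<m} (u n)) + e" by blast
  moreover have "(\<lambda>n. N (restrict_to {..<m} (u n)) + e) \<longlonglongrightarrow> N (restrict_to {..<m} x) + e"
    using rep by (intro tendsto_intros restrict_tendsto) (auto simp: represents_def)
  ultimately have "r \<le> N (restrict_to {..<m} x) + e" using LIMSEQ_le[OF lim] by blast
  then show ?thesis ..
qed

text \<open>The limits along any two representing sequences agree, since both are the supremum of
  the norms of the initial segments of x. This resolves the \<open>THE\<close>.\<close>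

lemma nrm_completion:
  assumes "represents N u x" and "(\<lambda>n. N (u n)) \<longlonglongrightarrow> r"
  shows "nrm (completion N) x = r"
proof -
  have le: "r' \<le> s'" if v: "represents N v x" "(\<lambda>n. N (v n)) \<longlonglongrightarrow> r'"
    and w: "represents N w x" "(\<lambda>n. N (w n)) \<longlonglongrightarrow> s'" for v w r' s'
  proof (rule field_le_epsilon)
    fix e :: real assume "0 < e"
    then obtain m where "r' \<le> N (restrict_to {..<m} x) + e" using represents_le_restrict[OF v] by blast
    then show "r' \<le> s' + e" using represents_restrict_le[OF w, of m] by linarith
  qed
  show ?thesis unfolding completion_def seq_space.simps
  proof (rule the_equality)
    show "\<exists>u. represents N u x \<and> (\<lambda>n. N (u n)) \<longlonglongrightarrow> r" using assms by blast
    show "\<And>s. \<exists>u. represents N u x \<and> (\<lambda>n. N (u n)) \<longlonglongrightarrow> s \<Longrightarrow> s = r"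
      using le assms by (metis order_antisym)
  qed
qed

lemma restrict_le_nrm:
  assumes "x \<in> vecs (completion N)" shows "N (restrict_to {..<m} x) \<le> nrm (completion N) x"
proof -
  obtain u where u: "represents N u x" using assms by (auto simp: completion_def)
  then obtain r where "(\<lambda>n. N (u n)) \<longlonglongrightarrow> r" using represents_limit by blast
  then show ?thesis using nrm_completion[OF u] represents_restrict_le[OF u] by metis
qed

lemma c00_completion:
  assumes "x \<in> c00" shows "x \<in> vecs (completion N)" and "nrm (completion N) x = N x"
proof -
  have rep: "represents N (\<lambda>n. x) x" using assms by (auto simp: represents_def zero)
  then show "x \<in> vecs (completion N)" unfolding completion_def seq_space.simps by blast
  show "nrm (completion N) x = N x" by (rule nrm_completion[OF rep tendsto_const])
qed

section \<open>Pairing with elements of the dual\<close>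

lemma functional_bound_pairing:
  assumes "functional_bound (completion N) y C"
  shows "cmod (\<Sum>i<n. v i * y i) \<le> C * N (restrict_to {..<n} v)"
proof -
  obtain f where add: "\<And>x x'. x \<in> c00 \<Longrightarrow> x' \<in> c00 \<Longrightarrow> f (x + x') = f x + f x'"
    and hom: "\<And>c x. x \<in> c00 \<Longrightarrow> f (scale c x) = c * f x"
    and bd: "\<And>x. x \<in> c00 \<Longrightarrow> cmod (f x) \<le> C * N x" and val: "\<And>j. f (unit_vec j) = y j"
    using assms c00_completion unfolding functional_bound_def by metis
  have f: "f (\<Sum>j<k. scale (v j) (unit_vec j)) = (\<Sum>j<k. v j * y j)" for k
  proof (induction k)
    case 0
    have "f (scale 0 0) = 0" using hom[of 0 0] by simp
    moreover have "scale 0 0 = 0" by (auto simp: scale_def)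
    ultimately show ?case by (simp only: lessThan_0 sum.empty)
  next
    case (Suc k)
    have "f ((\<Sum>j<k. scale (v j) (unit_vec j)) + scale (v k) (unit_vec k))
        = f (\<Sum>j<k. scale (v j) (unit_vec j)) + f (scale (v k) (unit_vec k))"
      by (intro add c00_sum) auto
    then show ?case using Suc hom[OF c00_unit_vec] val by (simp only: sum.lessThan_Suc)
  qed
  have "restrict_to {..<n} v = (\<Sum>j<n. scale (restrict_to {..<n} v j) (unit_vec j))"
    by (rule c00_decomp) (simp add: restrict_to_def)
  also have "\<dots> = (\<Sum>j<n. scale (v j) (unit_vec j))"
    by (rule sum.cong) (auto simp: restrict_to_def)
  finally have "cmod (\<Sum>i<n. v i * y i) = cmod (f (restrict_to {..<n} v))" using f[of n] by metis
  then show ?thesis using bd by simp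
qed

text \<open>The dual norm is an infimum of bounds, so it is itself a bound for the pairing on
  finitely many coordinates. The pairing is bilinear, without conjugation.\<close>

lemma dual_pairing:
  assumes y: "y \<in> vecs (dual (completion N))"
  shows "cmod (\<Sum>i<n. v i * y i) \<le> nrm (dual (completion N)) y * N (restrict_to {..<n} v)"
proof (cases "N (restrict_to {..<n} v) = 0")
  case True
  obtain C where "functional_bound (completion N) y C" using y by (auto simp: dual_def)
  then show ?thesis using functional_bound_pairing[of y C v n] True by simp
next
  case False
  let ?N = "N (restrict_to {..<n} v)"
  have pos: "0 < ?N" using False nonneg[of "restrict_to {..<n} v"] by simp
  have "cmod (\<Sum>i<n. v i * y i) / ?N \<le> Inf {C. functional_bound (completion N) y C}"
  proof (rule cInf_greatest)
    show "{C. functional_bound (completion N) y C} \<noteq> {}" using y by (auto simp: dual_def)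
    fix C assume "C \<in> {C. functional_bound (completion N) y C}"
    then show "cmod (\<Sum>i<n. v i * y i) / ?N \<le> C"
      using functional_bound_pairing[of y C v n] pos by (simp add: field_simps)
  qed
  then show ?thesis using pos by (simp add: dual_def field_simps)
qed

end

subsection \<open>Bounded functions on the strip\<close>

lemma interior_strip: "interior strip = {z. 0 < Re z \<and> Re z < 1}"
proof -
  have "interior strip = interior {z. 0 \<le> Re z} \<inter> interior {z. Re z \<le> 1}"
    unfolding interior_Int[symmetric] by (rule arg_cong[where f = interior]) (auto simp: strip_def)
  moreover have "interior {z. 0 \<le> Re z} = {z. 0 < Re z}"
    using interior_halfspace_ge[of "1::complex" 0] by (simp add: inner_complex_def)
  moreover have "interior {z. Re z \<le> 1} = {z. Re z < 1}"
    using interior_halfspace_le[of "1::complex" 1] by (simp add: inner_complex_def)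
  ultimately show ?thesis by auto
qed

text \<open>Cauchy's estimates on this disc of radius 1/4 are the source of the factors 4 in the
  bounds on derivatives.\<close>

lemma ball_half_strip: "cball (1/2) (1/4) \<subseteq> interior strip"
proof
  fix z :: complex assume "z \<in> cball (1/2) (1/4)"
  then have "\<bar>Re (1/2 - z)\<bar> \<le> 1/4"
    using abs_Re_le_cmod[of "1/2 - z"] by (simp add: dist_norm)
  then have "\<bar>1/2 - Re z\<bar> \<le> 1/4" by simp
  then have "0 < Re z" "Re z < 1" by linarith+
  then show "z \<in> interior strip" unfolding interior_strip by simp
qed

lemma half_in_strip: "1/2 \<in> interior strip" "1/2 \<in> strip"
  unfolding interior_strip by (auto simp: strip_def)

text \<open>A Phragmen-Lindelof argument: the factor \<open>exp (e * (w^2 - 1))\<close> decays along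
  the strip and has modulus at most 1 there. The maximum principle on a tall rectangle bounds the
  damped function, and then e tends to 0.\<close>

lemma strip_max_principle:
  fixes f :: "complex \<Rightarrow> complex"
  assumes cont: "continuous_on strip f" and hol: "f holomorphic_on interior strip"
    and bd: "bounded (f ` strip)"
    and left: "\<And>t. cmod (f (\<i> * complex_of_real t)) \<le> M"
    and right: "\<And>t. cmod (f (1 + \<i> * complex_of_real t)) \<le> M"
    and z: "z \<in> strip"
  shows "cmod (f z) \<le> M"
proof -
  obtain K where K: "0 < K" "\<And>w. w \<in> strip \<Longrightarrow> cmod (f w) \<le> K"
    using bd by (auto simp: bounded_pos)
  have M: "0 \<le> M" using left[of 0] norm_ge_zero order_trans by blast
  have edge: "cmod (f w) \<le> M" if "Re w = 0 \<or> Re w = 1" for w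
  proof -
    have "w = \<i> * complex_of_real (Im w) \<or> w = 1 + \<i> * complex_of_real (Im w)"
      using that by (auto simp: complex_eq_iff)
    then show ?thesis using left right by metis
  qed
  have damped: "cmod (f z) * exp (e * (Re (z\<^sup>2) - 1)) \<le> M" if e: "0 < e" for e
  proof (rule field_le_epsilon)
    fix d :: real assume d: "0 < d"
    define h where "h w = f w * exp (of_real e * (w\<^sup>2 - 1))" for w
    have normh: "cmod (h w) = cmod (f w) * exp (e * (Re (w\<^sup>2) - 1))" for w
      by (simp add: h_def norm_mult)
    \<comment> \<open>The rectangle contains z, and on its horizontal sides the damping factor is at
      most \<open>exp (- (K / d))\<close>, hence at most d / K, which beats the bound K for
      f.\<close>
    define R where "R = max (\<bar>Im z\<bar>) (sqrt (K / (e * d)))"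
    let ?S = "cbox (Complex 0 (- R)) (Complex 1 R)"
    have R: "0 \<le> R" "\<bar>Im z\<bar> \<le> R" "K / (e * d) \<le> R\<^sup>2"
    proof -
      have "0 \<le> K / (e * d)" using K e d by simp
      then have "(sqrt (K / (e * d)))\<^sup>2 = K / (e * d)" by simp
      moreover have "(sqrt (K / (e * d)))\<^sup>2 \<le> R\<^sup>2"
        using K e d by (intro power_mono) (auto simp: R_def)
      ultimately show "K / (e * d) \<le> R\<^sup>2" by simp
    qed (auto simp: R_def)
    have sub: "?S \<subseteq> strip" by (auto simp: strip_def in_cbox_complex_iff)
    have sub': "interior ?S \<subseteq> interior strip" by (rule interior_mono[OF sub])
    have "cmod (h z) \<le> M + d"
    proof (rule maximum_modulus_frontier[where S = ?S and f = h])
      show "h holomorphic_on interior ?S"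
        unfolding h_def by (intro holomorphic_intros holomorphic_on_subset[OF hol] sub')
      show "continuous_on (closure ?S) h"
        unfolding h_def using sub by (auto intro!: continuous_intros continuous_on_subset[OF cont])
      show "z \<in> ?S" using z R by (auto simp: strip_def in_cbox_complex_iff)
      fix w assume "w \<in> frontier ?S"
      then have w: "w \<in> ?S" "w \<notin> box (Complex 0 (- R)) (Complex 1 R)" by (auto simp: frontier_def)
      have Re_le: "e * (Re (w\<^sup>2) - 1) \<le> - (e * (Im w)\<^sup>2)"
      proof -
        have "(Re w)\<^sup>2 \<le> 1" using w(1) by (simp add: in_cbox_complex_iff power_le_one)
        then have "e * (Re (w\<^sup>2) - 1) \<le> e * (- (Im w)\<^sup>2)"
          using e by (intro mult_left_mono) (auto simp: power2_eq_square)
        then show ?thesis by simp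
      qed
      show "cmod (h w) \<le> M + d"
      proof (cases "Re w = 0 \<or> Re w = 1")
        case True
        have "exp (e * (Re (w\<^sup>2) - 1)) \<le> 1" using Re_le e by (smt (verit) exp_le_one_iff mult_nonneg_nonneg zero_le_power2)
        then have "cmod (h w) \<le> M * 1" unfolding normh using edge[OF True] M by (intro mult_mono) auto
        then show ?thesis using d by simp
      next
        case False
        then have "\<bar>Im w\<bar> = R" using w by (auto simp: in_cbox_complex_iff in_box_complex_iff)
        then have "(Im w)\<^sup>2 = R\<^sup>2" by (metis power2_abs)
        then have ge: "K / d \<le> e * (Im w)\<^sup>2" using R(3) e d by (simp add: field_simps)
        have "exp (e * (Re (w\<^sup>2) - 1)) \<le> exp (- (K / d))" using Re_le ge by simp
        also have "\<dots> \<le> 1 / (1 + K / d)"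
          using exp_ge_add_one_self[of "K / d"] K d by (simp add: exp_minus inverse_eq_divide frac_le add_pos_pos)
        also have "\<dots> \<le> d / K" using K d by (simp add: field_simps)
        finally have "cmod (h w) \<le> K * (d / K)"
          unfolding normh using K sub w(1) by (intro mult_mono) auto
        then show ?thesis using K M by simp
      qed
    qed (rule bounded_cbox)
    then show "cmod (f z) * exp (e * (Re (z\<^sup>2) - 1)) \<le> M + d" by (simp add: normh)
  qed
  have "((\<lambda>e. cmod (f z) * exp (e * (Re (z\<^sup>2) - 1))) \<longlongrightarrow> cmod (f z) * exp (0 * (Re (z\<^sup>2) - 1))) (at_right 0)"
    by (intro tendsto_intros)
  then have "cmod (f z) * exp (0 * (Re (z\<^sup>2) - 1)) \<le> M"
    by (rule tendsto_upperbound) (auto simp: eventually_at_right_less damped intro!: eventually_at_rightI[of 0 1])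
  then show ?thesis by simp
qed

lemma strip_deriv_bound:
  fixes f :: "complex \<Rightarrow> complex"
  assumes hol: "f holomorphic_on interior strip" and bd: "\<And>z. z \<in> strip \<Longrightarrow> cmod (f z) \<le> M"
  shows "cmod ((deriv ^^ n) f (1/2)) \<le> fact n * M / (1/4) ^ n"
proof (rule Cauchy_inequality)
  show "f holomorphic_on ball (1/2) (1/4)"
    by (rule holomorphic_on_subset[OF hol]) (use ball_half_strip in auto)
  show "continuous_on (cball (1/2) (1/4)) f"
    by (rule holomorphic_on_imp_continuous_on[OF holomorphic_on_subset[OF hol ball_half_strip]])
  fix x :: complex assume "cmod (1/2 - x) = 1/4"
  then have "x \<in> cball (1/2) (1/4)" by (simp add: dist_norm)
  then show "cmod (f x) \<le> M" using ball_half_strip interior_subset bd by blast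
qed simp

section \<open>Boundary conditions tested on finitely many coordinates\<close>

context lattice_norm
begin

text \<open>
  Only this much of membership in the Calderon space is needed: both boundary conditions are tested on
  finitely many coordinates, so the completion and its dual do not occur.
\<close>

definition strip_adm :: "(complex \<Rightarrow> omega) \<Rightarrow> real \<Rightarrow> bool" where
  "strip_adm F M \<longleftrightarrow>
     (\<forall>i. bounded ((\<lambda>z. F z i) ` strip)) \<and>
     (\<forall>i. continuous_on strip (\<lambda>z. F z i)) \<and>
     (\<forall>i. (\<lambda>z. F z i) holomorphic_on interior strip) \<and>
     (\<forall>t n. N (restrict_to {..<n} (F (\<i> * complex_of_real t))) \<le> M) \<and>
     (\<forall>t n v. cmod (\<Sum>i<n. v i * F (1 + \<i> * complex_of_real t) i) \<le> M * N (restrict_to {..<n} v))"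

lemma strip_admD:
  assumes "strip_adm F M"
  shows "bounded ((\<lambda>z. F z i) ` strip)" and "continuous_on strip (\<lambda>z. F z i)"
    and "(\<lambda>z. F z i) holomorphic_on interior strip"
    and "N (restrict_to {..<n} (F (\<i> * complex_of_real t))) \<le> M"
    and "cmod (\<Sum>i<n. v i * F (1 + \<i> * complex_of_real t) i) \<le> M * N (restrict_to {..<n} v)"
  using assms by (auto simp: strip_adm_def)

lemma strip_adm_nonneg: "strip_adm F M \<Longrightarrow> 0 \<le> M"
  using strip_admD(4) nonneg[OF c00_restrict_lessThan] order_trans by blast

lemma strip_adm_add:
  assumes F: "strip_adm F M" and G: "strip_adm G M'"
  shows "strip_adm (\<lambda>z. F z + G z) (M + M')"
  unfolding strip_adm_def
proof (intro conjI allI)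
  fix i show "bounded ((\<lambda>z. (F z + G z) i) ` strip)"
    using bounded_plus_comp[OF strip_admD(1)[OF F, of i] strip_admD(1)[OF G, of i]] by simp
  show "continuous_on strip (\<lambda>z. (F z + G z) i)"
    using strip_admD(2)[OF F] strip_admD(2)[OF G] by (auto intro!: continuous_intros)
  show "(\<lambda>z. (F z + G z) i) holomorphic_on interior strip"
    using strip_admD(3)[OF F] strip_admD(3)[OF G] by (auto intro!: holomorphic_intros)
next
  fix t n
  let ?z = "\<i> * complex_of_real t"
  have "N (restrict_to {..<n} (F ?z + G ?z)) \<le> N (restrict_to {..<n} (F ?z)) + N (restrict_to {..<n} (G ?z))"
    unfolding restrict_add by (rule triangle) auto
  also have "\<dots> \<le> M + M'" by (intro add_mono strip_admD(4) F G)
  finally show "N (restrict_to {..<n} (F ?z + G ?z)) \<le> M + M'" .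
next
  fix t n v
  let ?z = "1 + \<i> * complex_of_real t"
  have "(\<Sum>i<n. v i * (F ?z + G ?z) i) = (\<Sum>i<n. v i * F ?z i) + (\<Sum>i<n. v i * G ?z i)"
    by (simp add: distrib_left sum.distrib)
  also have "cmod \<dots> \<le> cmod (\<Sum>i<n. v i * F ?z i) + cmod (\<Sum>i<n. v i * G ?z i)" by (rule norm_triangle_ineq)
  also have "\<dots> \<le> M * N (restrict_to {..<n} v) + M' * N (restrict_to {..<n} v)"
    by (intro add_mono strip_admD(5) F G)
  finally show "cmod (\<Sum>i<n. v i * (F ?z + G ?z) i) \<le> (M + M') * N (restrict_to {..<n} v)"
    by (simp add: algebra_simps)
qed

lemma strip_adm_scale:
  assumes F: "strip_adm F M" shows "strip_adm (\<lambda>z. scale c (F z)) (cmod c * M)"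
  unfolding strip_adm_def
proof (intro conjI allI)
  fix i
  obtain K where "\<And>z. z \<in> strip \<Longrightarrow> cmod (F z i) \<le> K"
    using strip_admD(1)[OF F, of i] by (auto simp: bounded_iff)
  then have "cmod (c * F z i) \<le> cmod c * K" if "z \<in> strip" for z
    using that by (simp add: norm_mult mult_left_mono)
  then show "bounded ((\<lambda>z. scale c (F z) i) ` strip)" by (auto simp: bounded_iff scale_def)
  show "continuous_on strip (\<lambda>z. scale c (F z) i)"
    using strip_admD(2)[OF F] by (auto simp: scale_def intro!: continuous_intros)
  show "(\<lambda>z. scale c (F z) i) holomorphic_on interior strip"
    using strip_admD(3)[OF F] by (auto simp: scale_def intro!: holomorphic_intros)
next
  fix t n
  show "N (restrict_to {..<n} (scale c (F (\<i> * complex_of_real t)))) \<le> cmod c * M"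
    unfolding restrict_scale by (simp add: homog mult_left_mono strip_admD(4)[OF F])
next
  fix t n v
  let ?z = "1 + \<i> * complex_of_real t"
  have "(\<Sum>i<n. v i * scale c (F ?z) i) = c * (\<Sum>i<n. v i * F ?z i)"
    by (simp add: scale_def sum_distrib_left mult_ac)
  then have "cmod (\<Sum>i<n. v i * scale c (F ?z) i) = cmod c * cmod (\<Sum>i<n. v i * F ?z i)"
    by (simp add: norm_mult)
  also have "\<dots> \<le> cmod c * (M * N (restrict_to {..<n} v))"
    by (intro mult_left_mono strip_admD(5) F) auto
  finally show "cmod (\<Sum>i<n. v i * scale c (F ?z) i) \<le> cmod c * M * N (restrict_to {..<n} v)"
    by (simp add: mult_ac)
qed

lemma strip_adm_diff:
  assumes "strip_adm F M" and "strip_adm G M'"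
  shows "strip_adm (\<lambda>z. F z - G z) (M + M')"
proof -
  have "(\<lambda>z. F z - G z) = (\<lambda>z. F z + scale (-1) (G z))" by (auto simp: scale_def fun_eq_iff)
  then show ?thesis using strip_adm_add[OF assms(1) strip_adm_scale[OF assms(2), of "-1"]] by simp
qed

lemma strip_adm_zero: "strip_adm (\<lambda>z. 0) 0"
proof -
  have "restrict_to A 0 = 0" for A by (auto simp: restrict_to_def)
  then show ?thesis unfolding strip_adm_def by (auto simp: zero bounded_iff)
qed

lemma strip_adm_sum:
  "(\<And>j. j \<in> A \<Longrightarrow> strip_adm (F j) (M j)) \<Longrightarrow> strip_adm (\<lambda>z. \<Sum>j\<in>A. F j z) (\<Sum>j\<in>A. M j)"
proof (induction A rule: infinite_finite_induct)
  case (insert a A)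
  have "strip_adm (\<lambda>z. F a z + (\<Sum>j\<in>A. F j z)) (M a + (\<Sum>j\<in>A. M j))"
    using insert by (intro strip_adm_add) auto
  moreover have "(\<lambda>z. \<Sum>j\<in>insert a A. F j z) = (\<lambda>z. F a z + (\<Sum>j\<in>A. F j z))"
    using insert by (intro ext) (simp add: sum_omega_apply)
  moreover have "(\<Sum>j\<in>insert a A. M j) = M a + (\<Sum>j\<in>A. M j)" using insert by simp
  ultimately show ?case by (simp only:)
next
  case (infinite A)
  then have "(\<lambda>z. \<Sum>j\<in>A. F j z) = (\<lambda>z. 0)" "(\<Sum>j\<in>A. M j) = 0" by auto
  then show ?case using strip_adm_zero by (simp only:)
qed (simp only: sum.empty strip_adm_zero)

text \<open>The passage from the completion and its dual to finite tests. Boundedness of the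
  boundary values is needed to read \<open>calderon_norm\<close>, a supremum of reals, as a
  bound.\<close>

lemma calderon_strip_adm:
  fixes X defines "X \<equiv> completion N"
  assumes F: "F \<in> calderon X (dual X)" and le: "calderon_norm X (dual X) F \<le> M"
  shows "strip_adm F M"
  unfolding strip_adm_def
proof (intro conjI allI)
  fix i
  show "bounded ((\<lambda>z. F z i) ` strip)" using F by (simp add: calderon_def)
  have cont: "continuous_on strip F" and an: "(\<lambda>z. F z i) analytic_on interior strip"
    using F by (simp_all add: calderon_def)
  show "continuous_on strip (\<lambda>z. F z i)"
    by (rule continuous_on_product_then_coordinatewise[OF cont])
  show "(\<lambda>z. F z i) holomorphic_on interior strip"
    by (rule analytic_imp_holomorphic[OF an])
next
  fix t n
  let ?z = "\<lambda>t. \<i> * complex_of_real t"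
  have "bounded_continuous_into X (\<lambda>t. F (?z t))" using F by (simp add: calderon_def)
  then have mem: "F (?z t) \<in> vecs X" and bdd: "bdd_above (range (\<lambda>t. nrm X (F (?z t))))"
    by (auto simp: bounded_continuous_into_def)
  have "N (restrict_to {..<n} (F (?z t))) \<le> nrm X (F (?z t))"
    using restrict_le_nrm mem by (simp add: X_def)
  also have "\<dots> \<le> (SUP t. nrm X (F (?z t)))" by (rule cSUP_upper[OF _ bdd]) simp
  also have "\<dots> \<le> M" using le by (simp add: calderon_norm_def)
  finally show "N (restrict_to {..<n} (F (?z t))) \<le> M" .
next
  fix t n v
  let ?z = "\<lambda>t. 1 + \<i> * complex_of_real t"
  have "bounded_continuous_into (dual X) (\<lambda>t. F (?z t))" using F by (simp add: calderon_def)
  then have mem: "F (?z t) \<in> vecs (dual X)" and bdd: "bdd_above (range (\<lambda>t. nrm (dual X) (F (?z t))))"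
    by (auto simp: bounded_continuous_into_def)
  have "cmod (\<Sum>i<n. v i * F (?z t) i) \<le> nrm (dual X) (F (?z t)) * N (restrict_to {..<n} v)"
    using dual_pairing mem unfolding X_def by blast
  also have "\<dots> \<le> M * N (restrict_to {..<n} v)"
  proof (rule mult_right_mono)
    have "nrm (dual X) (F (?z t)) \<le> (SUP t. nrm (dual X) (F (?z t)))" by (rule cSUP_upper[OF _ bdd]) simp
    also have "\<dots> \<le> M" using le by (simp add: calderon_norm_def)
    finally show "nrm (dual X) (F (?z t)) \<le> M" .
  qed (simp add: nonneg)
  finally show "cmod (\<Sum>i<n. v i * F (?z t) i) \<le> M * N (restrict_to {..<n} v)" .
qed

text \<open>Both boundary conditions control single coordinates: the left one because
  \<open>N\<close> dominates them, the right one by testing against a unit vector.\<close>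

lemma strip_adm_coord:
  assumes F: "strip_adm F M" and z: "z \<in> strip" shows "cmod (F z i) \<le> M"
proof (rule strip_max_principle[OF strip_admD(2,3,1)[OF F] _ _ z])
  fix t
  show "cmod (F (\<i> * complex_of_real t) i) \<le> M"
  proof -
    let ?x = "F (\<i> * complex_of_real t)"
    have "cmod (?x i) = cmod (restrict_to {..<Suc i} ?x i)" by (simp add: restrict_to_def)
    also have "\<dots> \<le> N (restrict_to {..<Suc i} ?x)" by (intro coord_le c00_restrict_lessThan)
    also have "\<dots> \<le> M" by (rule strip_admD(4)[OF F])
    finally show ?thesis .
  qed
  have "(\<Sum>k<Suc i. unit_vec i k * F (1 + \<i> * complex_of_real t) k) = F (1 + \<i> * complex_of_real t) i"
    by (simp add: unit_vec_def)
  moreover have "restrict_to {..<Suc i} (unit_vec i) = unit_vec i"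
    by (auto simp: restrict_to_def unit_vec_def)
  ultimately show "cmod (F (1 + \<i> * complex_of_real t) i) \<le> M"
    using strip_admD(5)[OF F, where n = "Suc i" and v = "unit_vec i" and t = t] unit by simp
qed

lemma strip_adm_deriv_coord:
  assumes "strip_adm F M" shows "cmod (deriv (\<lambda>z. F z i) (1/2)) \<le> 4 * M"
  using strip_deriv_bound[OF strip_admD(3)[OF assms] strip_adm_coord[OF assms], where n = 1] by (simp add: mult.commute)

text \<open>
  The function \<open>\<Sum>i<n. F z i * cnj (F (1 - cnj z) i)\<close> pairs the two boundary lines with each other,
  hence is bounded by \<open>M\<^sup>2\<close>, and has second derivative \<open>- 2 * (\<Sum>i<n. \<bar>F' i\<bar>\<^sup>2)\<close> at a zero
  \<open>1/2\<close> of \<open>F\<close>.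
\<close>

lemma strip_adm_deriv:
  assumes F: "strip_adm F M" and zero: "F (1/2) = 0"
  shows "L2_set (\<lambda>i. cmod (deriv (\<lambda>z. F z i) (1/2))) {..<n} \<le> 4 * M"
proof -
  let ?S = "interior strip"
  define f where "f i = (\<lambda>z. F z i)" for i
  \<comment> \<open>The map \<open>z \<mapsto> 1 - cnj z\<close> reflects in the line Re z = 1/2: it
    exchanges the boundary lines and fixes 1/2. The two conjugations make \<open>ft\<close>
    holomorphic.\<close>
  define ft where "ft i = (\<lambda>z. cnj (f i (1 - cnj z)))" for i
  define G where "G = (\<lambda>z. \<Sum>i<n. f i z * ft i z)"
  define D where "D = (\<lambda>z. \<Sum>i<n. f i z * deriv (ft i) z + deriv (f i) z * ft i z)"
  have refl: "1 - cnj z \<in> strip" if "z \<in> strip" for z using that by (simp add: strip_def)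
  have refl': "1 - cnj z \<in> ?S" if "z \<in> ?S" for z using that by (simp add: interior_strip)
  have hol: "f i holomorphic_on ?S" for i using strip_admD(3)[OF F] by (simp add: f_def)
  have df: "(f i has_field_derivative deriv (f i) z) (at z)" if "z \<in> ?S" for i z
    by (rule holomorphic_derivI[OF hol open_interior that])
  have dft: "(ft i has_field_derivative - cnj (deriv (f i) (1 - cnj z))) (at z)" if "z \<in> ?S" for i z
  proof -
    have "((\<lambda>w. f i (1 - w)) has_field_derivative deriv (f i) (1 - cnj z) * (0 - 1)) (at (cnj z))"
      by (rule DERIV_chain2[where f = "f i" and g = "\<lambda>w. 1 - w", OF df[OF refl'[OF that]]]) (auto intro!: derivative_eq_intros)
    then have "((cnj \<circ> (\<lambda>w. f i (1 - w)) \<circ> cnj) has_field_derivative cnj (deriv (f i) (1 - cnj z) * (0 - 1))) (at z)"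
      by (rule has_field_derivative_cnj_cnj)
    then show ?thesis by (simp add: ft_def o_def)
  qed
  then have holt: "ft i holomorphic_on ?S" for i by (auto simp: holomorphic_on_open)
  have dG: "(G has_field_derivative D z) (at z)" if "z \<in> ?S" for z
    unfolding G_def D_def
    by (intro DERIV_sum DERIV_mult' df holomorphic_derivI[OF holt open_interior] that)
  have ddf: "(deriv (f i) has_field_derivative deriv (deriv (f i)) (1/2)) (at (1/2))" for i
    by (rule holomorphic_derivI[OF holomorphic_deriv[OF hol open_interior] open_interior half_in_strip(1)])
  have ddft: "(deriv (ft i) has_field_derivative deriv (deriv (ft i)) (1/2)) (at (1/2))" for i
    by (rule holomorphic_derivI[OF holomorphic_deriv[OF holt open_interior] open_interior half_in_strip(1)])
  have f0: "f i (1/2) = 0" "ft i (1/2) = 0" for i using zero by (auto simp: f_def ft_def)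
  have ft': "deriv (ft i) (1/2) = - cnj (deriv (f i) (1/2))" for i
    using DERIV_imp_deriv[OF dft[OF half_in_strip(1)]] by simp
  \<comment> \<open>Every term with an undifferentiated factor vanishes at 1/2; the two mixed terms
    remain, each equal to minus a squared modulus.\<close>
  have "(D has_field_derivative (\<Sum>i<n. (f i (1/2) * deriv (deriv (ft i)) (1/2) + deriv (f i) (1/2) * deriv (ft i) (1/2))
      + (deriv (f i) (1/2) * deriv (ft i) (1/2) + deriv (deriv (f i)) (1/2) * ft i (1/2)))) (at (1/2))"
    unfolding D_def
    by (intro DERIV_sum DERIV_add DERIV_mult' ddf ddft df[OF half_in_strip(1)]
        holomorphic_derivI[OF holt open_interior half_in_strip(1)])
  also have "(\<Sum>i<n. (f i (1/2) * deriv (deriv (ft i)) (1/2) + deriv (f i) (1/2) * deriv (ft i) (1/2))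
      + (deriv (f i) (1/2) * deriv (ft i) (1/2) + deriv (deriv (f i)) (1/2) * ft i (1/2)))
      = - 2 * complex_of_real (\<Sum>i<n. (cmod (deriv (f i) (1/2)))\<^sup>2)"
    unfolding f0 ft' of_real_sum sum_distrib_left complex_norm_square by (intro sum.cong) auto
  finally have dD: "(D has_field_derivative - 2 * complex_of_real (\<Sum>i<n. (cmod (deriv (f i) (1/2)))\<^sup>2)) (at (1/2))" .
  have "(deriv G has_field_derivative - 2 * complex_of_real (\<Sum>i<n. (cmod (deriv (f i) (1/2)))\<^sup>2)) (at (1/2))"
    by (rule has_field_derivative_transform_within_open[OF dD open_interior half_in_strip(1)])
       (simp add: DERIV_imp_deriv[OF dG])
  then have "(deriv ^^ 2) G (1/2) = - 2 * complex_of_real (\<Sum>i<n. (cmod (deriv (f i) (1/2)))\<^sup>2)"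
    by (simp add: numeral_2_eq_2 DERIV_imp_deriv)
  then have norm2: "cmod ((deriv ^^ 2) G (1/2)) = 2 * (\<Sum>i<n. (cmod (deriv (f i) (1/2)))\<^sup>2)"
    by (simp add: norm_mult sum_nonneg del: of_real_sum)
  have pair: "cmod (\<Sum>i<n. f i (\<i> * complex_of_real t) * cnj (f i (1 + \<i> * complex_of_real t))) \<le> M * M" for t
  proof -
    let ?v = "\<lambda>i. cnj (f i (\<i> * complex_of_real t))"
    have "(\<Sum>i<n. f i (\<i> * complex_of_real t) * cnj (f i (1 + \<i> * complex_of_real t)))
        = cnj (\<Sum>i<n. ?v i * F (1 + \<i> * complex_of_real t) i)" by (simp add: f_def)
    then have "cmod (\<Sum>i<n. f i (\<i> * complex_of_real t) * cnj (f i (1 + \<i> * complex_of_real t)))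
        \<le> M * N (restrict_to {..<n} ?v)"
      using strip_admD(5)[OF F, where n = n and v = ?v and t = t] by (simp only: complex_mod_cnj)
    \<comment> \<open>Conjugation does not change the lattice norm, so the conjugated left boundary
      value is a legitimate test vector for the right one.\<close>
    also have "N (restrict_to {..<n} ?v) = N (restrict_to {..<n} (F (\<i> * complex_of_real t)))"
      by (rule cmod_cong[OF c00_restrict_lessThan]) (auto simp: restrict_to_def f_def)
    also have "M * \<dots> \<le> M * M"
      by (intro mult_left_mono strip_admD(4) F strip_adm_nonneg[OF F])
    finally show ?thesis .
  qed
  have "cmod (G z) \<le> M * M" if "z \<in> strip" for z
  proof (rule strip_max_principle[OF _ _ _ _ _ that])
    have "continuous_on strip (ft i)" for i
    proof -
      have "continuous_on strip (\<lambda>z. f i (1 - cnj z))"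
        by (rule continuous_on_compose2[OF strip_admD(2)[OF F, of i, folded f_def]])
           (auto intro!: continuous_intros refl)
      then show ?thesis unfolding ft_def by (intro continuous_intros)
    qed
    then show "continuous_on strip G"
      unfolding G_def using strip_admD(2)[OF F] by (auto simp: f_def intro!: continuous_intros)
    show "G holomorphic_on ?S" unfolding G_def by (intro holomorphic_intros hol holt)
    \<comment> \<open>This crude bound grows with n, but it serves only as the boundedness required
      by the maximum principle, which returns \<open>M * M\<close>.\<close>
    have "cmod (G z) \<le> (\<Sum>i<n. M * M)" if "z \<in> strip" for z
      unfolding G_def
    proof (rule sum_norm_le)
      fix i
      show "cmod (f i z * ft i z) \<le> M * M"
        unfolding norm_mult ft_def complex_mod_cnj f_def
        by (intro mult_mono strip_adm_coord[OF F] refl that strip_adm_nonneg[OF F]) auto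
    qed
    then show "bounded (G ` strip)" by (auto simp: bounded_iff)
    fix t
    show "cmod (G (\<i> * complex_of_real t)) \<le> M * M"
      using pair[of t] by (simp add: G_def ft_def)
    have "cnj (\<Sum>i<n. f i (\<i> * complex_of_real t) * cnj (f i (1 + \<i> * complex_of_real t)))
      = G (1 + \<i> * complex_of_real t)" by (simp add: G_def ft_def mult.commute)
    then show "cmod (G (1 + \<i> * complex_of_real t)) \<le> M * M"
      using pair[of t] by (metis complex_mod_cnj)
  qed
  moreover have "G holomorphic_on ?S" unfolding G_def by (intro holomorphic_intros hol holt)
  ultimately have "cmod ((deriv ^^ 2) G (1/2)) \<le> fact 2 * (M * M) / (1/4) ^ 2"
    by (intro strip_deriv_bound)
  then have "(\<Sum>i<n. (cmod (deriv (f i) (1/2)))\<^sup>2) \<le> (4 * M)\<^sup>2"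
    unfolding norm2 by (simp add: power2_eq_square fact_numeral)
  then show ?thesis unfolding L2_set_def f_def
    using strip_adm_nonneg[OF F] by (intro real_le_lsqrt) (auto simp: sum_nonneg)
qed

end

subsection \<open>Square-summable sequences\<close>

text \<open>A bound on all partial sums yields membership in \<open>ell2\<close> and the norm bound
  together, so estimates can be added without separate summability conditions.\<close>

definition ell2_le :: "omega \<Rightarrow> real \<Rightarrow> bool" where
  "ell2_le x M \<longleftrightarrow> (\<forall>n. L2_set (\<lambda>i. cmod (x i)) {..<n} \<le> M)"

lemma ell2_norm_nonneg [simp]: "x \<in> ell2 \<Longrightarrow> 0 \<le> ell2_norm x"
  by (simp add: ell2_def ell2_norm_def suminf_nonneg)

lemma ell2_leD: assumes "ell2_le x M" shows "x \<in> ell2" and "ell2_norm x \<le> M"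
proof -
  have M: "0 \<le> M" using assms L2_set_nonneg order_trans unfolding ell2_le_def by blast
  have le: "(\<Sum>i<n. (cmod (x i))\<^sup>2) \<le> M\<^sup>2" for n
    using assms unfolding ell2_le_def L2_set_def by (metis real_sqrt_le_iff real_sqrt_abs M abs_of_nonneg)
  have sm: "summable (\<lambda>i. (cmod (x i))\<^sup>2)"
    by (rule summableI_nonneg_bounded[OF _ le]) simp
  then show "x \<in> ell2" by (simp add: ell2_def)
  have "(\<Sum>i. (cmod (x i))\<^sup>2) \<le> M\<^sup>2" by (rule suminf_le_const[OF sm le])
  then show "ell2_norm x \<le> M" unfolding ell2_norm_def using M by (intro real_le_lsqrt) auto
qed

lemma ell2_le_norm: "x \<in> ell2 \<Longrightarrow> ell2_le x (ell2_norm x)"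
  unfolding ell2_le_def ell2_norm_def L2_set_def ell2_def
  by (auto intro!: sum_le_suminf)

lemma ell2_coord_le: assumes "x \<in> ell2" shows "cmod (x i) \<le> ell2_norm x"
proof -
  have "cmod (x i) \<le> L2_set (\<lambda>i. cmod (x i)) {..<Suc i}" by (rule member_le_L2_set) auto
  then show ?thesis using ell2_le_norm[OF assms] unfolding ell2_le_def by (meson order_trans)
qed

lemma ell2_le_weaken: "ell2_le x M \<Longrightarrow> M \<le> M' \<Longrightarrow> ell2_le x M'"
  unfolding ell2_le_def by (meson order_trans)

lemma ell2_le_cmod_mono:
  assumes "ell2_le y M" and "\<And>i. cmod (x i) \<le> cmod (y i)" shows "ell2_le x M"
proof -
  have "L2_set (\<lambda>i. cmod (x i)) {..<n} \<le> L2_set (\<lambda>i. cmod (y i)) {..<n}" for n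
    using assms(2) by (intro L2_set_mono) auto
  then show ?thesis using assms(1) unfolding ell2_le_def by (meson order_trans)
qed

lemma ell2_le_add:
  assumes "ell2_le x M" and "ell2_le y M'" shows "ell2_le (x + y) (M + M')"
  unfolding ell2_le_def
proof
  fix n
  have "L2_set (\<lambda>i. cmod ((x + y) i)) {..<n} \<le> L2_set (\<lambda>i. cmod (x i) + cmod (y i)) {..<n}"
    by (intro L2_set_mono) (auto intro: norm_triangle_ineq)
  also have "\<dots> \<le> L2_set (\<lambda>i. cmod (x i)) {..<n} + L2_set (\<lambda>i. cmod (y i)) {..<n}"
    by (rule L2_set_triangle_ineq)
  also have "\<dots> \<le> M + M'" using assms unfolding ell2_le_def by (intro add_mono) auto
  finally show "L2_set (\<lambda>i. cmod ((x + y) i)) {..<n} \<le> M + M'" .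
qed

lemma ell2_le_scale: assumes "ell2_le x M" shows "ell2_le (scale c x) (cmod c * M)"
  unfolding ell2_le_def
proof
  fix n
  have "L2_set (\<lambda>i. cmod (scale c x i)) {..<n} = cmod c * L2_set (\<lambda>i. cmod (x i)) {..<n}"
    by (simp add: scale_def norm_mult L2_set_right_distrib)
  also have "\<dots> \<le> cmod c * M" using assms by (intro mult_left_mono) (auto simp: ell2_le_def)
  finally show "L2_set (\<lambda>i. cmod (scale c x i)) {..<n} \<le> cmod c * M" .
qed

lemma ell2_le_diff:
  assumes "ell2_le x M" and "ell2_le y M'" shows "ell2_le (x - y) (M + M')"
proof -
  have "x - y = x + scale (-1) y" by (auto simp: scale_def fun_eq_iff)
  moreover have "ell2_le (x + scale (-1) y) (M + M')"
    using ell2_le_add[OF assms(1) ell2_le_scale[OF assms(2), of "-1"]] by simp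
  ultimately show ?thesis by (simp only:)
qed

lemma ell2_le_zero: "ell2_le 0 0" by (simp add: ell2_le_def L2_set_def)

lemma ell2_le_sum:
  "finite A \<Longrightarrow> (\<And>j. j \<in> A \<Longrightarrow> ell2_le (x j) (M j)) \<Longrightarrow> ell2_le (\<Sum>j\<in>A. x j) (\<Sum>j\<in>A. M j)"
proof (induction A rule: finite_induct)
  case empty show ?case using ell2_le_zero by (simp only: sum.empty)
next
  case (insert a A)
  have "ell2_le (x a + (\<Sum>j\<in>A. x j)) (M a + (\<Sum>j\<in>A. M j))"
    using insert by (intro ell2_le_add) auto
  moreover have "(\<Sum>j\<in>insert a A. x j) = x a + (\<Sum>j\<in>A. x j)"
    using insert by (intro ext) (simp add: sum_omega_apply)
  moreover have "(\<Sum>j\<in>insert a A. M j) = M a + (\<Sum>j\<in>A. M j)" using insert by simp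
  ultimately show ?case by (simp only:)
qed

lemma ell2_add [simp]: "x \<in> ell2 \<Longrightarrow> y \<in> ell2 \<Longrightarrow> x + y \<in> ell2"
  and ell2_diff [simp]: "x \<in> ell2 \<Longrightarrow> y \<in> ell2 \<Longrightarrow> x - y \<in> ell2"
  and ell2_scale [simp]: "x \<in> ell2 \<Longrightarrow> scale c x \<in> ell2"
  by (meson ell2_le_norm ell2_leD(1) ell2_le_add ell2_le_diff ell2_le_scale)+

lemma ell2_sum: "finite A \<Longrightarrow> (\<And>j. j \<in> A \<Longrightarrow> x j \<in> ell2) \<Longrightarrow> (\<Sum>j\<in>A. x j) \<in> ell2"
  using ell2_le_sum[of A x "\<lambda>j. ell2_norm (x j)"] ell2_le_norm ell2_leD(1) by blast

lemma ell2_norm_eq_finite: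
  assumes "finite S" and "\<And>i. i \<notin> S \<Longrightarrow> x i = 0"
  shows "ell2_norm x = sqrt (\<Sum>i\<in>S. (cmod (x i))\<^sup>2)"
  unfolding ell2_norm_def using assms by (subst suminf_finite[OF assms(1)]) auto

lemma c00_ell2 [simp]: "x \<in> c00 \<Longrightarrow> x \<in> ell2"
  unfolding ell2_def c00_def supp_def
  by (auto intro!: summable_finite[of "{i. x i \<noteq> 0}"])

lemma ell2_norm_triangle:
  assumes "x \<in> ell2" and "y \<in> ell2"
  shows "ell2_norm (x + y) \<le> ell2_norm x + ell2_norm y" and "ell2_norm (x - y) \<le> ell2_norm x + ell2_norm y"
  using assms by (auto intro!: ell2_leD(2) ell2_le_add ell2_le_diff ell2_le_norm)

lemma ell2_norm_scale: assumes "x \<in> ell2" shows "ell2_norm (scale c x) = cmod c * ell2_norm x"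
proof -
  have "(\<Sum>i. (cmod (scale c x i))\<^sup>2) = (cmod c)\<^sup>2 * (\<Sum>i. (cmod (x i))\<^sup>2)"
    using assms by (simp add: ell2_def scale_def norm_mult power_mult_distrib suminf_mult)
  then show ?thesis by (simp add: ell2_norm_def real_sqrt_mult)
qed

lemma ell2_tail:
  assumes "x \<in> ell2" and "0 < e"
  obtains m where "\<And>n. m \<le> n \<Longrightarrow> ell2_norm (restrict_to {n..} x) \<le> e"
proof -
  have sm: "summable (\<lambda>i. (cmod (x i))\<^sup>2)" using assms by (simp add: ell2_def)
  obtain m where m: "\<And>n k. m \<le> n \<Longrightarrow> norm (\<Sum>i=n..<k. (cmod (x i))\<^sup>2) < e\<^sup>2"
    using sm[unfolded summable_Cauchy, rule_format, of "e\<^sup>2"] assms(2) by auto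
  have "ell2_norm (restrict_to {n..} x) \<le> e" if "m \<le> n" for n
  proof (rule ell2_leD(2))
    show "ell2_le (restrict_to {n..} x) e"
      unfolding ell2_le_def
    proof
      fix k
      have "(\<Sum>i<k. (cmod (restrict_to {n..} x i))\<^sup>2) = (\<Sum>i=n..<k. (cmod (x i))\<^sup>2)"
        by (rule sum.mono_neutral_cong_right) (auto simp: restrict_to_def)
      also have "\<dots> \<le> e\<^sup>2" using m[OF that, of k] by simp
      finally show "L2_set (\<lambda>i. cmod (restrict_to {n..} x i)) {..<k} \<le> e"
        unfolding L2_set_def using assms(2) by (intro real_le_lsqrt) (auto simp: sum_nonneg)
    qed
  qed
  then show ?thesis using that by blast
qed

subsection \<open>Factorisation of finitely supported vectors\<close>

context lattice_norm
begin

lemma of_real_abs_eq: "x \<in> c00 \<Longrightarrow> N (\<lambda>i. complex_of_real (cmod (x i))) = N x"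
  by (rule cmod_cong[symmetric]) auto

text \<open>Vectors supported in S with \<open>N\<close> at most 1 form a compact set for the
  product topology. The product of powers, unlike the sum of logarithms, is continuous also where
  coordinates vanish.\<close>

lemma maximiser_exists:
  fixes p :: "nat \<Rightarrow> real"
  assumes S: "finite S" "S \<noteq> {}" and p: "\<And>i. i \<in> S \<Longrightarrow> 0 < p i"
  obtains a :: "nat \<Rightarrow> real" where "\<And>i. i \<in> S \<Longrightarrow> 0 < a i" and "\<And>i. i \<notin> S \<Longrightarrow> a i = 0"
    and "N (\<lambda>i. complex_of_real (a i)) \<le> 1"
    and "\<And>g :: omega. (\<And>i. i \<notin> S \<Longrightarrow> g i = 0) \<Longrightarrow> N g \<le> 1 \<Longrightarrow>
      (\<Prod>i\<in>S. cmod (g i) powr p i) \<le> (\<Prod>i\<in>S. a i powr p i)"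
proof -
  define n where "n = Suc (Max S)"
  have Sn: "S \<subseteq> {..<n}" using S by (auto simp: n_def less_Suc_eq_le)
  define P where "P = Pi\<^sub>E UNIV (\<lambda>i. if i \<in> S then cball (0::complex) 1 else {0})"
  have res: "restrict_to {..<n} f = f" if "f \<in> P" for f
    using that Sn by (force simp: P_def restrict_to_def fun_eq_iff PiE_iff split: if_splits)
  have Pc: "f \<in> c00" if "f \<in> P" for f using res[OF that] c00_restrict_lessThan by metis
  define K where "K = P \<inter> {f. N (restrict_to {..<n} f) \<le> 1}"
  have "compactin (product_topology (\<lambda>i. euclidean) UNIV) P"
    unfolding P_def compactin_PiE by (auto simp: compactin_euclidean_iff)
  then have "compact P" by (simp add: euclidean_product_topology)
  have coord: "((\<lambda>f. f i) \<longlongrightarrow> g i) (at g)" for i and g :: omega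
  proof -
    have "continuous_on UNIV (\<lambda>f::omega. f i)" by simp
    then show ?thesis by (simp add: continuous_on_def)
  qed
  have "continuous_on UNIV (\<lambda>f. N (restrict_to {..<n} f))"
    unfolding continuous_on_def by (auto intro!: restrict_tendsto coord)
  then have "closed {f. N (restrict_to {..<n} f) \<le> 1}"
    by (intro closed_Collect_le continuous_on_const)
  then have K: "compact K" unfolding K_def using \<open>compact P\<close> by (rule compact_Int_closed[rotated])
  define h where "h f = (\<Prod>i\<in>S. cmod (f i) powr p i)" for f :: omega
  have "continuous_on K h"
    unfolding h_def using p
    by (auto intro!: continuous_intros continuous_on_powr' continuous_on_subset[OF continuous_on_product_coordinates])
  \<comment> \<open>A uniform vector has \<open>N\<close> at most its l_1 norm 1 and a positive
    product. So the maximum is positive, and the maximiser vanishes nowhere on S.\<close>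
  moreover define f0 :: omega where "f0 = (\<lambda>i. if i \<in> S then of_real (1 / real (card S)) else 0)"
  have card: "0 < card S" using S by (simp add: card_gt_0_iff)
  have f0: "f0 \<in> K" "0 < h f0"
  proof -
    have f0P: "f0 \<in> P" using card by (auto simp: P_def f0_def norm_divide)
    have "N f0 \<le> ell1_norm f0" by (rule le_ell1[OF Pc[OF f0P]])
    also have "\<dots> = (\<Sum>i\<in>S. cmod (f0 i))" by (rule ell1_norm_superset[OF S(1)]) (auto simp: supp_def f0_def)
    also have "\<dots> = 1" using card by (simp add: f0_def norm_divide)
    finally show "f0 \<in> K" using f0P res[OF f0P] by (simp add: K_def)
    show "0 < h f0" unfolding h_def f0_def using card by (auto intro!: prod_pos simp: norm_divide)
  qed
  ultimately obtain f where f: "f \<in> K" "\<And>g. g \<in> K \<Longrightarrow> h g \<le> h f"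
    using continuous_attains_sup[OF K] by blast
  have fP: "f \<in> P" using f by (simp add: K_def)
  have pos: "f i \<noteq> 0" if "i \<in> S" for i
  proof
    assume "f i = 0"
    then have "h f = 0" unfolding h_def using that S(1) by (auto intro!: prod_zero)
    then show False using f(2)[OF f0(1)] f0(2) by simp
  qed
  show ?thesis
  proof (rule that[of "\<lambda>i. cmod (f i)"])
    show "\<And>i. i \<in> S \<Longrightarrow> 0 < cmod (f i)" using pos by simp
    show "cmod (f i) = 0" if "i \<notin> S" for i
    proof -
      have "f i \<in> (if i \<in> S then cball 0 1 else {0})" using fP unfolding P_def by blast
      then show ?thesis using that by simp
    qed
    show "N (\<lambda>i. complex_of_real (cmod (f i))) \<le> 1"
      using f(1) res[OF fP] of_real_abs_eq[OF Pc[OF fP]] by (simp add: K_def)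
    fix g :: omega assume g: "\<And>i. i \<notin> S \<Longrightarrow> g i = 0" "N g \<le> 1"
    have "\<forall>i\<ge>n. g i = 0" using g(1) Sn by (meson lessThan_iff linorder_not_less subsetD)
    then have gc: "g \<in> c00" using c00_iff_bound by blast
    have "cmod (g i) \<le> 1" for i using coord_le[OF gc, of i] g(2) by linarith
    then have gP: "g \<in> P" using g(1) by (auto simp: P_def)
    then have "g \<in> K" using res[OF gP] g(2) by (simp add: K_def)
    then show "(\<Prod>i\<in>S. cmod (g i) powr p i) \<le> (\<Prod>i\<in>S. cmod (f i) powr p i)"
      using f(2) by (simp add: h_def)
  qed
qed

text \<open>Stationarity of \<open>a\<close> along the segment towards \<open>\<bar>v\<bar>\<close>.\<close>

lemma maximiser_dual_bound:
  fixes p a :: "nat \<Rightarrow> real"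
  assumes S: "finite S" and p: "\<And>i. i \<in> S \<Longrightarrow> 0 < p i"
    and a: "\<And>i. i \<in> S \<Longrightarrow> 0 < a i" "\<And>i. i \<notin> S \<Longrightarrow> a i = 0" "N (\<lambda>i. complex_of_real (a i)) \<le> 1"
    and max: "\<And>g :: omega. (\<And>i. i \<notin> S \<Longrightarrow> g i = 0) \<Longrightarrow> N g \<le> 1 \<Longrightarrow>
      (\<Prod>i\<in>S. cmod (g i) powr p i) \<le> (\<Prod>i\<in>S. a i powr p i)"
    and v: "v \<in> c00" "N v \<le> 1"
  shows "(\<Sum>i\<in>S. cmod (v i) * p i / a i) \<le> (\<Sum>i\<in>S. p i)"
proof (rule ccontr)
  assume "\<not> ?thesis"
  then have "0 < (\<Sum>i\<in>S. cmod (v i) * p i / a i) - (\<Sum>i\<in>S. p i)" by simp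
  also have "\<dots> = (\<Sum>i\<in>S. p i * ((cmod (v i) - a i) / a i))"
    unfolding sum_subtractf[symmetric]
  proof (rule sum.cong)
    fix i assume "i \<in> S"
    then show "cmod (v i) * p i / a i - p i = p i * ((cmod (v i) - a i) / a i)"
      using a(1)[of i] by (simp add: field_simps)
  qed simp
  finally have pos: "0 < (\<Sum>i\<in>S. p i * ((cmod (v i) - a i) / a i))" .
  define \<psi> where "\<psi> t = (\<Sum>i\<in>S. p i * ln (a i + t * (cmod (v i) - a i)))" for t
  have ac: "(\<lambda>i. complex_of_real (a i)) \<in> c00"
    using S a(2) unfolding c00_def supp_def by (auto intro: finite_subset[of _ S])
  have "(\<psi> has_real_derivative (\<Sum>i\<in>S. p i * ((cmod (v i) - a i) / a i))) (at 0)"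
    unfolding \<psi>_def
  proof (rule DERIV_sum)
    fix i assume "i \<in> S"
    then show "((\<lambda>t. p i * ln (a i + t * (cmod (v i) - a i))) has_real_derivative
        p i * ((cmod (v i) - a i) / a i)) (at 0)"
      using a(1)[of i] by (auto intro!: derivative_eq_intros)
  qed
  then obtain d where d: "0 < d" "\<And>t. 0 < t \<Longrightarrow> t < d \<Longrightarrow> \<psi> 0 < \<psi> (0 + t)"
    using DERIV_pos_inc_right[OF _ pos] by blast
  \<comment> \<open>Below 1, so that b stays positive on S even where v vanishes; below d, so that
    \<open>\<psi>\<close> has increased.\<close>
  define t where "t = min (1/2) (d/2)"
  have t: "0 < t" "t < d" "t < 1" using d by (auto simp: t_def)
  define b where "b i = (1 - t) * a i + t * (if i \<in> S then cmod (v i) else 0)" for i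
  have bpos: "0 < b i" if "i \<in> S" for i
    using that t a(1)[of i] unfolding b_def by (intro add_pos_nonneg) auto
  have b0: "b i = 0" if "i \<notin> S" for i using that a(2) by (simp add: b_def)
  have vS: "restrict_to S (\<lambda>i. complex_of_real (cmod (v i))) \<in> c00"
    using S by (auto simp: c00_def supp_def restrict_to_def intro: finite_subset[of _ S])
  have "(\<lambda>i. complex_of_real (b i)) = scale (of_real (1 - t)) (\<lambda>i. complex_of_real (a i))
      + scale (of_real t) (restrict_to S (\<lambda>i. complex_of_real (cmod (v i))))"
    by (auto simp: b_def scale_def restrict_to_def fun_eq_iff)
  then have "N (\<lambda>i. complex_of_real (b i)) \<le> N (scale (of_real (1 - t)) (\<lambda>i. complex_of_real (a i)))
      + N (scale (of_real t) (restrict_to S (\<lambda>i. complex_of_real (cmod (v i)))))"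
    using triangle[OF c00_scale[OF ac] c00_scale[OF vS]] by simp
  also have "\<dots> = (1 - t) * N (\<lambda>i. complex_of_real (a i)) + t * N (restrict_to S (\<lambda>i. complex_of_real (cmod (v i))))"
    using t by (simp add: homog[OF ac] homog[OF vS] del: of_real_diff)
  also have "\<dots> \<le> (1 - t) * 1 + t * 1"
  proof (intro add_mono mult_left_mono)
    have "N (restrict_to S (\<lambda>i. complex_of_real (cmod (v i)))) \<le> N v"
      by (rule mono[OF vS v(1)]) (simp add: restrict_to_def)
    then show "N (restrict_to S (\<lambda>i. complex_of_real (cmod (v i)))) \<le> 1" using v(2) by simp
  qed (use t a in auto)
  finally have "(\<Prod>i\<in>S. cmod (complex_of_real (b i)) powr p i) \<le> (\<Prod>i\<in>S. a i powr p i)"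
    using b0 by (intro max) auto
  then have "(\<Prod>i\<in>S. b i powr p i) \<le> (\<Prod>i\<in>S. a i powr p i)"
    using bpos by (simp add: less_imp_le cong: prod.cong)
  moreover have "0 < (\<Prod>i\<in>S. b i powr p i)" using bpos by (force intro: prod_pos)
  ultimately have "ln (\<Prod>i\<in>S. b i powr p i) \<le> ln (\<Prod>i\<in>S. a i powr p i)" by simp
  moreover have "ln (\<Prod>i\<in>S. c i powr p i) = (\<Sum>i\<in>S. p i * ln (c i))"
    if "\<And>i. i \<in> S \<Longrightarrow> 0 < c i" for c :: "nat \<Rightarrow> real"
  proof -
    have "ln (\<Prod>i\<in>S. c i powr p i) = (\<Sum>i\<in>S. ln (c i powr p i))"
      using S that by (intro ln_prod) force+
    also have "\<dots> = (\<Sum>i\<in>S. p i * ln (c i))" using that by (intro sum.cong) (auto simp: ln_powr)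
    finally show ?thesis .
  qed
  ultimately have "(\<Sum>i\<in>S. p i * ln (b i)) \<le> \<psi> 0" using bpos a(1) by (simp add: \<psi>_def)
  moreover have "(\<Sum>i\<in>S. p i * ln (b i)) = \<psi> t"
    unfolding \<psi>_def by (intro sum.cong) (auto simp: b_def algebra_simps)
  ultimately show False using d(2)[OF t(1,2)] by simp
qed

text \<open>Lozanovskii's factorisation from the maximiser a with weights
  \<open>p i = (cmod (x i))^2\<close>. Their sum is the square of the norm s of x, so the dual bound
  for the quotient by a is s^2, and \<open>\<phi> = s * a\<close> gives both factors the bound
  s.\<close>

lemma factorisation:
  assumes x: "x \<in> c00" "x \<noteq> 0"
  obtains \<phi> :: "nat \<Rightarrow> real" where "\<And>i. x i \<noteq> 0 \<Longrightarrow> 0 < \<phi> i" and "\<And>i. x i = 0 \<Longrightarrow> \<phi> i = 0"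
    and "N (\<lambda>i. complex_of_real (\<phi> i)) \<le> ell2_norm x"
    and "\<And>v. v \<in> c00 \<Longrightarrow> (\<Sum>i\<in>supp x. cmod (v i) * (cmod (x i))\<^sup>2 / \<phi> i) \<le> ell2_norm x * N v"
proof -
  define S where "S = supp x"
  define s where "s = ell2_norm x"
  have S: "finite S" "S \<noteq> {}" using x by (auto simp: S_def c00_def supp_def fun_eq_iff)
  have s2: "s\<^sup>2 = (\<Sum>i\<in>S. (cmod (x i))\<^sup>2)"
    unfolding s_def by (subst ell2_norm_eq_finite[OF S(1)]) (auto simp: S_def supp_def sum_nonneg)
  have xS: "0 < (cmod (x i))\<^sup>2" if "i \<in> S" for i using that by (simp add: S_def supp_def)
  have "0 < s\<^sup>2" unfolding s2 using S xS by (intro sum_pos) auto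
  moreover have "0 \<le> s" using x by (simp add: s_def)
  ultimately have s: "0 < s" by (simp add: zero_less_power2)
  obtain a :: "nat \<Rightarrow> real" where a: "\<And>i. i \<in> S \<Longrightarrow> 0 < a i" "\<And>i. i \<notin> S \<Longrightarrow> a i = 0"
      "N (\<lambda>i. complex_of_real (a i)) \<le> 1"
    and max: "\<And>g :: omega. (\<And>i. i \<notin> S \<Longrightarrow> g i = 0) \<Longrightarrow> N g \<le> 1 \<Longrightarrow>
      (\<Prod>i\<in>S. cmod (g i) powr (cmod (x i))\<^sup>2) \<le> (\<Prod>i\<in>S. a i powr (cmod (x i))\<^sup>2)"
    using maximiser_exists[OF S, of "\<lambda>i. (cmod (x i))\<^sup>2"] xS by blast
  have ac: "(\<lambda>i. complex_of_real (a i)) \<in> c00"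
    using S a(2) unfolding c00_def supp_def by (auto intro: finite_subset[of _ S])
  show ?thesis
  proof (rule that[of "\<lambda>i. s * a i"])
    show "\<And>i. x i \<noteq> 0 \<Longrightarrow> 0 < s * a i" using s a(1) by (simp add: S_def supp_def)
    show "\<And>i. x i = 0 \<Longrightarrow> s * a i = 0" using a(2) by (simp add: S_def supp_def)
    have "(\<lambda>i. complex_of_real (s * a i)) = scale (of_real s) (\<lambda>i. complex_of_real (a i))"
      by (simp add: scale_def)
    then have "N (\<lambda>i. complex_of_real (s * a i)) = s * N (\<lambda>i. complex_of_real (a i))"
      using homog[OF ac, of "of_real s"] s by simp
    also have "\<dots> \<le> s * 1" using a(3) s by (intro mult_left_mono) auto
    finally show "N (\<lambda>i. complex_of_real (s * a i)) \<le> ell2_norm x" by (simp add: s_def)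
    fix v assume v: "v \<in> c00"
    show "(\<Sum>i\<in>supp x. cmod (v i) * (cmod (x i))\<^sup>2 / (s * a i)) \<le> ell2_norm x * N v"
    proof (cases "N v = 0")
      case True
      then have "v i = 0" for i using coord_le[OF v, of i] by simp
      then show ?thesis using True by simp
    next
      case False
      then have Nv: "0 < N v" using nonneg[OF v] by simp
      define w where "w = scale (of_real (1 / N v)) v"
      have "N w = 1" using Nv v by (simp add: w_def homog norm_divide)
      then have "(\<Sum>i\<in>S. cmod (w i) * (cmod (x i))\<^sup>2 / a i) \<le> s\<^sup>2"
        unfolding s2 using v by (intro maximiser_dual_bound[OF S(1) xS a max]) (auto simp: w_def)
      moreover have "(\<Sum>i\<in>S. cmod (v i) * (cmod (x i))\<^sup>2 / (s * a i))
          = N v / s * (\<Sum>i\<in>S. cmod (w i) * (cmod (x i))\<^sup>2 / a i)"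
        unfolding sum_distrib_left w_def scale_def using Nv s
        by (intro sum.cong) (auto simp: norm_mult norm_divide)
      ultimately have "(\<Sum>i\<in>S. cmod (v i) * (cmod (x i))\<^sup>2 / (s * a i)) \<le> N v / s * s\<^sup>2"
        using Nv s mult_left_mono[of _ "s\<^sup>2" "N v / s"] by simp
      then show ?thesis using s by (simp add: S_def s_def power2_eq_square mult.commute)
    qed
  qed
qed

text \<open>The modulus of the function is \<open>\<phi>\<close> on the left line and
  \<open>\<bar>x\<bar>^2 / \<phi>\<close> on the right one, and its value at 1/2 is x. Where x
  vanishes the meaningless logarithm is multiplied by 0.\<close>

lemma strip_adm_factor:
  fixes \<phi> :: "nat \<Rightarrow> real"
  assumes x: "x \<in> c00" and pos: "\<And>i. x i \<noteq> 0 \<Longrightarrow> 0 < \<phi> i" and zero\<phi>: "\<And>i. x i = 0 \<Longrightarrow> \<phi> i = 0"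
    and N\<phi>: "N (\<lambda>i. complex_of_real (\<phi> i)) \<le> M"
    and dual: "\<And>v. v \<in> c00 \<Longrightarrow> (\<Sum>i\<in>supp x. cmod (v i) * (cmod (x i))\<^sup>2 / \<phi> i) \<le> M * N v"
  shows "strip_adm (\<lambda>z i. x i * exp ((1 - 2 * z) * of_real (ln (\<phi> i / cmod (x i))))) M"
    (is "strip_adm ?F M")
  unfolding strip_adm_def
proof (intro conjI allI)
  let ?l = "\<lambda>i. ln (\<phi> i / cmod (x i))"
  have normF: "cmod (?F z i) = cmod (x i) * exp ((1 - 2 * Re z) * ?l i)" for z i
    by (simp add: norm_mult)
  fix i
  have "cmod (?F z i) \<le> cmod (x i) * exp \<bar>?l i\<bar>" if "z \<in> strip" for z
  proof -
    have "\<bar>1 - 2 * Re z\<bar> \<le> 1" using that by (auto simp: strip_def abs_le_iff)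
    then have "\<bar>(1 - 2 * Re z) * ?l i\<bar> \<le> 1 * \<bar>?l i\<bar>" unfolding abs_mult by (rule mult_right_mono) simp
    then show ?thesis unfolding normF by (intro mult_left_mono) auto
  qed
  then show "bounded ((\<lambda>z. ?F z i) ` strip)" by (auto simp: bounded_iff)
  show "continuous_on strip (\<lambda>z. ?F z i)" by (intro continuous_intros)
  show "(\<lambda>z. ?F z i) holomorphic_on interior strip" by (intro holomorphic_intros)
next
  fix t n
  let ?z = "\<i> * complex_of_real t"
  have c: "(\<lambda>i. complex_of_real (\<phi> i)) \<in> c00"
    using x zero\<phi> unfolding c00_def supp_def by (auto intro: finite_subset[of _ "{i. x i \<noteq> 0}"])
  have "cmod (?F ?z i) = \<phi> i" for i
    using pos[of i] zero\<phi>[of i] by (cases "x i = 0") (auto simp: norm_mult)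
  then have "N (restrict_to {..<n} (?F ?z)) \<le> N (\<lambda>i. complex_of_real (\<phi> i))"
    using pos zero\<phi> by (intro mono c c00_restrict_lessThan) (auto simp: restrict_to_def abs_if)
  then show "N (restrict_to {..<n} (?F ?z)) \<le> M" using N\<phi> by simp
next
  fix t n v
  let ?z = "1 + \<i> * complex_of_real t"
  let ?v = "restrict_to {..<n} v"
  have fin: "finite (supp x)" using x by (simp add: c00_def)
  have F: "cmod (?F ?z i) = (cmod (x i))\<^sup>2 / \<phi> i" for i
  proof (cases "x i = 0")
    case False
    then have "exp (- ln (\<phi> i / cmod (x i))) = cmod (x i) / \<phi> i"
      using pos[of i] by (simp add: exp_minus)
    then show ?thesis by (simp add: norm_mult power2_eq_square)
  qed simp
  have "cmod (\<Sum>i<n. v i * ?F ?z i) \<le> (\<Sum>i<n. cmod (v i * ?F ?z i))" by (rule norm_sum)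
  also have "\<dots> = (\<Sum>i<n. cmod (v i) * (cmod (x i))\<^sup>2 / \<phi> i)" unfolding norm_mult[of "v _"] F by simp
  also have "\<dots> = (\<Sum>i\<in>supp x. cmod (?v i) * (cmod (x i))\<^sup>2 / \<phi> i)"
    using fin by (intro sum.mono_neutral_cong) (auto simp: supp_def restrict_to_def)
  also have "\<dots> \<le> M * N ?v" by (rule dual) simp
  finally show "cmod (\<Sum>i<n. v i * ?F ?z i) \<le> M * N ?v" .
qed

end

section \<open>Orthogonality of disjointly supported vectors\<close>

lemma ell2_le_restrict: "ell2_le x M \<Longrightarrow> ell2_le (restrict_to A x) M"
  by (erule ell2_le_cmod_mono) (rule cmod_restrict_le)

lemma sum_disjoint_square:
  fixes W :: "nat \<Rightarrow> omega"
  assumes disj: "\<And>k k'. k < n \<Longrightarrow> k' < n \<Longrightarrow> W k i \<noteq> 0 \<Longrightarrow> W k' i \<noteq> 0 \<Longrightarrow> k = k'"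
  shows "(cmod ((\<Sum>k<n. scale (a k) (W k)) i))\<^sup>2 = (\<Sum>k<n. (cmod (a k))\<^sup>2 * (cmod (W k i))\<^sup>2)"
proof (cases "\<exists>k<n. W k i \<noteq> 0")
  case True
  then obtain k where k: "k < n" "W k i \<noteq> 0" by blast
  then have other: "W k' i = 0" if "k' < n" "k' \<noteq> k" for k' using disj that by blast
  have "(\<Sum>k<n. scale (a k) (W k)) i = (\<Sum>k'\<in>{k}. a k' * W k' i)"
    unfolding sum_omega_apply scale_def using k other by (intro sum.mono_neutral_right) auto
  moreover have "(\<Sum>k<n. (cmod (a k))\<^sup>2 * (cmod (W k i))\<^sup>2) = (\<Sum>k'\<in>{k}. (cmod (a k'))\<^sup>2 * (cmod (W k' i))\<^sup>2)"
    using k other by (intro sum.mono_neutral_right) auto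
  ultimately show ?thesis by (simp add: norm_mult power_mult_distrib)
next
  case False
  then show ?thesis by (simp add: sum_omega_apply scale_def)
qed

lemma ell2_le_disjoint_sum:
  fixes W :: "nat \<Rightarrow> omega"
  assumes disj: "\<And>k k' i. k < n \<Longrightarrow> k' < n \<Longrightarrow> W k i \<noteq> 0 \<Longrightarrow> W k' i \<noteq> 0 \<Longrightarrow> k = k'"
    and W: "\<And>k. k < n \<Longrightarrow> ell2_le (W k) K" and K: "0 \<le> K"
  shows "ell2_le (\<Sum>k<n. scale (a k) (W k)) (K * sqrt (\<Sum>k<n. (cmod (a k))\<^sup>2))"
  unfolding ell2_le_def
proof
  fix m
  have WK: "(\<Sum>i<m. (cmod (W k i))\<^sup>2) \<le> K\<^sup>2" if "k < n" for k
    using W[OF that] K unfolding ell2_le_def L2_set_def by (metis real_sqrt_le_iff real_sqrt_abs abs_of_nonneg)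
  have "(\<Sum>i<m. (cmod ((\<Sum>k<n. scale (a k) (W k)) i))\<^sup>2)
      = (\<Sum>i<m. \<Sum>k<n. (cmod (a k))\<^sup>2 * (cmod (W k i))\<^sup>2)"
    by (intro sum.cong sum_disjoint_square disj) auto
  also have "\<dots> = (\<Sum>k<n. (cmod (a k))\<^sup>2 * (\<Sum>i<m. (cmod (W k i))\<^sup>2))"
    unfolding sum_distrib_left by (rule sum.swap)
  also have "\<dots> \<le> (\<Sum>k<n. (cmod (a k))\<^sup>2 * K\<^sup>2)" using WK by (intro sum_mono mult_left_mono) auto
  also have "\<dots> = (K * sqrt (\<Sum>k<n. (cmod (a k))\<^sup>2))\<^sup>2"
    by (simp add: power_mult_distrib sum_nonneg sum_distrib_right[symmetric])
  finally show "L2_set (\<lambda>i. cmod ((\<Sum>k<n. scale (a k) (W k)) i)) {..<m} \<le> K * sqrt (\<Sum>k<n. (cmod (a k))\<^sup>2)"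
    unfolding L2_set_def using K by (intro real_le_lsqrt) (auto simp: sum_nonneg)
qed

lemma ell2_norm_lessThan:
  "(\<And>i. M \<le> i \<Longrightarrow> x i = 0) \<Longrightarrow> (ell2_norm x)\<^sup>2 = (\<Sum>i<M. (cmod (x i))\<^sup>2)"
  by (subst ell2_norm_eq_finite[of "{..<M}"]) (auto simp: sum_nonneg not_less)

lemma ell2_norm_disjoint_sum:
  fixes u :: "nat \<Rightarrow> omega"
  assumes disj: "\<And>k k' i. k < n \<Longrightarrow> k' < n \<Longrightarrow> u k i \<noteq> 0 \<Longrightarrow> u k' i \<noteq> 0 \<Longrightarrow> k = k'"
    and u: "\<And>k. u k \<in> c00"
  shows "(ell2_norm (\<Sum>k<n. scale (a k) (u k)))\<^sup>2 = (\<Sum>k<n. (cmod (a k))\<^sup>2 * (ell2_norm (u k))\<^sup>2)"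
proof -
  have "\<exists>M. \<forall>i\<ge>M. u k i = 0" for k using u c00_iff_bound by blast
  then obtain M where M: "\<And>k i. M k \<le> i \<Longrightarrow> u k i = 0" by metis
  define L where "L = Max (M ` {..<n})"
  have L: "u k i = 0" if "L \<le> i" "k < n" for k i
  proof -
    have "M k \<le> L" using that by (simp add: L_def)
    then show ?thesis using M that by simp
  qed
  have "(ell2_norm (\<Sum>k<n. scale (a k) (u k)))\<^sup>2 = (\<Sum>i<L. (cmod ((\<Sum>k<n. scale (a k) (u k)) i))\<^sup>2)"
    using L by (intro ell2_norm_lessThan) (simp add: sum_omega_apply scale_def)
  also have "\<dots> = (\<Sum>i<L. \<Sum>k<n. (cmod (a k))\<^sup>2 * (cmod (u k i))\<^sup>2)"
    by (intro sum.cong sum_disjoint_square disj) auto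
  also have "\<dots> = (\<Sum>k<n. (cmod (a k))\<^sup>2 * (\<Sum>i<L. (cmod (u k i))\<^sup>2))"
    unfolding sum_distrib_left by (rule sum.swap)
  also have "\<dots> = (\<Sum>k<n. (cmod (a k))\<^sup>2 * (ell2_norm (u k))\<^sup>2)"
    using L by (intro sum.cong) (auto simp: ell2_norm_lessThan[of L])
  finally show ?thesis .
qed

subsection \<open>The derivation \<open>\<Omega>\<close>\<close>

text \<open>What the proof retains of a homogeneous selection: finite tests with respect to
  \<open>N\<close>, the value at 1/2 and homogeneity. Nothing here is special to Tsirelson's
  norm.\<close>

locale twisted_selection = lattice_norm N for N +
  fixes B :: "omega \<Rightarrow> complex \<Rightarrow> omega" and C :: real
  assumes C_nonneg: "0 \<le> C"
    and B_adm: "x \<in> ell2 \<Longrightarrow> strip_adm (B x) (C * ell2_norm x)"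
    and B_half: "x \<in> ell2 \<Longrightarrow> B x (1/2) = x"
    and B_scale: "x \<in> ell2 \<Longrightarrow> z \<in> strip \<Longrightarrow> B (scale c x) z = scale c (B x z)"
begin

abbreviation "\<Omega> \<equiv> Omega B"

lemma strip_adm_has_deriv:
  assumes "strip_adm F M"
  shows "((\<lambda>z. F z i) has_field_derivative deriv (\<lambda>z. F z i) (1/2)) (at (1/2))"
  by (rule holomorphic_derivI[OF strip_admD(3)[OF assms] open_interior half_in_strip(1)])

lemma Omega_deriv:
  "x \<in> ell2 \<Longrightarrow> ((\<lambda>z. B x z i) has_field_derivative \<Omega> x i) (at (1/2))"
  unfolding Omega_def using strip_adm_has_deriv[OF B_adm] .

lemma Omega_coord: "x \<in> ell2 \<Longrightarrow> cmod (\<Omega> x i) \<le> 4 * C * ell2_norm x"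
  unfolding Omega_def using strip_adm_deriv_coord[OF B_adm, of x i] by (simp add: mult.assoc)

lemma Omega_scale: assumes "x \<in> ell2" shows "\<Omega> (scale c x) = scale c (\<Omega> x)"
proof
  fix i
  have "((\<lambda>z. c * B x z i) has_field_derivative c * \<Omega> x i) (at (1/2))"
    by (rule DERIV_cmult[OF Omega_deriv[OF assms]])
  then have "((\<lambda>z. B (scale c x) z i) has_field_derivative c * \<Omega> x i) (at (1/2))"
  \<comment> \<open>Homogeneity of \<open>B\<close> is given on the strip only, so the two functions
    are compared on its interior, which contains 1/2.\<close>
  proof (rule has_field_derivative_transform_within_open[OF _ open_interior half_in_strip(1)])
    fix z assume "z \<in> interior strip"
    then have "z \<in> strip" using interior_subset by blast
    then show "c * B x z i = B (scale c x) z i" using B_scale[OF assms] by (simp add: scale_def)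
  qed
  then have "\<Omega> (scale c x) i = c * \<Omega> x i"
    unfolding Omega_def[of B "scale c x"] by (rule DERIV_imp_deriv)
  then show "\<Omega> (scale c x) i = scale c (\<Omega> x) i" by (simp add: scale_def)
qed

lemma Omega_zero: "\<Omega> 0 = 0"
proof -
  have "scale 0 x = 0" for x by (auto simp: scale_def)
  then show ?thesis using Omega_scale[of 0 0] by simp
qed

text \<open>The difference of two extensions of x vanishes at 1/2, so \<open>strip_adm_deriv\<close>
  applies to it. All quasi-linearity of \<open>\<Omega>\<close> and its explicit formula come from
  choices of F.\<close>

lemma Omega_compare:
  assumes x: "x \<in> ell2" and F: "strip_adm F M" and half: "F (1/2) = x"
    and deriv: "\<And>i. ((\<lambda>z. F z i) has_field_derivative d i) (at (1/2))"
  shows "ell2_le (\<Omega> x - d) (4 * (C * ell2_norm x + M))"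
proof -
  have "deriv (\<lambda>z. (B x z - F z) i) (1/2) = (\<Omega> x - d) i" for i
    using DERIV_imp_deriv[OF DERIV_diff[OF Omega_deriv[OF x, of i] deriv[of i]]] by simp
  then show ?thesis
    using strip_adm_deriv[OF strip_adm_diff[OF B_adm[OF x] F]] B_half[OF x] half
    unfolding ell2_le_def by simp
qed

text \<open>F is the same combination of selected extensions. The error is of l_1 type in the
  \<open>x j\<close>, hence useful when these are summably small; the large part of y goes into
  \<open>x0\<close>.\<close>

lemma Omega_combination:
  assumes A: "finite A" and y: "y \<in> ell2" and x0: "x0 \<in> ell2" and x: "\<And>j. j \<in> A \<Longrightarrow> x j \<in> ell2"
    and eq: "y = x0 + (\<Sum>j\<in>A. scale (c j) (x j))"
  shows "ell2_le (\<Omega> y - (\<Omega> x0 + (\<Sum>j\<in>A. scale (c j) (\<Omega> (x j)))))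
    (4 * C * (ell2_norm y + ell2_norm x0 + (\<Sum>j\<in>A. cmod (c j) * ell2_norm (x j))))"
proof -
  let ?F = "\<lambda>z. B x0 z + (\<Sum>j\<in>A. scale (c j) (B (x j) z))"
  let ?M = "C * ell2_norm x0 + (\<Sum>j\<in>A. cmod (c j) * (C * ell2_norm (x j)))"
  have "ell2_le (\<Omega> y - (\<Omega> x0 + (\<Sum>j\<in>A. scale (c j) (\<Omega> (x j))))) (4 * (C * ell2_norm y + ?M))"
  proof (rule Omega_compare[OF y])
    show "strip_adm ?F ?M" using x0 x by (intro strip_adm_add strip_adm_sum strip_adm_scale B_adm)
    have "(\<Sum>j\<in>A. scale (c j) (B (x j) (1/2))) = (\<Sum>j\<in>A. scale (c j) (x j))"
      using x by (intro sum.cong) (auto simp: B_half)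
    then show "?F (1/2) = y" using eq B_half[OF x0] by (simp only:)
    fix i
    have "((\<lambda>z. B x0 z i + (\<Sum>j\<in>A. c j * B (x j) z i)) has_field_derivative
        \<Omega> x0 i + (\<Sum>j\<in>A. c j * \<Omega> (x j) i)) (at (1/2))"
      using x0 x by (intro DERIV_add DERIV_sum DERIV_cmult Omega_deriv)
    then show "((\<lambda>z. ?F z i) has_field_derivative (\<Omega> x0 + (\<Sum>j\<in>A. scale (c j) (\<Omega> (x j)))) i) (at (1/2))"
      by (simp add: sum_omega_apply scale_def)
  qed
  also have "4 * (C * ell2_norm y + ?M)
      = 4 * C * (ell2_norm y + ell2_norm x0 + (\<Sum>j\<in>A. cmod (c j) * ell2_norm (x j)))"
    by (simp add: algebra_simps sum_distrib_left)
  finally show ?thesis .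
qed

lemma Omega_sum:
  assumes "finite A" and "\<And>j. j \<in> A \<Longrightarrow> x j \<in> ell2"
  shows "\<Omega> (\<Sum>j\<in>A. scale (c j) (x j)) - (\<Sum>j\<in>A. scale (c j) (\<Omega> (x j))) \<in> ell2"
proof -
  have "ell2_le (\<Omega> (\<Sum>j\<in>A. scale (c j) (x j)) - (\<Omega> 0 + (\<Sum>j\<in>A. scale (c j) (\<Omega> (x j)))))
    (4 * C * (ell2_norm (\<Sum>j\<in>A. scale (c j) (x j)) + ell2_norm 0 + (\<Sum>j\<in>A. cmod (c j) * ell2_norm (x j))))"
    using assms by (intro Omega_combination ell2_sum) auto
  then show ?thesis using ell2_leD(1) unfolding Omega_zero add_0 by blast
qed

text \<open>Minus the derivative at 1/2 of the extension in \<open>strip_adm_factor\<close>.\<close>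

definition log_weight :: "(nat \<Rightarrow> real) \<Rightarrow> omega \<Rightarrow> omega" where
  "log_weight \<phi> x = (\<lambda>i. 2 * x i * complex_of_real (ln (\<phi> i / cmod (x i))))"

definition factor :: "omega \<Rightarrow> (nat \<Rightarrow> real) \<Rightarrow> bool" where
  "factor x \<phi> \<longleftrightarrow> (\<forall>i. x i \<noteq> 0 \<longrightarrow> 0 < \<phi> i) \<and> (\<forall>i. x i = 0 \<longrightarrow> \<phi> i = 0) \<and>
    N (\<lambda>i. complex_of_real (\<phi> i)) \<le> ell2_norm x \<and>
    (\<forall>v\<in>c00. (\<Sum>i\<in>supp x. cmod (v i) * (cmod (x i))\<^sup>2 / \<phi> i) \<le> ell2_norm x * N v)"

lemma factor_dual:
  "factor x \<phi> \<Longrightarrow> v \<in> c00 \<Longrightarrow> (\<Sum>i\<in>supp x. cmod (v i) * (cmod (x i))\<^sup>2 / \<phi> i) \<le> ell2_norm x * N v"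
  by (simp add: factor_def)

lemma factor_c00: "x \<in> c00 \<Longrightarrow> factor x \<phi> \<Longrightarrow> (\<lambda>i. complex_of_real (\<phi> i)) \<in> c00"
  unfolding c00_def supp_def factor_def by (auto intro: finite_subset[of _ "{i. x i \<noteq> 0}"])

lemma factor_exists: "x \<in> c00 \<Longrightarrow> x \<noteq> 0 \<Longrightarrow> \<exists>\<phi>. factor x \<phi>"
  unfolding factor_def by (rule factorisation) blast+

lemma Omega_factor:
  assumes x: "x \<in> c00" and \<phi>: "factor x \<phi>"
  shows "ell2_le (\<Omega> x + log_weight \<phi> x) (4 * (C + 1) * ell2_norm x)"
proof -
  let ?l = "\<lambda>i. complex_of_real (ln (\<phi> i / cmod (x i)))"
  have "ell2_le (\<Omega> x - (\<lambda>i. x i * (exp ((1 - 2 * (1/2)) * ?l i) * (- 2 * ?l i))))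
      (4 * (C * ell2_norm x + ell2_norm x))"
  proof (rule Omega_compare)
    show "strip_adm (\<lambda>z i. x i * exp ((1 - 2 * z) * ?l i)) (ell2_norm x)"
      using \<phi> unfolding factor_def by (intro strip_adm_factor x) auto
    show "((\<lambda>z. x i * exp ((1 - 2 * z) * ?l i)) has_field_derivative
        x i * (exp ((1 - 2 * (1/2)) * ?l i) * (- 2 * ?l i))) (at (1/2))" for i
      by (auto intro!: derivative_eq_intros)
  qed (use x in auto)
  moreover have "\<Omega> x - (\<lambda>i. x i * (exp ((1 - 2 * (1/2)) * ?l i) * (- 2 * ?l i))) = \<Omega> x + log_weight \<phi> x"
    by (auto simp: log_weight_def fun_eq_iff)
  moreover have "4 * (C * ell2_norm x + ell2_norm x) = 4 * (C + 1) * ell2_norm x"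
    by (simp add: algebra_simps)
  ultimately show ?thesis by (simp only:)
qed

text \<open>By \<open>Omega_factor\<close> the image differs by a square-summable vector from minus
  \<open>log_weight\<close>, which is finitely supported. This is membership only, without a bound
  in terms of the norm of x.\<close>

lemma Omega_c00: assumes "x \<in> c00" shows "\<Omega> x \<in> ell2"
proof (cases "x = 0")
  case True
  then show ?thesis using Omega_zero ell2_leD(1)[OF ell2_le_zero] by simp
next
  case False
  then obtain \<phi> where \<phi>: "factor x \<phi>" using factor_exists[OF assms] by blast
  have "log_weight \<phi> x \<in> c00"
    using assms unfolding c00_def supp_def log_weight_def by (auto intro: finite_subset[of _ "{i. x i \<noteq> 0}"])
  then have "\<Omega> x + log_weight \<phi> x - log_weight \<phi> x \<in> ell2"
    using ell2_leD(1)[OF Omega_factor[OF assms \<phi>]] by (intro ell2_diff) auto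
  moreover have "\<Omega> x + log_weight \<phi> x - log_weight \<phi> x = \<Omega> x" by auto
  ultimately show ?thesis by simp
qed

text \<open>
  If \<open>\<Omega>\<close> is almost linear on the span of the blocks \<open>u j\<close>, then the factors of \<open>\<Sum>j. a j u j\<close> and
  those of the \<open>u j\<close> are comparable in logarithmic mean. Testing the dual factor of the sum against
  \<open>\<psi> = \<Sum>j. a j \<phi> j\<close> with the tangent inequality \<open>exp t \<ge> exp (- L) * (1 + L + t)\<close> bounds
  the norm of \<open>\<psi>\<close> from below.
\<close>

lemma block_factors_lower:
  fixes u l :: "nat \<Rightarrow> omega" and \<phi> :: "nat \<Rightarrow> nat \<Rightarrow> real" and m n :: "nat \<Rightarrow> nat"
  assumes u: "\<And>j i. i < m j \<or> n j \<le> i \<Longrightarrow> u j i = 0" and mn: "\<And>j. m j \<le> n j" "\<And>j. n j \<le> m (Suc j)"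
    and u_norm: "\<And>j. \<delta> \<le> ell2_norm (u j)" "\<And>j. ell2_norm (u j) \<le> U" and \<delta>: "0 < \<delta>"
    and l: "\<And>j. ell2_le (restrict_to (- {m j..<m (Suc j)}) (l j)) (\<eta> j)"
    and \<eta>: "\<And>k. (\<Sum>j<k. \<eta> j) \<le> E"
    and lin: "\<And>k a. (\<And>j. 0 \<le> a j) \<Longrightarrow>
      ell2_le (\<Omega> (\<Sum>j<k. scale (complex_of_real (a j)) (u j)) - (\<Sum>j<k. scale (complex_of_real (a j)) (l j)))
        (K * sqrt (\<Sum>j<k. (a j)\<^sup>2))"
    and \<phi>: "\<And>j. factor (u j) (\<phi> j)"
  shows "\<exists>c>0. \<forall>k a. (\<forall>j. 0 \<le> a j) \<longrightarrow>
    c * sqrt (\<Sum>j<k. (a j)\<^sup>2) \<le> N (\<Sum>j<k. scale (complex_of_real (a j)) (\<lambda>i. complex_of_real (\<phi> j i)))"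
proof -
  \<comment> \<open>\<open>K3\<close> adds the error of almost linearity to that of the explicit
    formula. \<open>L\<close> bounds the root mean square of \<open>\<tau>\<close>: half of the
    total error 2 * K3 + E, relative to the lower bound \<open>\<delta>\<close>; the added 1 keeps
    it positive.\<close>
  define K3 where "K3 = K + 4 * (C + 1) * U"
  define L where "L = (2 * K3 + E + 1) / (2 * \<delta>)"
  have uc: "u j \<in> c00" for j using u unfolding c00_iff_bound by blast
  have mmono: "m j \<le> m j'" if "j \<le> j'" for j j'
    using that by (rule lift_Suc_mono_le[rotated]) (use mn order_trans in blast)
  have order: "n j \<le> m j'" if "j < j'" for j j'
    using mn(2)[of j] mmono[of "Suc j" j'] that by (meson Suc_leI order_trans)
  have disjI: "j = j'" if "i \<in> {m j..<n j}" "i \<in> {m j'..<n j'}" for i j j'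
    using that order[of j j'] order[of j' j] by (cases j j' rule: linorder_cases) auto
  have uI: "i \<in> {m j..<n j}" if "u j i \<noteq> 0" for i j using u[of i j] that by (auto simp: not_le[symmetric])
  have udisj: "j = j'" if "u j i \<noteq> 0" "u j' i \<noteq> 0" for i j j' using disjI uI that by blast
  have U: "0 \<le> U" using \<delta> u_norm[of 0] by linarith
  \<comment> \<open>Almost linearity at the j-th unit coefficient vector compares \<open>l j\<close>
    with \<open>\<Omega> (u j)\<close>.\<close>
  have V: "ell2_le (log_weight (\<phi> j) (u j) + l j) K3" for j
  proof -
    let ?a = "\<lambda>k. if k = j then 1 else (0::real)"
    have sum: "(\<Sum>k<Suc j. scale (complex_of_real (?a k)) (w k)) = w j" for w :: "nat \<Rightarrow> omega"
      by (auto simp: sum_omega_apply scale_def fun_eq_iff)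
    have "ell2_le (\<Omega> (u j) - l j) (K * sqrt (\<Sum>k<Suc j. (?a k)\<^sup>2))"
      using lin[of ?a "Suc j"] unfolding sum by auto
    then have "ell2_le (\<Omega> (u j) - l j) K" by (simp add: if_distrib cong: if_cong)
    then have "ell2_le (\<Omega> (u j) + log_weight (\<phi> j) (u j) - (\<Omega> (u j) - l j)) (4 * (C + 1) * ell2_norm (u j) + K)"
      by (intro ell2_le_diff Omega_factor uc \<phi>)
    moreover have "\<Omega> (u j) + log_weight (\<phi> j) (u j) - (\<Omega> (u j) - l j) = log_weight (\<phi> j) (u j) + l j" by auto
    moreover have "4 * (C + 1) * ell2_norm (u j) + K \<le> K3"
      using u_norm(2)[of j] C_nonneg by (simp add: K3_def mult_left_mono)
    ultimately show ?thesis by (metis ell2_le_weaken)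
  qed
  have K3: "0 \<le> K3" using V[of 0] L2_set_nonneg order_trans unfolding ell2_le_def by blast
  have E: "0 \<le> E" using \<eta>[of 0] by simp
  have \<eta>0: "0 \<le> \<eta> j" for j using l[of j] L2_set_nonneg order_trans unfolding ell2_le_def by blast
  have L: "0 < L" using K3 E \<delta> by (simp add: L_def)
  have main: "exp (- L) * \<delta> * sqrt (\<Sum>j<k. (a j)\<^sup>2)
      \<le> N (\<Sum>j<k. scale (complex_of_real (a j)) (\<lambda>i. complex_of_real (\<phi> j i)))"
    if a: "\<And>j. 0 \<le> a j" for k a
  proof (cases "\<exists>j<k. a j \<noteq> 0")
    case False
    then have "sqrt (\<Sum>j<k. (a j)\<^sup>2) = 0" by simp
    then show ?thesis
      by (simp only: mult_zero_right) (intro nonneg c00_sum c00_scale factor_c00[OF uc \<phi>])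
  next
    case True
    define na where "na = sqrt (\<Sum>j<k. (a j)\<^sup>2)"
    define x where "x = (\<Sum>j<k. scale (complex_of_real (a j)) (u j))"
    define s where "s = ell2_norm x"
    define \<psi> where "\<psi> = (\<lambda>i. \<Sum>j<k. a j * \<phi> j i)"
    have \<psi>eq: "(\<Sum>j<k. scale (complex_of_real (a j)) (\<lambda>i. complex_of_real (\<phi> j i))) = (\<lambda>i. complex_of_real (\<psi> i))"
      by (auto simp: sum_omega_apply scale_def \<psi>_def fun_eq_iff)
    have na: "0 \<le> na" by (simp add: na_def sum_nonneg)
    have na2: "na\<^sup>2 = (\<Sum>j<k. (a j)\<^sup>2)" by (simp add: na_def sum_nonneg)
    have xc: "x \<in> c00" unfolding x_def using uc by (intro c00_sum c00_scale)
    have s0: "0 \<le> s" using xc by (simp add: s_def)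
    have s2: "s\<^sup>2 = (\<Sum>j<k. (a j)\<^sup>2 * (ell2_norm (u j))\<^sup>2)"
      unfolding s_def x_def using ell2_norm_disjoint_sum[of k u] udisj uc by simp
    have "s\<^sup>2 \<le> (\<Sum>j<k. (a j)\<^sup>2 * U\<^sup>2)"
      unfolding s2 using u_norm uc by (intro sum_mono mult_left_mono power_mono) auto
    then have "s\<^sup>2 \<le> (U * na)\<^sup>2" by (simp add: na2 power_mult_distrib sum_distrib_left mult.commute)
    then have sU: "s \<le> U * na" using U na by (meson mult_nonneg_nonneg power2_le_imp_le)
    have "(\<Sum>j<k. (a j)\<^sup>2 * \<delta>\<^sup>2) \<le> s\<^sup>2"
      unfolding s2 using u_norm uc \<delta> by (intro sum_mono mult_left_mono power_mono) auto
    then have "(\<delta> * na)\<^sup>2 \<le> s\<^sup>2" by (simp add: na2 power_mult_distrib sum_distrib_left mult.commute)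
    then have s\<delta>: "\<delta> * na \<le> s" using s0 by (rule power2_le_imp_le)
    have "0 < na"
    proof -
      obtain j where "j < k" "a j \<noteq> 0" using True by blast
      then have "0 < (\<Sum>j<k. (a j)\<^sup>2)" by (intro sum_pos2[of _ j]) auto
      then show ?thesis by (simp add: na_def)
    qed
    then have s: "0 < s" using s\<delta> \<delta> by (meson mult_pos_pos less_le_trans)
    have "x \<noteq> 0"
    proof
      assume "x = 0"
      then have "s \<le> 0" using ell2_leD(2)[OF ell2_le_zero] by (simp add: s_def)
      then show False using s by simp
    qed
    then obtain f where f: "factor x f" using factor_exists[OF xc] by blast
    let ?V = "log_weight f x"
    let ?Vu = "\<lambda>j. log_weight (\<phi> j) (u j)"
    \<comment> \<open>The combination lives on these intervals, so the parts of the
      \<open>l j\<close> in the gaps can be discarded.\<close>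
    define I where "I = (\<Union>j<k. {m j..<n j})"
    have xj: "x i = complex_of_real (a j) * u j i" if "j < k" "i \<in> {m j..<n j}" for i j
    proof -
      have "x i = (\<Sum>j'<k. complex_of_real (a j') * u j' i)" by (simp add: x_def sum_omega_apply scale_def)
      also have "\<dots> = (\<Sum>j'\<in>{j}. complex_of_real (a j') * u j' i)"
      proof (rule sum.mono_neutral_right)
        have "u j' i = 0" if "j' \<noteq> j" for j' using disjI uI that \<open>i \<in> {m j..<n j}\<close> by blast
        then show "\<forall>j'\<in>{..<k} - {j}. complex_of_real (a j') * u j' i = 0" by simp
      qed (use that in auto)
      finally show ?thesis by simp
    qed
    have \<phi>0: "\<phi> j i = 0" if "u j i = 0" for i j using \<phi>[of j] that by (simp add: factor_def)
    have \<psi>j: "\<psi> i = a j * \<phi> j i" if "j < k" "i \<in> {m j..<n j}" for i j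
    proof -
      have "u j' i = 0" if "j' \<noteq> j" for j' using disjI uI that \<open>i \<in> {m j..<n j}\<close> by blast
      then have "\<psi> i = (\<Sum>j'\<in>{j}. a j' * \<phi> j' i)"
        unfolding \<psi>_def using that \<phi>0 by (intro sum.mono_neutral_right) auto
      then show ?thesis by simp
    qed
    have xI: "\<exists>j<k. i \<in> {m j..<n j}" if "x i \<noteq> 0" for i
    proof (rule ccontr)
      assume "\<not> ?thesis"
      then have "\<forall>j<k. u j i = 0" using uI by blast
      then show False using that by (simp add: x_def sum_omega_apply scale_def)
    qed
    have 1: "ell2_le (restrict_to I (?V + (\<Sum>j<k. scale (complex_of_real (a j)) (l j)))) (K3 * na)"
    proof -
      have le: "ell2_le (\<Omega> x + ?V - (\<Omega> x - (\<Sum>j<k. scale (complex_of_real (a j)) (l j)))) (4 * (C + 1) * s + K * na)"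
        unfolding s_def x_def na_def
        by (intro ell2_le_diff Omega_factor lin a) (use xc f in \<open>simp_all add: x_def\<close>)
      have K3: "4 * (C + 1) * s + K * na \<le> K3 * na"
        using mult_left_mono[OF sU, of "4 * (C + 1)"] C_nonneg by (simp add: K3_def algebra_simps)
      have "\<Omega> x + ?V - (\<Omega> x - (\<Sum>j<k. scale (complex_of_real (a j)) (l j)))
          = ?V + (\<Sum>j<k. scale (complex_of_real (a j)) (l j))" by (rule ext) simp
      then have "ell2_le (?V + (\<Sum>j<k. scale (complex_of_real (a j)) (l j))) (K3 * na)"
        using ell2_le_weaken[OF le K3] by (simp only:)
      then show ?thesis by (rule ell2_le_restrict)
    qed
    \<comment> \<open>Each block is compared on its own interval, so the errors are orthogonal and
      add up in l_2.\<close>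
    have 2: "ell2_le (\<Sum>j<k. scale (complex_of_real (a j)) (restrict_to {m j..<n j} (?Vu j + l j))) (K3 * na)"
    proof -
      have "ell2_le (\<Sum>j<k. scale (complex_of_real (a j)) (restrict_to {m j..<n j} (?Vu j + l j)))
        (K3 * sqrt (\<Sum>j<k. (cmod (complex_of_real (a j)))\<^sup>2))"
      proof (rule ell2_le_disjoint_sum[OF _ _ K3])
        show "ell2_le (restrict_to {m j..<n j} (?Vu j + l j)) K3" for j
          by (rule ell2_le_restrict[OF V])
      qed (use disjI in \<open>auto simp: restrict_to_def split: if_splits\<close>)
      then show ?thesis by (simp add: na_def)
    qed
    \<comment> \<open>The parts of \<open>l j\<close> on the other blocks overlap, so they are
      summed by the triangle inequality; here the \<open>\<eta> j\<close> have to be summable. The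
      other intervals lie before \<open>m j\<close> or from \<open>m (Suc j)\<close> on.\<close>
    have 3: "ell2_le (\<Sum>j<k. scale (complex_of_real (a j)) (restrict_to (I - {m j..<n j}) (l j))) (E * na)"
    proof -
      have "ell2_le (restrict_to (I - {m j..<n j}) (l j)) (\<eta> j)" if "j < k" for j
      proof (rule ell2_le_cmod_mono[OF l[of j]])
        have "i \<notin> {m j..<m (Suc j)}" if iI: "i \<in> I - {m j..<n j}" for i
        proof
          assume i: "i \<in> {m j..<m (Suc j)}"
          obtain j' where j': "i \<in> {m j'..<n j'}" using iI by (auto simp: I_def)
          show False
          proof (cases j j' rule: linorder_cases)
            case less
            then show ?thesis using i j' mmono[of "Suc j" j'] by auto
          next
            case greater
            then show ?thesis using i j' order[of j' j] by auto
          qed (use iI j' in auto)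
        qed
        then show "cmod (restrict_to (I - {m j..<n j}) (l j) i) \<le> cmod (restrict_to (- {m j..<m (Suc j)}) (l j) i)" for i
          by (auto simp: restrict_to_def)
      qed
      then have "ell2_le (\<Sum>j<k. scale (complex_of_real (a j)) (restrict_to (I - {m j..<n j}) (l j)))
          (\<Sum>j<k. cmod (complex_of_real (a j)) * \<eta> j)"
        by (intro ell2_le_sum ell2_le_scale) auto
      moreover have "(\<Sum>j<k. cmod (complex_of_real (a j)) * \<eta> j) \<le> (\<Sum>j<k. na * \<eta> j)"
      proof (intro sum_mono mult_right_mono \<eta>0)
        fix j assume "j \<in> {..<k}"
        then have "(a j)\<^sup>2 \<le> na\<^sup>2" unfolding na2 by (intro member_le_sum) auto
        then have "a j \<le> na" using na by (rule power2_le_imp_le)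
        then show "cmod (complex_of_real (a j)) \<le> na" using a[of j] by (simp only: norm_of_real abs_of_nonneg)
      qed
      moreover have "(\<Sum>j<k. na * \<eta> j) \<le> E * na"
        using mult_left_mono[OF \<eta>[of k] na] by (simp only: sum_distrib_left[symmetric] mult.commute[of E])
      ultimately show ?thesis using ell2_le_weaken order_trans by blast
    qed
    \<comment> \<open>On \<open>I\<close> all \<open>l j\<close> cancel, leaving the difference of
      the logarithmic weights of the sum and of its blocks. On a block
      \<open>\<bar>x\<bar> = a j * \<bar>u j\<bar>\<close> and
      \<open>\<psi> = a j * \<phi> j\<close>, so this is a multiple of
      \<open>ln (\<psi> / f)\<close>.\<close>
    define D where "D = restrict_to I (?V + (\<Sum>j<k. scale (complex_of_real (a j)) (l j)))
      - (\<Sum>j<k. scale (complex_of_real (a j)) (restrict_to {m j..<n j} (?Vu j + l j)))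
      - (\<Sum>j<k. scale (complex_of_real (a j)) (restrict_to (I - {m j..<n j}) (l j)))"
    have D: "ell2_le D (K3 * na + K3 * na + E * na)" unfolding D_def by (intro ell2_le_diff 1 2 3)
    define \<tau> where "\<tau> i = ln (\<psi> i / f i)" for i
    have pos: "0 < \<psi> i \<and> 0 < f i \<and> D i = - 2 * x i * complex_of_real (\<tau> i)" if xi0: "x i \<noteq> 0" for i
    proof -
      obtain j where j: "j < k" "i \<in> {m j..<n j}" using xI xi0 by blast
      have xi: "x i = complex_of_real (a j) * u j i" using xj[OF j] .
      then have aj: "0 < a j" "u j i \<noteq> 0" using that a[of j] by (auto simp: less_le)
      have p: "0 < \<phi> j i" "0 < f i" using \<phi>[of j] f aj that by (auto simp: factor_def)
      have iI: "i \<in> I" using j by (auto simp: I_def)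
      have "D i = ?V i + (\<Sum>j'<k. complex_of_real (a j') * l j' i)
         - (\<Sum>j'<k. complex_of_real (a j') * restrict_to {m j'..<n j'} (?Vu j' + l j') i
             + complex_of_real (a j') * restrict_to (I - {m j'..<n j'}) (l j') i)"
        unfolding D_def using iI by (simp add: sum_omega_apply scale_def sum.distrib restrict_to_def[of I])
      also have "(\<Sum>j'<k. complex_of_real (a j') * restrict_to {m j'..<n j'} (?Vu j' + l j') i
             + complex_of_real (a j') * restrict_to (I - {m j'..<n j'}) (l j') i)
          = (\<Sum>j'<k. complex_of_real (a j') * l j' i + (if j' = j then complex_of_real (a j) * ?Vu j i else 0))"
      proof (rule sum.cong)
        fix j'
        have "i \<notin> {m j'..<n j'}" if "j' \<noteq> j" using disjI[OF j(2)] that by blast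
        then show "complex_of_real (a j') * restrict_to {m j'..<n j'} (?Vu j' + l j') i
             + complex_of_real (a j') * restrict_to (I - {m j'..<n j'}) (l j') i
            = complex_of_real (a j') * l j' i + (if j' = j then complex_of_real (a j) * ?Vu j i else 0)"
          using j(2) iI by (cases "j' = j") (auto simp: restrict_to_def distrib_left)
      qed simp
      also have "\<dots> = (\<Sum>j'<k. complex_of_real (a j') * l j' i) + complex_of_real (a j) * ?Vu j i"
        using j by (simp add: sum.distrib)
      finally have "D i = ?V i - complex_of_real (a j) * ?Vu j i" by simp
      also have "\<dots> = 2 * x i * complex_of_real (ln (f i / cmod (x i)) - ln (\<phi> j i / cmod (u j i)))"
        by (simp add: log_weight_def xi algebra_simps)
      also have "ln (f i / cmod (x i)) - ln (\<phi> j i / cmod (u j i)) = - \<tau> i"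
        using p aj by (simp add: xi \<tau>_def \<psi>j[OF j] norm_mult ln_div ln_mult)
      finally show ?thesis using p aj \<psi>j[OF j] by simp
    qed
    have fin: "finite (supp x)" using xc by (simp add: c00_def)
    define p where "p i = (cmod (x i))\<^sup>2" for i
    have psum: "(\<Sum>i\<in>supp x. p i) = s\<^sup>2"
      unfolding s_def p_def by (subst ell2_norm_eq_finite[OF fin]) (auto simp: supp_def sum_nonneg)
    have "(\<Sum>i\<in>supp x. p i * (\<tau> i)\<^sup>2) \<le> (L * s)\<^sup>2"
    proof -
      obtain M where M: "\<And>i. M \<le> i \<Longrightarrow> x i = 0" using c00_bound[OF xc] by blast
      have "4 * (\<Sum>i\<in>supp x. p i * (\<tau> i)\<^sup>2) = (\<Sum>i\<in>supp x. (cmod (D i))\<^sup>2)"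
        unfolding sum_distrib_left
      proof (rule sum.cong)
        fix i assume "i \<in> supp x"
        then have Di: "D i = - 2 * x i * complex_of_real (\<tau> i)" using pos by (simp add: supp_def)
        show "4 * (p i * (\<tau> i)\<^sup>2) = (cmod (D i))\<^sup>2"
          unfolding Di p_def by (simp add: norm_mult power_mult_distrib)
      qed simp
      also have "\<dots> \<le> (\<Sum>i<M. (cmod (D i))\<^sup>2)"
        using M by (intro sum_mono2) (auto simp: supp_def not_le[symmetric])
      also have "\<dots> = (L2_set (\<lambda>i. cmod (D i)) {..<M})\<^sup>2" by (simp add: L2_set_def sum_nonneg)
      also have "\<dots> \<le> (K3 * na + K3 * na + E * na)\<^sup>2"
        using D by (intro power_mono) (auto simp: ell2_le_def)
      also have "\<dots> \<le> (2 * (L * s))\<^sup>2"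
      proof (rule power_mono)
        have "K3 * na + K3 * na + E * na \<le> (2 * K3 + E + 1) * na" using na by (simp add: algebra_simps)
        also have "\<dots> = 2 * L * (\<delta> * na)" using \<delta> by (simp add: L_def)
        also have "\<dots> \<le> 2 * L * s" using L s\<delta> by (intro mult_left_mono) auto
        finally show "K3 * na + K3 * na + E * na \<le> 2 * (L * s)" by simp
        show "0 \<le> K3 * na + K3 * na + E * na" using K3 E na by simp
      qed
      finally show ?thesis by (simp add: power_mult_distrib)
    qed
    then have \<tau>2: "(\<Sum>i\<in>supp x. p i * (\<tau> i)\<^sup>2) \<le> L\<^sup>2 * s\<^sup>2" by (simp add: power_mult_distrib)
    \<comment> \<open>The mean of \<open>\<tau>\<close> is bounded below by its mean square:
      expanding the square of \<open>\<tau> i + L\<close> plays the role of the Cauchy-Schwarz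
      inequality.\<close>
    have "- (L * s\<^sup>2) \<le> (\<Sum>i\<in>supp x. p i * \<tau> i)"
    proof -
      have "(\<Sum>i\<in>supp x. - (1 / (2 * L)) * (p i * (\<tau> i)\<^sup>2) - L / 2 * p i) \<le> (\<Sum>i\<in>supp x. p i * \<tau> i)"
      proof (rule sum_mono)
        fix i
        have "0 \<le> p i / (2 * L) * (\<tau> i + L)\<^sup>2" using L by (simp add: p_def)
        also have "\<dots> = p i * \<tau> i + (1 / (2 * L)) * (p i * (\<tau> i)\<^sup>2) + L / 2 * p i"
          using L by (simp add: power2_eq_square field_simps)
        finally show "- (1 / (2 * L)) * (p i * (\<tau> i)\<^sup>2) - L / 2 * p i \<le> p i * \<tau> i" by linarith
      qed
      moreover have "(\<Sum>i\<in>supp x. - (1 / (2 * L)) * (p i * (\<tau> i)\<^sup>2) - L / 2 * p i)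
          = - (1 / (2 * L)) * (\<Sum>i\<in>supp x. p i * (\<tau> i)\<^sup>2) - L / 2 * s\<^sup>2"
        unfolding psum[symmetric] sum_subtractf sum_distrib_left by (rule refl)
      moreover have "(1 / (2 * L)) * (\<Sum>i\<in>supp x. p i * (\<tau> i)\<^sup>2) \<le> (1 / (2 * L)) * (L\<^sup>2 * s\<^sup>2)"
        using \<tau>2 L by (intro mult_left_mono) auto
      moreover have "(1 / (2 * L)) * (L\<^sup>2 * s\<^sup>2) = L / 2 * s\<^sup>2" using L by (simp add: power2_eq_square)
      ultimately show ?thesis by linarith
    qed
    moreover have "(\<Sum>i\<in>supp x. p i * (1 + L + \<tau> i))
        = (\<Sum>i\<in>supp x. p i) + L * (\<Sum>i\<in>supp x. p i) + (\<Sum>i\<in>supp x. p i * \<tau> i)"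
      by (simp add: algebra_simps sum.distrib sum_distrib_left)
    ultimately have "s\<^sup>2 \<le> (\<Sum>i\<in>supp x. p i * (1 + L + \<tau> i))"
      unfolding psum by linarith
    then have "exp (- L) * s\<^sup>2 \<le> exp (- L) * (\<Sum>i\<in>supp x. p i * (1 + L + \<tau> i))"
      by (rule mult_left_mono) simp
    also have "\<dots> \<le> (\<Sum>i\<in>supp x. p i * exp (\<tau> i))"
      unfolding sum_distrib_left
    proof (rule sum_mono)
      fix i
      have "exp (- L) * (1 + (L + \<tau> i)) \<le> exp (- L) * exp (L + \<tau> i)"
        by (intro mult_left_mono exp_ge_add_one_self) auto
      also have "\<dots> = exp (\<tau> i)" by (simp add: exp_add[symmetric])
      finally have "p i * (exp (- L) * (1 + (L + \<tau> i))) \<le> p i * exp (\<tau> i)"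
        by (intro mult_left_mono) (auto simp: p_def)
      then show "exp (- L) * (p i * (1 + L + \<tau> i)) \<le> p i * exp (\<tau> i)" by (simp add: algebra_simps)
    qed
    \<comment> \<open>Since \<open>exp (\<tau> i) = \<psi> i / f i\<close>, the weighted sum is the
      pairing of \<open>\<psi>\<close> with the dual factor of x.\<close>
    also have "\<dots> = (\<Sum>i\<in>supp x. cmod (complex_of_real (\<psi> i)) * (cmod (x i))\<^sup>2 / f i)"
    proof (rule sum.cong)
      fix i assume "i \<in> supp x"
      then have "0 < \<psi> i" "0 < f i" using pos by (auto simp: supp_def)
      then show "p i * exp (\<tau> i) = cmod (complex_of_real (\<psi> i)) * (cmod (x i))\<^sup>2 / f i"
        by (simp add: \<tau>_def p_def)
    qed simp
    also have "\<dots> \<le> s * N (\<lambda>i. complex_of_real (\<psi> i))"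
    proof -
      have "(\<lambda>i. complex_of_real (\<psi> i)) \<in> c00"
        unfolding \<psi>eq[symmetric] by (intro c00_sum c00_scale factor_c00[OF uc \<phi>])
      then show ?thesis unfolding s_def by (rule factor_dual[OF f])
    qed
    finally have "exp (- L) * s \<le> N (\<lambda>i. complex_of_real (\<psi> i))"
      using s by (simp add: power2_eq_square mult.left_commute[of _ s])
    moreover have "exp (- L) * (\<delta> * na) \<le> exp (- L) * s" using s\<delta> by (intro mult_left_mono) auto
    ultimately show ?thesis unfolding \<psi>eq na_def by linarith
  qed
  then show ?thesis using \<delta> by (intro exI[of _ "exp (- L) * \<delta>"]) auto
qed

end

subsection \<open>Perturbation of \<open>\<ell>\<^sub>2\<close>-sequences\<close>

text \<open>Taking for a the conjugates of t bounds the sum of the squared moduli by D times its own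
  root, so t is square-summable.\<close>

lemma bessel_tendsto_zero:
  fixes t :: "nat \<Rightarrow> complex"
  assumes "\<And>n a. cmod (\<Sum>j<n. a j * t j) \<le> D * sqrt (\<Sum>j<n. (cmod (a j))\<^sup>2)"
  shows "t \<longlonglongrightarrow> 0"
proof -
  have "(\<Sum>j<n. (cmod (t j))\<^sup>2) \<le> D\<^sup>2" for n
  proof -
    let ?S = "\<Sum>j<n. (cmod (t j))\<^sup>2"
    have S0: "0 \<le> ?S" by (simp add: sum_nonneg)
    have "(\<Sum>j<n. cnj (t j) * t j) = complex_of_real ?S"
      by (simp add: complex_norm_square mult.commute del: of_real_power)
    then have "?S \<le> D * sqrt ?S" using assms[where n = n and a = "\<lambda>j. cnj (t j)"] S0 by (simp del: of_real_sum)
    then have "sqrt ?S * sqrt ?S \<le> D * sqrt ?S" using S0 by simp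
    then have "sqrt ?S \<le> D \<or> sqrt ?S = 0"
      using S0 mult_right_le_imp_le[of "sqrt ?S" "sqrt ?S" D] real_sqrt_ge_zero[OF S0] by linarith
    then have "(sqrt ?S)\<^sup>2 \<le> D\<^sup>2"
    proof
      assume "sqrt ?S \<le> D"
      then show ?thesis using S0 by (intro power_mono real_sqrt_ge_zero)
    qed (use S0 in simp)
    then show ?thesis using S0 by simp
  qed
  then have "summable (\<lambda>j. (cmod (t j))\<^sup>2)" by (intro summableI_nonneg_bounded[where x = "D\<^sup>2"]) auto
  then have "(\<lambda>j. (cmod (t j))\<^sup>2) \<longlonglongrightarrow> 0" by (rule summable_LIMSEQ_zero)
  then have "(\<lambda>j. sqrt ((cmod (t j))\<^sup>2)) \<longlonglongrightarrow> sqrt 0" by (rule tendsto_real_sqrt)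
  then show ?thesis by (simp add: tendsto_norm_zero_iff)
qed

text \<open>Padding the coefficients by zeros up to \<open>k n\<close> transfers estimates for the
  full sequence to a subsequence.\<close>

lemma subsequence_sum:
  fixes a :: "nat \<Rightarrow> complex" and k :: "nat \<Rightarrow> nat"
  assumes "strict_mono k"
  obtains b :: "nat \<Rightarrow> complex" where
    "\<And>w :: nat \<Rightarrow> omega. (\<Sum>i<k n. scale (b i) (w i)) = (\<Sum>j<n. scale (a j) (w (k j)))"
    and "(\<Sum>i<k n. (cmod (b i))\<^sup>2) = (\<Sum>j<n. (cmod (a j))\<^sup>2)"
proof
  let ?b = "\<lambda>i. if i \<in> k ` {..<n} then a (inv k i) else 0"
  have inj: "inj k" using assms by (rule strict_mono_imp_inj_on)
  have sub: "k ` {..<n} \<subseteq> {..<k n}" using assms by (auto dest: strict_monoD)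
  have b: "?b (k j) = a j" if "j < n" for j using that inj by auto
  show "(\<Sum>i<k n. scale (?b i) (w i)) = (\<Sum>j<n. scale (a j) (w (k j)))" for w :: "nat \<Rightarrow> omega"
  proof
    fix t
    have "(\<Sum>i<k n. ?b i * w i t) = (\<Sum>i\<in>k ` {..<n}. ?b i * w i t)"
      using sub by (intro sum.mono_neutral_right) auto
    also have "\<dots> = (\<Sum>j<n. ?b (k j) * w (k j) t)"
      by (subst sum.reindex) (auto intro: inj_on_subset[OF inj])
    also have "\<dots> = (\<Sum>j<n. a j * w (k j) t)" using b by (intro sum.cong) (auto simp del: if_split)
    finally show "(\<Sum>i<k n. scale (?b i) (w i)) t = (\<Sum>j<n. scale (a j) (w (k j))) t"
      by (simp add: sum_omega_apply scale_def)
  qed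
  have "(\<Sum>i<k n. (cmod (?b i))\<^sup>2) = (\<Sum>i\<in>k ` {..<n}. (cmod (?b i))\<^sup>2)"
    using sub by (intro sum.mono_neutral_right) auto
  also have "\<dots> = (\<Sum>j<n. (cmod (?b (k j)))\<^sup>2)"
    by (subst sum.reindex) (auto intro: inj_on_subset[OF inj])
  also have "\<dots> = (\<Sum>j<n. (cmod (a j))\<^sup>2)" using b by (intro sum.cong) (auto simp del: if_split)
  finally show "(\<Sum>i<k n. (cmod (?b i))\<^sup>2) = (\<Sum>j<n. (cmod (a j))\<^sup>2)" .
qed

lemma ell2_norm_head_le: "ell2_norm (restrict_to {..<m} x) \<le> (\<Sum>i<m. cmod (x i))"
proof -
  have "ell2_norm (restrict_to {..<m} x) = L2_set (\<lambda>i. cmod (x i)) {..<m}"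
    unfolding L2_set_def by (subst ell2_norm_eq_finite[of "{..<m}"]) (auto simp: restrict_to_def)
  also have "\<dots> \<le> (\<Sum>i<m. cmod (x i))" by (rule L2_set_le_sum) simp
  finally show ?thesis .
qed

lemma ell2_restrict [simp]: "x \<in> ell2 \<Longrightarrow> restrict_to A x \<in> ell2"
  using ell2_leD(1)[OF ell2_le_restrict[OF ell2_le_norm]] .

lemma ell2_norm_restrict_le: "x \<in> ell2 \<Longrightarrow> ell2_norm (restrict_to A x) \<le> ell2_norm x"
  using ell2_leD(2)[OF ell2_le_restrict[OF ell2_le_norm]] .

lemma ell2_norm_off_block_le:
  assumes "x \<in> ell2" and "m \<le> n"
  shows "ell2_norm (x - restrict_to {m..<n} x)
    \<le> (\<Sum>i<m. cmod (x i)) + ell2_norm (restrict_to {n..} x)"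
proof -
  have "x - restrict_to {m..<n} x = restrict_to {..<m} x + restrict_to {n..} x"
    using assms(2) by (auto simp: restrict_to_def fun_eq_iff)
  then have "ell2_norm (x - restrict_to {m..<n} x) \<le> ell2_norm (restrict_to {..<m} x) + ell2_norm (restrict_to {n..} x)"
    using ell2_norm_triangle(1)[of "restrict_to {..<m} x" "restrict_to {n..} x"] assms(1) by simp
  then show ?thesis using ell2_norm_head_le[of m x] by linarith
qed

context twisted_selection
begin

lemma Omega_add_ell2:
  assumes "x \<in> ell2" and "y \<in> ell2" shows "\<Omega> (x + y) - (\<Omega> x + \<Omega> y) \<in> ell2"
proof -
  have "ell2_le (\<Omega> (x + y) - (\<lambda>i. \<Omega> x i + \<Omega> y i))
      (4 * (C * ell2_norm (x + y) + (C * ell2_norm x + C * ell2_norm y)))"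
  proof (rule Omega_compare)
    show "strip_adm (\<lambda>z. B x z + B y z) (C * ell2_norm x + C * ell2_norm y)"
      by (intro strip_adm_add B_adm assms)
    show "((\<lambda>z. (B x z + B y z) i) has_field_derivative \<Omega> x i + \<Omega> y i) (at (1/2))" for i
      using DERIV_add[OF Omega_deriv[OF assms(1), of i] Omega_deriv[OF assms(2), of i]] by simp
    show "B x (1/2) + B y (1/2) = x + y" by (simp only: B_half assms)
    show "x + y \<in> ell2" using assms by (rule ell2_add)
  qed
  then show ?thesis using ell2_leD(1) unfolding plus_fun_def by blast
qed

text \<open>On an initial segment \<open>\<Omega>\<close> is small when its argument is, at the
  price of the length m; this replaces the missing l_2 bound wherever blocks are cut.\<close>

lemma sum_Omega_coord_le:
  assumes "x \<in> ell2" shows "(\<Sum>i<m. cmod (\<Omega> x i)) \<le> real m * (4 * C * ell2_norm x)"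
  using sum_mono[of "{..<m}" "\<lambda>i. cmod (\<Omega> x i)" "\<lambda>i. 4 * C * ell2_norm x"] Omega_coord[OF assms] by simp

end

section \<open>Sequences in the twisted space with an upper l_2 estimate\<close>

locale ell2_sequence = twisted_selection N B C for N B C +
  fixes x y :: "nat \<Rightarrow> omega" and D :: real
  assumes y_ell2: "y j \<in> ell2" and p_ell2: "x j - \<Omega> (y j) \<in> ell2"
    and upper: "Z_norm B (\<Sum>j<n. scale (a j) (x j), \<Sum>j<n. scale (a j) (y j))
      \<le> D * sqrt (\<Sum>j<n. (cmod (a j))\<^sup>2)"
begin

lemma y_sum_ell2: "(\<Sum>j<n. scale (a j) (y j)) \<in> ell2"
  using y_ell2 by (intro ell2_sum) auto

lemma x_sum_ell2: "(\<Sum>j<n. scale (a j) (x j)) - \<Omega> (\<Sum>j<n. scale (a j) (y j)) \<in> ell2"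
proof -
  have "(\<Sum>j<n. scale (a j) (x j - \<Omega> (y j)))
      - (\<Omega> (\<Sum>j<n. scale (a j) (y j)) - (\<Sum>j<n. scale (a j) (\<Omega> (y j)))) \<in> ell2"
    by (rule ell2_diff[OF ell2_sum Omega_sum]) (rule ell2_scale p_ell2 y_ell2 finite_lessThan)+
  also have "(\<Sum>j<n. scale (a j) (x j - \<Omega> (y j)))
      - (\<Omega> (\<Sum>j<n. scale (a j) (y j)) - (\<Sum>j<n. scale (a j) (\<Omega> (y j))))
      = (\<Sum>j<n. scale (a j) (x j)) - \<Omega> (\<Sum>j<n. scale (a j) (y j))"
    by (rule ext) (simp add: sum_omega_apply scale_def right_diff_distrib sum_subtractf)
  finally show ?thesis .
qed

lemma y_sum_le: "ell2_norm (\<Sum>j<n. scale (a j) (y j)) \<le> D * sqrt (\<Sum>j<n. (cmod (a j))\<^sup>2)"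
  and x_sum_le: "ell2_norm ((\<Sum>j<n. scale (a j) (x j)) - \<Omega> (\<Sum>j<n. scale (a j) (y j)))
    \<le> D * sqrt (\<Sum>j<n. (cmod (a j))\<^sup>2)"
  using upper[where n = n and a = a] ell2_norm_nonneg[OF x_sum_ell2[where n = n and a = a]] ell2_norm_nonneg[OF y_sum_ell2[where n = n and a = a]]
  unfolding Z_norm_def by auto

lemma y_coord_null: "(\<lambda>j. y j i) \<longlonglongrightarrow> 0"
proof (rule bessel_tendsto_zero)
  fix n a
  show "cmod (\<Sum>j<n. a j * y j i) \<le> D * sqrt (\<Sum>j<n. (cmod (a j))\<^sup>2)"
    using ell2_coord_le[OF y_sum_ell2[where n = n and a = a], of i] y_sum_le[where n = n and a = a] by (simp add: sum_omega_apply scale_def)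
qed

text \<open>The \<open>x j\<close> have no l_2 bound of their own. Their combinations split into a
  part controlled by the quasi-norm and a value of \<open>\<Omega>\<close>, whose coordinates are
  controlled by its argument.\<close>

lemma x_coord_null: "(\<lambda>j. x j i) \<longlonglongrightarrow> 0"
proof (rule bessel_tendsto_zero)
  fix n a
  let ?X = "\<Sum>j<n. scale (a j) (x j)" and ?Y = "\<Sum>j<n. scale (a j) (y j)"
  let ?s = "sqrt (\<Sum>j<n. (cmod (a j))\<^sup>2)"
  have "cmod (?X i) \<le> cmod ((?X - \<Omega> ?Y) i) + cmod (\<Omega> ?Y i)"
    using norm_triangle_ineq[of "(?X - \<Omega> ?Y) i" "\<Omega> ?Y i"] by simp
  also have "\<dots> \<le> D * ?s + 4 * C * (D * ?s)"
  proof (rule add_mono)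
    show "cmod ((?X - \<Omega> ?Y) i) \<le> D * ?s"
      using ell2_coord_le[OF x_sum_ell2[where n = n and a = a], of i] x_sum_le[where n = n and a = a] by linarith
    have "cmod (\<Omega> ?Y i) \<le> 4 * C * ell2_norm ?Y" by (rule Omega_coord[OF y_sum_ell2])
    also have "\<dots> \<le> 4 * C * (D * ?s)" using C_nonneg y_sum_le by (intro mult_left_mono) auto
    finally show "cmod (\<Omega> ?Y i) \<le> 4 * C * (D * ?s)" .
  qed
  finally show "cmod (\<Sum>j<n. a j * x j i) \<le> (D + 4 * C * D) * ?s"
    by (simp add: sum_omega_apply scale_def algebra_simps)
qed

lemma head_small:
  fixes t :: "nat \<Rightarrow> omega"
  assumes "\<And>i. (\<lambda>j. t j i) \<longlonglongrightarrow> 0" and "0 < e"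
  shows "eventually (\<lambda>j. (\<Sum>i<m. cmod (t j i)) < e) sequentially"
proof -
  have "(\<lambda>j. \<Sum>i<m. cmod (t j i)) \<longlonglongrightarrow> (\<Sum>i<m. cmod 0)" by (intro tendsto_intros assms)
  then show ?thesis using assms(2) by (intro order_tendstoD) auto
qed

section \<open>Large second coordinates: almost linear blocks\<close>

definition rest :: "nat \<Rightarrow> nat \<Rightarrow> nat \<Rightarrow> omega" where
  "rest k m n = y k - restrict_to {m..<n} (y k)"

text \<open>The intended value of \<open>\<Omega>\<close> at the block of \<open>y k\<close> from m
  to n: x k approximates \<open>\<Omega> (y k)\<close>, and the contribution of the remainder is
  removed.\<close>

definition lin_part :: "nat \<Rightarrow> nat \<Rightarrow> nat \<Rightarrow> omega" where
  "lin_part k m n = x k - \<Omega> (rest k m n)"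

lemma rest_ell2: "rest k m n \<in> ell2"
  unfolding rest_def using y_ell2 by simp

text \<open>Since the block has finite support, \<open>\<Omega>\<close> maps it into l_2. Thus the
  correction turns x k, which need not be in l_2, into a vector whose tails can be cut off.\<close>

lemma lin_part_ell2: "lin_part k m n \<in> ell2"
proof -
  let ?u = "restrict_to {m..<n} (y k)" and ?r = "rest k m n"
  have uc: "?u \<in> c00" unfolding c00_iff_bound restrict_to_def by (auto intro: exI[of _ n])
  have "?u + ?r = y k" by (rule ext) (simp add: rest_def)
  then have add: "\<Omega> (y k) - (\<Omega> ?u + \<Omega> ?r) \<in> ell2"
    using Omega_add_ell2[OF c00_ell2[OF uc] rest_ell2[of k m n]] by (simp only:)
  have "(x k - \<Omega> (y k)) + (\<Omega> (y k) - (\<Omega> ?u + \<Omega> ?r)) + \<Omega> ?u \<in> ell2"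
    by (rule ell2_add[OF ell2_add[OF p_ell2 add] Omega_c00[OF uc]])
  moreover have "(x k - \<Omega> (y k)) + (\<Omega> (y k) - (\<Omega> ?u + \<Omega> ?r)) + \<Omega> ?u = lin_part k m n"
    by (rule ext) (simp add: lin_part_def)
  ultimately show ?thesis by (simp only:)
qed

text \<open>Given m, first k is taken so large that \<open>x k\<close> and \<open>y k\<close> have
  small heads, then n so large that the tail of \<open>y k\<close> is small. The head of
  \<open>\<Omega> (rest k m n)\<close> is then small as well.\<close>

lemma block_exists:
  assumes e: "0 < e"
  shows "\<exists>k>k0. \<exists>n\<ge>m. ell2_norm (rest k m n) \<le> e \<and> ell2_norm (restrict_to {..<m} (lin_part k m n)) \<le> e"
proof -
  \<comment> \<open>The head of \<open>\<Omega>\<close> up to m costs \<open>real m * 4 * C\<close>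
    times the norm of the remainder; the added 1 makes the denominator positive and gives
    \<open>\<epsilon> \<le> e\<close>.\<close>
  define \<epsilon> where "\<epsilon> = e / (2 * (4 * C * real m + 1))"
  have den: "0 < 4 * C * real m + 1" using C_nonneg by (simp add: add_nonneg_pos)
  have \<epsilon>: "0 < \<epsilon>" using den e by (simp add: \<epsilon>_def)
  have \<epsilon>e: "\<epsilon> \<le> e" and m\<epsilon>: "real m * (4 * C * \<epsilon>) \<le> e / 2"
  proof -
    have "\<epsilon> * (4 * C * real m + 1) = e / 2" unfolding \<epsilon>_def using den by (simp add: field_simps)
    then have "real m * (4 * C * \<epsilon>) + \<epsilon> = e / 2" by (simp add: algebra_simps)
    moreover have "0 \<le> real m * (4 * C * \<epsilon>)" using C_nonneg \<epsilon> by simp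
    ultimately show "\<epsilon> \<le> e" "real m * (4 * C * \<epsilon>) \<le> e / 2" using \<epsilon> e by linarith+
  qed
  have "eventually (\<lambda>k. (\<Sum>i<m. cmod (x k i)) < e / 2 \<and> (\<Sum>i<m. cmod (y k i)) < \<epsilon> / 2 \<and> k0 < k) sequentially"
    using e \<epsilon> by (intro eventually_conj head_small x_coord_null y_coord_null eventually_gt_at_top) auto
  then obtain k where k: "(\<Sum>i<m. cmod (x k i)) < e / 2" "(\<Sum>i<m. cmod (y k i)) < \<epsilon> / 2" "k0 < k"
    by (auto simp: eventually_sequentially)
  obtain n0 where n0: "\<And>n. n0 \<le> n \<Longrightarrow> ell2_norm (restrict_to {n..} (y k)) \<le> \<epsilon> / 2"
    using ell2_tail[OF y_ell2, of "\<epsilon> / 2" k] \<epsilon> by auto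
  define n where "n = max m n0"
  have mn: "m \<le> n" by (simp add: n_def)
  have r: "ell2_norm (rest k m n) \<le> \<epsilon>"
    using ell2_norm_off_block_le[OF y_ell2 mn, of k] k(2) n0[of n] by (simp add: rest_def n_def)
  have "ell2_norm (restrict_to {..<m} (lin_part k m n)) \<le> (\<Sum>i<m. cmod (lin_part k m n i))"
    by (rule ell2_norm_head_le)
  also have "\<dots> \<le> (\<Sum>i<m. cmod (x k i) + cmod (\<Omega> (rest k m n) i))"
    by (intro sum_mono) (auto simp: lin_part_def intro: norm_triangle_ineq4)
  also have "\<dots> \<le> e / 2 + real m * (4 * C * \<epsilon>)"
  proof -
    have "(\<Sum>i<m. cmod (\<Omega> (rest k m n) i)) \<le> real m * (4 * C * ell2_norm (rest k m n))"
      by (rule sum_Omega_coord_le[OF rest_ell2])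
    also have "\<dots> \<le> real m * (4 * C * \<epsilon>)" using r C_nonneg by (intro mult_left_mono) auto
    finally show ?thesis using k(1) by (simp add: sum.distrib)
  qed
  also have "\<dots> \<le> e" using m\<epsilon> by linarith
  finally show ?thesis using k(3) mn r \<epsilon>e by (meson order_trans)
qed

lemma subsequence_sum_le:
  fixes k :: "nat \<Rightarrow> nat"
  assumes k: "strict_mono k"
  shows "(\<Sum>j<n. scale (a j) (y (k j))) \<in> ell2"
    and "ell2_norm (\<Sum>j<n. scale (a j) (y (k j))) \<le> D * sqrt (\<Sum>j<n. (cmod (a j))\<^sup>2)"
    and "(\<Sum>j<n. scale (a j) (x (k j))) - \<Omega> (\<Sum>j<n. scale (a j) (y (k j))) \<in> ell2"
    and "ell2_norm ((\<Sum>j<n. scale (a j) (x (k j))) - \<Omega> (\<Sum>j<n. scale (a j) (y (k j))))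
      \<le> D * sqrt (\<Sum>j<n. (cmod (a j))\<^sup>2)"
proof -
  obtain b where b: "\<And>w :: nat \<Rightarrow> omega. (\<Sum>i<k n. scale (b i) (w i)) = (\<Sum>j<n. scale (a j) (w (k j)))"
    "(\<Sum>i<k n. (cmod (b i))\<^sup>2) = (\<Sum>j<n. (cmod (a j))\<^sup>2)"
    using subsequence_sum[OF k] by blast
  show "(\<Sum>j<n. scale (a j) (y (k j))) \<in> ell2"
    "ell2_norm (\<Sum>j<n. scale (a j) (y (k j))) \<le> D * sqrt (\<Sum>j<n. (cmod (a j))\<^sup>2)"
    "(\<Sum>j<n. scale (a j) (x (k j))) - \<Omega> (\<Sum>j<n. scale (a j) (y (k j))) \<in> ell2"
    "ell2_norm ((\<Sum>j<n. scale (a j) (x (k j))) - \<Omega> (\<Sum>j<n. scale (a j) (y (k j))))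
      \<le> D * sqrt (\<Sum>j<n. (cmod (a j))\<^sup>2)"
    using y_sum_ell2[where n = "k n" and a = b] y_sum_le[where n = "k n" and a = b] x_sum_ell2[where n = "k n" and a = b] x_sum_le[where n = "k n" and a = b]
    unfolding b by auto
qed

lemma y_norm_le: "ell2_norm (y j) \<le> D"
proof -
  let ?a = "\<lambda>k. if k = j then 1 else (0::complex)"
  have "(\<Sum>k<Suc j. scale (?a k) (y k)) = y j"
    by (auto simp: sum_omega_apply scale_def fun_eq_iff)
  moreover have "(\<Sum>k<Suc j. (cmod (?a k))\<^sup>2) = 1" by (simp add: if_distrib cong: if_cong)
  ultimately show ?thesis using y_sum_le[where n = "Suc j" and a = ?a] by simp
qed

text \<open>\<open>\<Omega> Y\<close> is within \<open>D * s\<close> of \<open>X\<close> by the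
  upper estimate. Splitting \<open>Y\<close> into the blocks and the summably small remainders with
  \<open>Omega_combination\<close> moves this to the blocks; \<open>a j \<le> s\<close> turns the
  l_1 error into \<open>E * s\<close>.\<close>

lemma lin_part_sum:
  fixes k :: "nat \<Rightarrow> nat"
  assumes k: "strict_mono k" and r: "\<And>j. ell2_norm (rest (k j) (m j) (n j)) \<le> e j"
    and e: "\<And>q. (\<Sum>j<q. e j) \<le> E" and a: "\<And>j. 0 \<le> a j"
  shows "ell2_le (\<Omega> (\<Sum>j<q. scale (complex_of_real (a j)) (restrict_to {m j..<n j} (y (k j))))
      - (\<Sum>j<q. scale (complex_of_real (a j)) (lin_part (k j) (m j) (n j))))
    ((4 * C * (2 * D + 2 * E) + D) * sqrt (\<Sum>j<q. (a j)\<^sup>2))"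
proof -
  define s where "s = sqrt (\<Sum>j<q. (a j)\<^sup>2)"
  let ?a = "\<lambda>j. complex_of_real (a j)"
  define r where "r j = rest (k j) (m j) (n j)" for j
  define X where "X = (\<Sum>j<q. scale (?a j) (x (k j)))"
  define Y where "Y = (\<Sum>j<q. scale (?a j) (y (k j)))"
  define u where "u = (\<Sum>j<q. scale (?a j) (restrict_to {m j..<n j} (y (k j))))"
  define R where "R = (\<Sum>j<q. scale (?a j) (r j))"
  have s: "0 \<le> s" by (simp add: s_def sum_nonneg)
  have Y: "Y \<in> ell2" "ell2_norm Y \<le> D * s" "X - \<Omega> Y \<in> ell2" "ell2_norm (X - \<Omega> Y) \<le> D * s"
    using subsequence_sum_le[OF k, where n = q and a = ?a] by (simp_all add: X_def Y_def s_def)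
  have Yu: "Y = u + R"
    by (rule ext) (simp add: Y_def u_def R_def r_def rest_def sum_omega_apply scale_def sum.distrib[symmetric] algebra_simps)
  have r2: "r j \<in> ell2" "0 \<le> ell2_norm (r j)" "ell2_norm (r j) \<le> e j" for j
    using rest_ell2 assms(2) by (auto simp: r_def)
  have as: "a j \<le> s" if "j < q" for j
  proof -
    have "(a j)\<^sup>2 \<le> (\<Sum>j<q. (a j)\<^sup>2)" using that by (intro member_le_sum) auto
    then show ?thesis unfolding s_def using a by (intro real_le_rsqrt) auto
  qed
  have "(\<Sum>j<q. cmod (?a j) * ell2_norm (r j)) \<le> (\<Sum>j<q. s * e j)"
    using as a r2 s by (intro sum_mono mult_mono) auto
  also have "\<dots> \<le> s * E" unfolding sum_distrib_left[symmetric] using e s by (rule mult_left_mono)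
  finally have sumr: "(\<Sum>j<q. cmod (?a j) * ell2_norm (r j)) \<le> E * s" by (simp add: mult.commute)
  have R: "ell2_le R (E * s)"
    unfolding R_def
    by (rule ell2_le_weaken[OF ell2_le_sum sumr]) (intro finite_lessThan ell2_le_scale ell2_le_norm r2)+
  have u2: "u \<in> ell2" unfolding u_def using y_ell2 by (intro ell2_sum) auto
  have "u = Y - R" using Yu by simp
  then have "ell2_norm u \<le> D * s + E * s"
    using ell2_norm_triangle(2)[OF Y(1) ell2_leD(1)[OF R]] ell2_leD(2)[OF R] Y(2) by simp
  then have "4 * C * (ell2_norm Y + ell2_norm u + (\<Sum>j<q. cmod (?a j) * ell2_norm (r j)))
      \<le> 4 * C * (D * s + (D * s + E * s) + E * s)"
    using Y(2) sumr C_nonneg by (intro mult_left_mono add_mono) auto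
  then have 1: "ell2_le (\<Omega> Y - (\<Omega> u + (\<Sum>j<q. scale (?a j) (\<Omega> (r j))))) (4 * C * (D * s + (D * s + E * s) + E * s))"
    using Yu r2 u2 Y(1) unfolding R_def by (intro ell2_le_weaken[OF Omega_combination]) auto
  have 2: "ell2_le (X - \<Omega> Y) (D * s)" by (rule ell2_le_weaken[OF ell2_le_norm[OF Y(3)] Y(4)])
  have "ell2_le (scale (-1) (\<Omega> Y - (\<Omega> u + (\<Sum>j<q. scale (?a j) (\<Omega> (r j))))) - (X - \<Omega> Y))
      (cmod (-1) * (4 * C * (D * s + (D * s + E * s) + E * s)) + D * s)"
    by (intro ell2_le_diff ell2_le_scale 1 2)
  moreover have "scale (-1) (\<Omega> Y - (\<Omega> u + (\<Sum>j<q. scale (?a j) (\<Omega> (r j))))) - (X - \<Omega> Y)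
      = \<Omega> u - (\<Sum>j<q. scale (?a j) (lin_part (k j) (m j) (n j)))"
    by (rule ext)
      (simp add: X_def lin_part_def r_def sum_omega_apply scale_def right_diff_distrib sum_subtractf algebra_simps)
  moreover have "cmod (-1) * (4 * C * (D * s + (D * s + E * s) + E * s)) + D * s
      = (4 * C * (2 * D + 2 * E) + D) * s" by (simp add: algebra_simps)
  ultimately show ?thesis unfolding u_def s_def by (simp only:)
qed

text \<open>A gliding hump: choosing k makes the head of the linear part before its block small, and
  choosing the start of the next block makes its tail small.\<close>

lemma linear_blocks:
  assumes \<delta>: "0 < \<delta>" and large: "\<And>j. M \<le> j \<Longrightarrow> \<delta> \<le> ell2_norm (y j)"
  obtains u l :: "nat \<Rightarrow> omega" and m n :: "nat \<Rightarrow> nat" and \<eta> :: "nat \<Rightarrow> real" and K :: real where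
    "\<And>j i. i < m j \<or> n j \<le> i \<Longrightarrow> u j i = 0" and "\<And>j. m j \<le> n j" and "\<And>j. n j \<le> m (Suc j)"
    and "\<And>j. \<delta> / 2 \<le> ell2_norm (u j)" and "\<And>j. ell2_norm (u j) \<le> D"
    and "\<And>j. ell2_le (restrict_to (- {m j..<m (Suc j)}) (l j)) (\<eta> j)" and "\<And>k. (\<Sum>j<k. \<eta> j) \<le> \<delta>"
    and "\<And>k a. (\<And>j. 0 \<le> a j) \<Longrightarrow>
      ell2_le (\<Omega> (\<Sum>j<k. scale (complex_of_real (a j)) (u j)) - (\<Sum>j<k. scale (complex_of_real (a j)) (l j)))
        (K * sqrt (\<Sum>j<k. (a j)\<^sup>2))"
proof -
  \<comment> \<open>At most \<open>\<delta> / 4\<close> each, so the blocks keep norm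
    \<open>\<delta> / 2\<close>; with total at most \<open>\<delta> / 2\<close>, head and tail
    errors together sum to at most \<open>\<delta>\<close>.\<close>
  define e where "e j = \<delta> / 4 * (1/2) ^ j" for j :: nat
  have e: "0 < e j" "e j \<le> \<delta> / 4" for j using \<delta> by (auto simp: e_def power_le_one)
  have esum: "(\<Sum>j<q. e j) \<le> \<delta> / 2" for q
  proof -
    have "(\<Sum>j<q. e j) = \<delta> / 4 * (\<Sum>j<q. (1/2) ^ j)" by (simp add: e_def sum_distrib_left)
    also have "(\<Sum>j<q. (1/2) ^ j) = 2 * (1 - (1/2::real) ^ q)"
    proof (induction q)
      case (Suc q)
      have "s + p = 2 * (1 - 1 / 2 * p)" if "s = 2 * (1 - p)" for s p :: real using that by simp
      from this[OF Suc] show ?case unfolding sum.lessThan_Suc power_Suc .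
    qed simp
    also have "\<delta> / 4 * (2 * (1 - (1/2) ^ q)) \<le> \<delta> / 4 * 2" using \<delta> by (intro mult_left_mono) auto
    finally show ?thesis by simp
  qed
  let ?l = "\<lambda>(k, m, n). lin_part k m n"
  define P where "P j s \<longleftrightarrow> (case s of (k, m, n) \<Rightarrow> M \<le> k \<and> m \<le> n \<and> ell2_norm (rest k m n) \<le> e j \<and>
    ell2_norm (restrict_to {..<m} (lin_part k m n)) \<le> e j)" for j and s :: "nat \<times> nat \<times> nat"
  define Q where "Q j s s' \<longleftrightarrow> (case s of (k, m, n) \<Rightarrow> case s' of (k', m', n') \<Rightarrow> k < k' \<and> n \<le> m' \<and>
    ell2_norm (restrict_to {m'..} (lin_part k m n)) \<le> e j)" for j and s s' :: "nat \<times> nat \<times> nat"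
  have "\<exists>f. \<forall>j. P j (f j) \<and> Q j (f j) (f (Suc j))"
  proof (rule dependent_nat_choice)
    obtain k n where "M < k" "0 \<le> n" "ell2_norm (rest k 0 n) \<le> e 0"
        "ell2_norm (restrict_to {..<0} (lin_part k 0 n)) \<le> e 0"
      using block_exists[OF e(1)[of 0], of M 0] by blast
    then have "P 0 (k, 0, n)" by (simp add: P_def)
    then show "\<exists>s. P 0 s" by blast
  next
    fix s j assume Ps: "P j s"
    obtain k m n where s: "s = (k, m, n)" by (cases s)
    obtain m0 where m0: "\<And>n'. m0 \<le> n' \<Longrightarrow> ell2_norm (restrict_to {n'..} (lin_part k m n)) \<le> e j"
      using ell2_tail[OF lin_part_ell2 e(1)] by blast
    define m' where "m' = max n m0"
    obtain k' n' where "k < k'" "m' \<le> n'" "ell2_norm (rest k' m' n') \<le> e (Suc j)"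
        "ell2_norm (restrict_to {..<m'} (lin_part k' m' n')) \<le> e (Suc j)"
      using block_exists[OF e(1)[of "Suc j"], of k m'] by blast
    then have "P (Suc j) (k', m', n') \<and> Q j s (k', m', n')"
      using Ps m0[of m'] by (simp add: P_def Q_def s m'_def)
    then show "\<exists>s'. P (Suc j) s' \<and> Q j s s'" by blast
  qed
  then obtain f where f: "\<And>j. P j (f j)" "\<And>j. Q j (f j) (f (Suc j))" by blast
  define k m n where "k j = fst (f j)" and "m j = fst (snd (f j))" and "n j = snd (snd (f j))" for j
  have kmn: "f j = (k j, m j, n j)" for j by (simp add: k_def m_def n_def)
  have P: "M \<le> k j" "m j \<le> n j" "ell2_norm (rest (k j) (m j) (n j)) \<le> e j"
      "ell2_norm (restrict_to {..<m j} (lin_part (k j) (m j) (n j))) \<le> e j" for j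
    using f(1)[of j] unfolding kmn P_def by auto
  have Q: "k j < k (Suc j)" "n j \<le> m (Suc j)"
      "ell2_norm (restrict_to {m (Suc j)..} (lin_part (k j) (m j) (n j))) \<le> e j" for j
    using f(2)[of j] unfolding kmn Q_def by auto
  have kmono: "strict_mono k" using Q(1) by (simp add: strict_mono_Suc_iff)
  let ?u = "\<lambda>j. restrict_to {m j..<n j} (y (k j))"
  show ?thesis
  proof (rule that[of m n ?u "\<lambda>j. lin_part (k j) (m j) (n j)" "\<lambda>j. 2 * e j" "4 * C * (2 * D + 2 * (\<delta> / 2)) + D"])
    show "\<And>j i. i < m j \<or> n j \<le> i \<Longrightarrow> ?u j i = 0" by (auto simp: restrict_to_def)
    show "m j \<le> n j" "n j \<le> m (Suc j)" for j using P(2) Q(2) by auto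
    show "\<delta> / 2 \<le> ell2_norm (?u j)" for j
    proof -
      have "y (k j) = ?u j + rest (k j) (m j) (n j)" by (auto simp: rest_def)
      then have "ell2_norm (y (k j)) \<le> ell2_norm (?u j) + ell2_norm (rest (k j) (m j) (n j))"
        using ell2_norm_triangle(1)[of "?u j" "rest (k j) (m j) (n j)"] y_ell2 rest_ell2 by simp
      then show ?thesis using large[OF P(1)[of j]] P(3)[of j] e(2)[of j] \<delta> by linarith
    qed
    show "ell2_norm (?u j) \<le> D" for j
      using ell2_norm_restrict_le[OF y_ell2] y_norm_le order_trans by blast
    show "ell2_le (restrict_to (- {m j..<m (Suc j)}) (lin_part (k j) (m j) (n j))) (2 * e j)" for j
    proof -
      let ?l = "lin_part (k j) (m j) (n j)"
      have "ell2_le (restrict_to {..<m j} ?l + restrict_to {m (Suc j)..} ?l) (e j + e j)"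
        using P(4)[of j] Q(3)[of j] lin_part_ell2
        by (intro ell2_le_add) (auto intro: ell2_le_weaken[OF ell2_le_norm])
      moreover have "restrict_to (- {m j..<m (Suc j)}) ?l = restrict_to {..<m j} ?l + restrict_to {m (Suc j)..} ?l"
        using P(2)[of j] Q(2)[of j] by (auto simp: restrict_to_def fun_eq_iff)
      ultimately show ?thesis by (simp only: mult_2)
    qed
    show "(\<Sum>j<q. 2 * e j) \<le> \<delta>" for q
      using esum[of q] by (simp add: sum_distrib_left[symmetric])
    show "ell2_le (\<Omega> (\<Sum>j<q. scale (complex_of_real (a j)) (?u j))
        - (\<Sum>j<q. scale (complex_of_real (a j)) (lin_part (k j) (m j) (n j))))
      ((4 * C * (2 * D + 2 * (\<delta> / 2)) + D) * sqrt (\<Sum>j<q. (a j)\<^sup>2))" if "\<And>j. 0 \<le> a j" for q a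
      by (rule lin_part_sum[OF kmono P(3) esum that])
  qed
qed

section \<open>Small second coordinates: perturbation to blocks\<close>

lemma approximating_block:
  assumes small: "\<And>\<epsilon> k0. 0 < \<epsilon> \<Longrightarrow> \<exists>k>k0. ell2_norm (y k) < \<epsilon>" and e: "0 < e"
  shows "\<exists>k>k0. \<exists>n\<ge>m. ell2_norm (y k) \<le> e \<and>
    ell2_norm ((x k - \<Omega> (y k)) - restrict_to {m..<n} (x k - \<Omega> (y k))) \<le> e"
proof -
  \<comment> \<open>The error e is spent as e / 4 on the head of \<open>x k\<close>, e / 4 on that
    of \<open>\<Omega> (y k)\<close>, and e / 2 on the tail.\<close>
  define \<epsilon> where "\<epsilon> = e / (4 * (4 * C * real m + 1))"
  have den: "0 < 4 * C * real m + 1" using C_nonneg by (simp add: add_nonneg_pos)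
  have \<epsilon>: "0 < \<epsilon>" using den e by (simp add: \<epsilon>_def)
  have \<epsilon>e: "\<epsilon> \<le> e" and m\<epsilon>: "real m * (4 * C * \<epsilon>) \<le> e / 4"
  proof -
    have "\<epsilon> * (4 * C * real m + 1) = e / 4" unfolding \<epsilon>_def using den by (simp add: field_simps)
    then have "real m * (4 * C * \<epsilon>) + \<epsilon> = e / 4" by (simp add: algebra_simps)
    moreover have "0 \<le> real m * (4 * C * \<epsilon>)" using C_nonneg \<epsilon> by simp
    ultimately show "\<epsilon> \<le> e" "real m * (4 * C * \<epsilon>) \<le> e / 4" using \<epsilon> e by linarith+
  qed
  obtain k1 where k1: "\<And>k. k1 \<le> k \<Longrightarrow> (\<Sum>i<m. cmod (x k i)) < e / 4"
    using head_small[of x, OF x_coord_null, where e = "e / 4" and m = m] e by (auto simp: eventually_sequentially)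
  obtain k where k: "max k0 k1 < k" "ell2_norm (y k) < \<epsilon>" using small[OF \<epsilon>] by blast
  let ?p = "x k - \<Omega> (y k)"
  obtain n0 where n0: "\<And>n. n0 \<le> n \<Longrightarrow> ell2_norm (restrict_to {n..} ?p) \<le> e / 2"
    using ell2_tail[OF p_ell2, of "e / 2" k] e by auto
  define n where "n = max m n0"
  have mn: "m \<le> n" by (simp add: n_def)
  have "(\<Sum>i<m. cmod (?p i)) \<le> (\<Sum>i<m. cmod (x k i) + cmod (\<Omega> (y k) i))"
    by (intro sum_mono) (auto intro: norm_triangle_ineq4)
  also have "\<dots> \<le> e / 4 + real m * (4 * C * \<epsilon>)"
  proof -
    have "(\<Sum>i<m. cmod (\<Omega> (y k) i)) \<le> real m * (4 * C * ell2_norm (y k))"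
      by (rule sum_Omega_coord_le[OF y_ell2])
    also have "\<dots> \<le> real m * (4 * C * \<epsilon>)" using k(2) C_nonneg by (intro mult_left_mono) auto
    finally show ?thesis using k1[of k] k(1) by (simp add: sum.distrib)
  qed
  finally have "(\<Sum>i<m. cmod (?p i)) \<le> e / 2" using m\<epsilon> by linarith
  then have "ell2_norm (?p - restrict_to {m..<n} ?p) \<le> e"
    using ell2_norm_off_block_le[OF p_ell2 mn, of k] n0[of n] by (simp add: n_def)
  then show ?thesis using k \<epsilon>e mn by (intro exI[of _ k]) auto
qed

text \<open>With \<open>\<nu>\<close> the norm of the vector, \<open>y k\<close> and the part off
  the block cost \<open>e / \<nu>\<close> each, and replacing the factor \<open>1 / \<nu>\<close> by
  the reciprocal of the norm of \<open>v\<close> costs \<open>2 * e / \<nu>\<close>. The condition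
  \<open>4 * e \<le> c\<close> also keeps \<open>v\<close> nonzero.\<close>

lemma normalised_block_error:
  assumes c: "0 < c" "c \<le> Z_norm B (x k, y k)" and e: "0 < e" "4 * e \<le> c"
    and yk: "ell2_norm (y k) \<le> e"
    and pk: "ell2_norm ((x k - \<Omega> (y k)) - restrict_to {m..<n} (x k - \<Omega> (y k))) \<le> e"
  defines "v \<equiv> restrict_to {m..<n} (x k - \<Omega> (y k))"
  shows "ell2_norm (scale (complex_of_real (1 / ell2_norm v)) v) = 1"
    and "Z_norm B (scale_pair (complex_of_real (1 / Z_norm B (x k, y k))) (x k, y k)
      - (scale (complex_of_real (1 / ell2_norm v)) v, 0)) \<le> 4 * e / c"
proof -
  define p where "p = x k - \<Omega> (y k)"
  define \<nu> where "\<nu> = Z_norm B (x k, y k)"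
  define q where "q = p - v"
  have p: "p \<in> ell2" and v: "v \<in> ell2" and q: "q \<in> ell2"
    using p_ell2 by (auto simp: p_def v_def q_def)
  have qe: "ell2_norm q \<le> e" using pk by (simp add: q_def p_def v_def)
  have \<nu>: "\<nu> = ell2_norm p + ell2_norm (y k)" by (simp add: \<nu>_def Z_norm_def p_def)
  have \<nu>c: "c \<le> \<nu>" "0 < \<nu>" using c by (auto simp: \<nu>_def)
  have vp: "ell2_norm v \<le> ell2_norm p" unfolding v_def p_def[symmetric] by (rule ell2_norm_restrict_le[OF p])
  have "p = v + q" by (auto simp: q_def)
  then have pv: "ell2_norm p \<le> ell2_norm v + e" using ell2_norm_triangle(1)[OF v q] qe by simp
  have vpos: "0 < ell2_norm v" using pv \<nu> \<nu>c c e yk by linarith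
  show "ell2_norm (scale (complex_of_real (1 / ell2_norm v)) v) = 1"
    using vpos v by (simp add: ell2_norm_scale norm_divide)
  let ?c = "complex_of_real (1 / \<nu>)" and ?d = "complex_of_real (1 / ell2_norm v)"
  have cnorm: "cmod ?c = 1 / \<nu>" using \<nu>c by (simp add: norm_divide)
  have cd: "cmod (?c - ?d) * ell2_norm v \<le> 2 * e / \<nu>"
  proof -
    have "cmod (?c - ?d) * ell2_norm v = \<bar>1 / \<nu> - 1 / ell2_norm v\<bar> * ell2_norm v"
      by (metis norm_of_real of_real_diff)
    also have "\<dots> = \<bar>(1 / \<nu> - 1 / ell2_norm v) * ell2_norm v\<bar>" using vpos by (simp add: abs_mult)
    also have "(1 / \<nu> - 1 / ell2_norm v) * ell2_norm v = (ell2_norm v - \<nu>) / \<nu>"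
      using vpos \<nu>c by (simp add: field_simps)
    also have "\<bar>(ell2_norm v - \<nu>) / \<nu>\<bar> = \<bar>ell2_norm v - \<nu>\<bar> / \<nu>" using \<nu>c by simp
    also have "\<dots> \<le> 2 * e / \<nu>"
      using vp pv \<nu> yk \<nu>c ell2_norm_nonneg[OF y_ell2[of k]] by (intro divide_right_mono) auto
    finally show ?thesis .
  qed
  have eq: "scale ?c (x k) - scale ?d v - \<Omega> (scale ?c (y k) - 0) = scale ?c q + scale (?c - ?d) v"
  proof -
    have "scale ?c (y k) - 0 = scale ?c (y k)" by auto
    then have "\<Omega> (scale ?c (y k) - 0) = scale ?c (\<Omega> (y k))" using Omega_scale[OF y_ell2] by simp
    then show ?thesis by (auto simp: q_def p_def scale_def algebra_simps fun_eq_iff)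
  qed
  have 1: "Z_norm B (scale_pair ?c (x k, y k) - (scale ?d v, 0))
      = ell2_norm (scale ?c q + scale (?c - ?d) v) + ell2_norm (scale ?c (y k) - 0)"
    unfolding Z_norm_def scale_pair_def eq[symmetric] by simp
  have "ell2_norm (scale ?c (y k) - 0) = 1 / \<nu> * ell2_norm (y k)"
    using ell2_norm_scale[OF y_ell2, of ?c k] cnorm by simp
  also have "\<dots> \<le> 1 / \<nu> * e" using yk \<nu>c by (intro mult_left_mono) auto
  finally have 2: "ell2_norm (scale ?c (y k) - 0) \<le> 1 / \<nu> * e" .
  have "ell2_norm (scale ?c q + scale (?c - ?d) v) \<le> ell2_norm (scale ?c q) + ell2_norm (scale (?c - ?d) v)"
    using q v by (intro ell2_norm_triangle) auto
  also have "\<dots> = 1 / \<nu> * ell2_norm q + cmod (?c - ?d) * ell2_norm v"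
    using ell2_norm_scale[OF q, of ?c] ell2_norm_scale[OF v, of "?c - ?d"] cnorm by simp
  also have "\<dots> \<le> 1 / \<nu> * e + 2 * e / \<nu>" using qe cd \<nu>c by (intro add_mono mult_left_mono) auto
  finally have "Z_norm B (scale_pair ?c (x k, y k) - (scale ?d v, 0)) \<le> 1 / \<nu> * e + 2 * e / \<nu> + 1 / \<nu> * e"
    unfolding 1 by (rule add_mono[OF _ 2])
  also have "\<dots> = 4 * e / \<nu>" by (simp add: field_simps)
  also have "\<dots> \<le> 4 * e / c" using e c \<nu>c by (intro divide_left_mono) auto
  finally show "Z_norm B (scale_pair (complex_of_real (1 / Z_norm B (x k, y k))) (x k, y k)
      - (scale (complex_of_real (1 / ell2_norm v)) v, 0)) \<le> 4 * e / c" by (simp add: \<nu>_def)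
qed

lemma perturbation:
  assumes small: "\<And>\<epsilon> k0. 0 < \<epsilon> \<Longrightarrow> \<exists>k>k0. ell2_norm (y k) < \<epsilon>"
    and c: "0 < c" "\<And>k. c \<le> Z_norm B (x k, y k)"
  shows "\<exists>k b. strict_mono (k :: nat \<Rightarrow> nat) \<and> block_sequence b \<and>
    (\<forall>j. (b j, 0) \<in> Z_space B \<and> Z_norm B (b j, 0) = 1 \<and>
      Z_norm B (scale_pair (complex_of_real (1 / Z_norm B (x (k j), y (k j)))) (x (k j), y (k j)) - (b j, 0))
        \<le> (1/2) ^ Suc j)"
proof -
  \<comment> \<open>Chosen so that the error \<open>4 * e j / c\<close> of the normalised block is
    exactly the required power of 1/2.\<close>
  define e where "e j = c / 4 * (1/2) ^ Suc j" for j
  have e: "0 < e j" "4 * e j \<le> c" "4 * e j / c = (1/2) ^ Suc j" for j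
  proof -
    have "(1/2::real) ^ Suc j \<le> 1" by (rule power_le_one) auto
    then have "c * (1/2) ^ Suc j \<le> c * 1" using c(1) by (intro mult_left_mono) auto
    then show "4 * e j \<le> c" by (simp add: e_def)
  qed (use c(1) in \<open>auto simp: e_def\<close>)
  define p where "p k = x k - \<Omega> (y k)" for k
  define P where "P j s \<longleftrightarrow> (case s of (k, m, n) \<Rightarrow> m \<le> n \<and> ell2_norm (y k) \<le> e j \<and>
    ell2_norm (p k - restrict_to {m..<n} (p k)) \<le> e j)" for j and s :: "nat \<times> nat \<times> nat"
  define Q where "Q s s' \<longleftrightarrow> (case s of (k, m, n) \<Rightarrow> case s' of (k', m', n') \<Rightarrow> k < k' \<and> n = m')"
    for s s' :: "nat \<times> nat \<times> nat"
  have "\<exists>f. \<forall>j. P j (f j) \<and> Q (f j) (f (Suc j))"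
  proof (rule dependent_nat_choice)
    obtain k n where "0 \<le> n" "ell2_norm (y k) \<le> e 0" "ell2_norm (p k - restrict_to {0..<n} (p k)) \<le> e 0"
      using approximating_block[OF small e(1)[of 0], of 0 0] unfolding p_def by blast
    then have "P 0 (k, 0, n)" by (simp add: P_def)
    then show "\<exists>s. P 0 s" by blast
  next
    fix s j assume "P j s"
    obtain k m n where s: "s = (k, m, n)" by (cases s)
    obtain k' n' where "k < k'" "n \<le> n'" "ell2_norm (y k') \<le> e (Suc j)"
        "ell2_norm (p k' - restrict_to {n..<n'} (p k')) \<le> e (Suc j)"
      using approximating_block[OF small e(1)[of "Suc j"], of k n] unfolding p_def by blast
    then have "P (Suc j) (k', n, n') \<and> Q s (k', n, n')" by (simp add: P_def Q_def s)
    then show "\<exists>s'. P (Suc j) s' \<and> Q s s'" by blast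
  qed
  then obtain f where f: "\<And>j. P j (f j)" "\<And>j. Q (f j) (f (Suc j))" by blast
  define k m n where "k j = fst (f j)" and "m j = fst (snd (f j))" and "n j = snd (snd (f j))" for j
  have kmn: "f j = (k j, m j, n j)" for j by (simp add: k_def m_def n_def)
  have P: "ell2_norm (y (k j)) \<le> e j"
      "ell2_norm (p (k j) - restrict_to {m j..<n j} (p (k j))) \<le> e j" for j
    using f(1)[of j] unfolding kmn P_def by auto
  have Q: "k j < k (Suc j)" "n j = m (Suc j)" for j
    using f(2)[of j] unfolding kmn Q_def by auto
  define v where "v j = restrict_to {m j..<n j} (p (k j))" for j
  define b where "b j = scale (complex_of_real (1 / ell2_norm (v j))) (v j)" for j
  have bs: "supp (b j) \<subseteq> {m j..<n j}" for j
    by (auto simp: supp_def b_def v_def scale_def restrict_to_def split: if_splits)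
  have bc: "b j \<in> c00" for j using bs[of j] unfolding c00_def by (auto intro: finite_subset)
  have norm0: "ell2_norm 0 = 0" by (simp add: ell2_norm_def)
  have b1: "ell2_norm (b j) = 1" for j
    using normalised_block_error(1)[OF c(1) c(2) e(1,2) P(1) P(2)[unfolded p_def]]
    by (simp add: b_def v_def p_def)
  have err: "Z_norm B (scale_pair (complex_of_real (1 / Z_norm B (x (k j), y (k j)))) (x (k j), y (k j)) - (b j, 0))
      \<le> (1/2) ^ Suc j" for j
    using normalised_block_error(2)[OF c(1) c(2) e(1,2) P(1) P(2)[unfolded p_def], of j]
    unfolding b_def v_def p_def e(3) .
  show ?thesis
  proof (intro exI conjI allI)
    show "strict_mono k" using Q(1) by (simp add: strict_mono_Suc_iff)
    show "block_sequence b"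
      unfolding block_sequence_def
    proof (intro conjI allI ballI)
      fix j i i' assume "i \<in> supp (b j)" "i' \<in> supp (b (Suc j))"
      then have "i < n j" "m (Suc j) \<le> i'" using bs by fastforce+
      then show "i < i'" using Q(2)[of j] by simp
    qed (rule bc)
    fix j
    have b0: "b j - \<Omega> 0 = b j" unfolding Omega_zero by auto
    show "(b j, 0) \<in> Z_space B" using b0 bc[of j] by (simp add: Z_space_def)
    show "Z_norm B (b j, 0) = 1" using b0 b1 norm0 by (simp add: Z_norm_def)
  qed (rule err)
qed

end

text \<open>The squares of the factors of the blocks would span a copy of \<open>\<ell>\<^sub>1\<close> in Tsirelson's space.\<close>

lemma tsirelson_no_linear_blocks:
  fixes u l :: "nat \<Rightarrow> omega" and m n :: "nat \<Rightarrow> nat"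
  assumes sel: "twisted_selection tsirelson2_norm B C"
    and u: "\<And>j i. i < m j \<or> n j \<le> i \<Longrightarrow> u j i = 0" and mn: "\<And>j. m j \<le> n j" "\<And>j. n j \<le> m (Suc j)"
    and u_norm: "\<And>j. \<delta> \<le> ell2_norm (u j)" "\<And>j. ell2_norm (u j) \<le> U" and \<delta>: "0 < \<delta>"
    and l: "\<And>j. ell2_le (restrict_to (- {m j..<m (Suc j)}) (l j)) (\<eta> j)"
    and \<eta>: "\<And>k. (\<Sum>j<k. \<eta> j) \<le> E"
    and lin: "\<And>k a. (\<And>j. 0 \<le> a j) \<Longrightarrow>
      ell2_le (Omega B (\<Sum>j<k. scale (complex_of_real (a j)) (u j)) - (\<Sum>j<k. scale (complex_of_real (a j)) (l j)))
        (K * sqrt (\<Sum>j<k. (a j)\<^sup>2))"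
  shows False
proof -
  interpret twisted_selection tsirelson2_norm B C by (rule sel)
  interpret T: lattice_norm tsirelson_norm by (rule lattice_norm_tsirelson)
  have uc: "u j \<in> c00" for j using u unfolding c00_iff_bound by blast
  have u0: "u j \<noteq> 0" for j
  proof
    assume "u j = 0"
    then show False using u_norm(1)[of j] \<delta> ell2_leD(2)[OF ell2_le_zero] by simp
  qed
  then obtain \<phi> where \<phi>: "\<And>j. factor (u j) (\<phi> j)" using factor_exists[OF uc] by metis
  obtain c where c: "0 < c" and lower: "\<And>k a. (\<And>j. 0 \<le> a j) \<Longrightarrow> c * sqrt (\<Sum>j<k. (a j)\<^sup>2)
      \<le> tsirelson2_norm (\<Sum>j<k. scale (complex_of_real (a j)) (\<lambda>i. complex_of_real (\<phi> j i)))"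
    using block_factors_lower[OF u mn u_norm \<delta> l \<eta> lin \<phi>] by metis
  have mless: "m j < n j" for j
  proof (rule ccontr)
    assume "\<not> m j < n j"
    then have "u j i = 0" for i using u[of i j] by linarith
    then show False using u0[of j] by auto
  qed
  \<comment> \<open>Nonzero blocks have nonempty intervals, so their starting points increase; this
    gives the condition that \<open>h j\<close> vanishes before j.\<close>
  have mj: "j \<le> m j" for j
  proof (induction j)
    case (Suc j)
    then show ?case using mless[of j] mn(2)[of j] by linarith
  qed simp
  have mmono: "m j \<le> m j'" if "j \<le> j'" for j j'
    using that by (rule lift_Suc_mono_le[rotated]) (use mn order_trans in blast)
  have udisj: "j = j'" if "u j i \<noteq> 0" "u j' i \<noteq> 0" for i j j'
  proof (rule ccontr)
    have *: False if "j < j'" "u j i \<noteq> 0" "u j' i \<noteq> 0" for j j'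
    proof -
      have "i < n j" using u[of i j] that(2) by linarith
      also have "\<dots> \<le> m j'" using mn(2)[of j] mmono[of "Suc j" j'] that(1) by simp
      also have "\<dots> \<le> i" using u[of i j'] that(3) by linarith
      finally show False by simp
    qed
    assume "j \<noteq> j'"
    then show False using *[of j j'] *[of j' j] that by (cases j j' rule: linorder_cases) auto
  qed
  define h where "h j = sq_abs (\<lambda>i. complex_of_real (\<phi> j i))" for j
  have \<phi>c: "(\<lambda>i. complex_of_real (\<phi> j i)) \<in> c00" for j by (rule factor_c00[OF uc \<phi>])
  have \<phi>0: "\<phi> j i = 0" if "u j i = 0" for i j using \<phi>[of j] that by (simp add: factor_def)
  have sq: "(tsirelson2_norm z)\<^sup>2 = tsirelson_norm (sq_abs z)" if "z \<in> c00" for z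
    using T.nonneg[of "sq_abs z"] that by (simp add: tsirelson2_eq)
  show False
  proof (rule tsirelson_no_positive_ell1[of h "U\<^sup>2" "c\<^sup>2"])
    show "h j \<in> c00" for j using \<phi>c by (simp add: h_def)
    show "h j i = 0" if "i < j" for i j
      using \<phi>0[of j i] u[of i j] mj[of j] that by (simp add: h_def sq_abs_def)
    show "tsirelson_norm (h j) \<le> U\<^sup>2" for j
    proof -
      have "tsirelson2_norm (\<lambda>i. complex_of_real (\<phi> j i)) \<le> U"
        using \<phi>[of j] u_norm(2)[of j] by (simp add: factor_def)
      then show ?thesis unfolding h_def sq[OF \<phi>c, symmetric] by (intro power_mono nonneg \<phi>c)
    qed
    show "0 < c\<^sup>2" using c by simp
    fix b :: "nat \<Rightarrow> real" and k assume b: "\<And>j. 0 \<le> b j"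
    \<comment> \<open>Square roots of the coefficients, because disjointness gives
      \<open>sq_abs\<close> of the sum the coefficients \<open>b j\<close>.\<close>
    let ?\<psi> = "\<Sum>j<k. scale (complex_of_real (sqrt (b j))) (\<lambda>i. complex_of_real (\<phi> j i))"
    have \<psi>c: "?\<psi> \<in> c00" using \<phi>c by (intro c00_sum c00_scale)
    have "sq_abs ?\<psi> = (\<Sum>j<k. scale (complex_of_real (b j)) (h j))"
    proof
      fix i
      have "(cmod (?\<psi> i))\<^sup>2 = (\<Sum>j<k. (cmod (complex_of_real (sqrt (b j))))\<^sup>2 * (cmod (complex_of_real (\<phi> j i)))\<^sup>2)"
        using udisj \<phi>0 by (intro sum_disjoint_square) (metis of_real_0)
      also have "\<dots> = (\<Sum>j<k. b j * (\<phi> j i)\<^sup>2)" using b by simp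
      finally have "sq_abs ?\<psi> i = complex_of_real (\<Sum>j<k. b j * (\<phi> j i)\<^sup>2)"
        by (simp only: sq_abs_def)
      then show "sq_abs ?\<psi> i = (\<Sum>j<k. scale (complex_of_real (b j)) (h j)) i"
        unfolding sum_omega_apply scale_def h_def sq_abs_def by simp
    qed
    then have "tsirelson_norm (\<Sum>j<k. scale (complex_of_real (b j)) (h j)) = (tsirelson2_norm ?\<psi>)\<^sup>2"
      using sq[OF \<psi>c] by simp
    moreover have "(c * sqrt (\<Sum>j<k. (sqrt (b j))\<^sup>2))\<^sup>2 \<le> (tsirelson2_norm ?\<psi>)\<^sup>2"
      using lower[where a = "\<lambda>j. sqrt (b j)" and k = k] b c by (intro power_mono) (auto simp: sum_nonneg)
    moreover have "(c * sqrt (\<Sum>j<k. (sqrt (b j))\<^sup>2))\<^sup>2 = c\<^sup>2 * (\<Sum>j<k. b j)"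
      using b by (simp add: power_mult_distrib sum_nonneg)
    ultimately show "c\<^sup>2 * (\<Sum>j<k. b j) \<le> tsirelson_norm (\<Sum>j<k. scale (complex_of_real (b j)) (h j))"
      by simp
  qed
qed

section \<open>Conclusion for the 2-convexified Tsirelson space\<close>

lemma homogeneous_selectionE:
  assumes "homogeneous_selection T2 B"
  obtains C where "twisted_selection tsirelson2_norm B C"
proof -
  interpret lattice_norm tsirelson2_norm by (rule lattice_norm_tsirelson2)
  obtain C where C: "\<And>x. x \<in> ell2 \<Longrightarrow> calderon_norm T2 (dual T2) (B x) \<le> C * ell2_norm x"
    using assms unfolding homogeneous_selection_def by blast
  \<comment> \<open>The constant of a selection is not assumed nonnegative, whereas the locale
    requires this.\<close>
  have "twisted_selection tsirelson2_norm B (max C 0)"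
  proof
    fix x assume x: "x \<in> ell2"
    have "C * ell2_norm x \<le> max C 0 * ell2_norm x" using x by (intro mult_right_mono) auto
    then have "calderon_norm T2 (dual T2) (B x) \<le> max C 0 * ell2_norm x" using C[OF x] by linarith
    then show "strip_adm (B x) (max C 0 * ell2_norm x)"
      using assms x unfolding T2_def homogeneous_selection_def by (intro calderon_strip_adm) auto
    show "B x (1/2) = x" using assms x unfolding homogeneous_selection_def by blast
    show "B (scale c x) z = scale c (B x z)" if "z \<in> strip" for c z
      using assms x that unfolding homogeneous_selection_def by blast
  qed simp
  then show ?thesis using that by blast
qed

theorem theorem2:
  fixes B :: "omega \<Rightarrow> complex \<Rightarrow> omega"
  assumes "homogeneous_selection T2 B"
  shows "small_perturbations (Z_space B) (Z_norm B)"
proof -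
  obtain C where sel: "twisted_selection tsirelson2_norm B C"
    using homogeneous_selectionE[OF assms] .
  interpret twisted_selection tsirelson2_norm B C by (rule sel)
  show ?thesis
    unfolding small_perturbations_def
  proof (intro allI impI)
    fix w assume w: "range w \<subseteq> Z_space B \<and> equivalent_to_ell2_basis (Z_norm B) w"
    define x where "x j = fst (w j)" for j
    define y where "y j = snd (w j)" for j
    have wxy: "w j = (x j, y j)" for j by (simp add: x_def y_def)
    obtain c D where c: "0 < c" and
      lower: "\<And>n a. c * sqrt (\<Sum>j<n. (cmod (a j))\<^sup>2) \<le> Z_norm B (\<Sum>j<n. scale_pair (a j) (w j))" and
      upper: "\<And>n a. Z_norm B (\<Sum>j<n. scale_pair (a j) (w j)) \<le> D * sqrt (\<Sum>j<n. (cmod (a j))\<^sup>2)"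
      using w unfolding equivalent_to_ell2_basis_def by blast
    have sum: "(\<Sum>j<n. scale_pair (a j) (w j)) = (\<Sum>j<n. scale (a j) (x j), \<Sum>j<n. scale (a j) (y j))" for n a
      by (intro prod_eqI) (simp_all add: fst_sum snd_sum scale_pair_def wxy)
    have mem: "(x j, y j) \<in> Z_space B" for j using w unfolding wxy[symmetric] by blast
    interpret ell2_sequence tsirelson2_norm B C x y D
    proof
      show "y j \<in> ell2" "x j - \<Omega> (y j) \<in> ell2" for j using mem[of j] by (auto simp: Z_space_def)
      show "Z_norm B (\<Sum>j<n. scale (a j) (x j), \<Sum>j<n. scale (a j) (y j)) \<le> D * sqrt (\<Sum>j<n. (cmod (a j))\<^sup>2)" for n a
        using upper[where n = n and a = a] unfolding sum .
    qed
    \<comment> \<open>Otherwise the second coordinates are bounded below from some index on, and the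
      blocks of \<open>linear_blocks\<close> contradict
      \<open>tsirelson_no_linear_blocks\<close>.\<close>
    have small: "\<exists>k>k0. ell2_norm (y k) < \<epsilon>" if \<epsilon>: "0 < \<epsilon>" for \<epsilon> k0
    proof (rule ccontr)
      assume "\<not> ?thesis"
      then have large: "\<epsilon> \<le> ell2_norm (y j)" if "Suc k0 \<le> j" for j using that by (meson Suc_le_lessD not_less)
      show False
      proof (rule linear_blocks[OF \<epsilon> large])
        fix u l :: "nat \<Rightarrow> omega" and m n :: "nat \<Rightarrow> nat" and \<eta> :: "nat \<Rightarrow> real" and K :: real
        assume blocks:
          "\<And>j i. i < m j \<or> n j \<le> i \<Longrightarrow> u j i = 0" "\<And>j. m j \<le> n j" "\<And>j. n j \<le> m (Suc j)"
          "\<And>j. \<epsilon> / 2 \<le> ell2_norm (u j)" "\<And>j. ell2_norm (u j) \<le> D"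
          "\<And>j. ell2_le (restrict_to (- {m j..<m (Suc j)}) (l j)) (\<eta> j)" "\<And>k. (\<Sum>j<k. \<eta> j) \<le> \<epsilon>"
          "\<And>k a. (\<And>j. 0 \<le> a j) \<Longrightarrow>
            ell2_le (\<Omega> (\<Sum>j<k. scale (complex_of_real (a j)) (u j)) - (\<Sum>j<k. scale (complex_of_real (a j)) (l j)))
              (K * sqrt (\<Sum>j<k. (a j)\<^sup>2))"
        have "0 < \<epsilon> / 2" using \<epsilon> by simp
        from tsirelson_no_linear_blocks[OF sel blocks(1-5) this blocks(6-8)] show False by simp
      qed
    qed
    \<comment> \<open>The lower estimate at a single unit coefficient bounds the normalising
      factors.\<close>
    have "c \<le> Z_norm B (x k, y k)" for k
    proof -
      let ?a = "\<lambda>j. if j = k then 1 else (0::complex)"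
      have "(\<Sum>j<Suc k. scale (?a j) (z j)) = z k" for z :: "nat \<Rightarrow> omega"
        by (auto simp: sum_omega_apply scale_def fun_eq_iff)
      moreover have "(\<Sum>j<Suc k. (cmod (?a j))\<^sup>2) = 1" by (simp add: if_distrib cong: if_cong)
      ultimately show ?thesis using lower[where a = ?a and n = "Suc k"] unfolding sum by simp
    qed
    then show "\<exists>k b. strict_mono (k :: nat \<Rightarrow> nat) \<and> block_sequence b \<and>
      (\<forall>j. (b j, 0) \<in> Z_space B \<and> Z_norm B (b j, 0) = 1 \<and>
        Z_norm B (scale_pair (complex_of_real (1 / Z_norm B (w (k j)))) (w (k j)) - (b j, 0)) \<le> (1/2) ^ Suc j)"
      unfolding wxy using perturbation[OF small c] by blast
  qed
qed

end
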